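(* Let $I\subset\mathbb{R}$ be an open interval and $\Omega\subset\mathbb{R}^n$ an open set. Let $w: I\times\Omega\to(0,\infty)$ be a Borel function uniformly bounded from above and from below on compact subsets of $I\times\Omega$ (i.e. for every compact $K\subset I\times\Omega$ there are constants $0<c_K\le C_K<\infty$ with $c_K\le w\le C_K$ on $K$). Let $\varphi:[0,\infty)\to[0,\infty)$ be a convex function with $\varphi(0)=0$ for which there exists a constant $k_\varphi>0$ such that $$\varphi(a+b)\le k_\varphi\,[\varphi(a)\varphi(b)+\varphi(a)+\varphi(b)]\qquad\text{for all } a,b\in[0,\infty).$$ Let $b\in L^1_{\rm loc}(I;W^{1,1}_{\rm loc}(\Omega;\mathbb{R}^m))\cap C^0(I\times\Omega;\mathbb{R}^m)$ satisfy $$N_{\varphi,w}(|Db|):=\int_I\int_\Omega w(t,x)\,\varphi(|Db(t,x)|)\,\mathrm{d}x\,\mathrm{d}t<\infty.$$ Then there exists a sequence $(b_h)_h\subset C^\infty(I\times\Omega;\mathbb{R}^m)$ such that, as $h\to\infty$, $$b_h\to b \text{ in } L^1_{\rm loc}(I\times\Omega;\mathbb{R}^m),\qquad Db_h\to Db\text{ in }L^1_{\rm loc}(I\times\Omega;\mathbb{R}^{nm}),$$ and $$w\,\varphi(|Db_h|)\to w\,\varphi(|Db|)\quad\text{in } L^1(I\times\Omega).$$ In particular, $\lim_{h\to\infty}N_{\varphi,w}(|Db_h|)=N_{\varphi,w}(|Db|)$.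
   Context: For a function $b=b(t,x)$ of time $t\in I$ and space $x\in\Omega$, $Db$ denotes the (weak) derivative with respect to the spatial variable $x$ only, an $m\times n$ matrix identified with an element of $\mathbb{R}^{nm}$, and $|\cdot|$ is the Euclidean norm. *)

theory Defs
  imports "HOL-Analysis.Analysis"
begin

text \<open>
  Throughout, space is \<open>real ^ 'n\<close>, space-time is \<open>real \<times> (real ^ 'n)\<close>, and an \<open>m \<times> n\<close> matrix is an
  element of \<open>real ^ 'n ^ 'm\<close>, whose norm is the Euclidean norm on \<open>nm\<close>-dimensional space
  (it is not the operator norm).
\<close>

text \<open>Only intended for open \<open>S\<close>, where \<open>at x\<close> sees no point outside \<open>S\<close>.\<close>

primrec Ck_on :: "nat \<Rightarrow> 'a::real_normed_vector set \<Rightarrow> ('a \<Rightarrow> 'b::real_normed_vector) \<Rightarrow> bool" where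
  "Ck_on 0 S f \<longleftrightarrow> continuous_on S f"
| "Ck_on (Suc k) S f \<longleftrightarrow>
     (\<forall>x\<in>S. f differentiable (at x)) \<and> (\<forall>v. Ck_on k S (\<lambda>x. frechet_derivative f (at x) v))"

definition Cinf_on :: "'a::real_normed_vector set \<Rightarrow> ('a \<Rightarrow> 'b::real_normed_vector) \<Rightarrow> bool" where
  "Cinf_on S f \<longleftrightarrow> (\<forall>k. Ck_on k S f)"

definition test_function :: "(real ^ 'n) set \<Rightarrow> (real ^ 'n \<Rightarrow> real) \<Rightarrow> bool" where
  "test_function \<Omega> \<psi> \<longleftrightarrow>
     Cinf_on UNIV \<psi> \<and> compact (closure {x. \<psi> x \<noteq> 0}) \<and> closure {x. \<psi> x \<noteq> 0} \<subseteq> \<Omega>"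

definition locally_integrable_on ::
    "('a::euclidean_space \<Rightarrow> 'b::{banach, second_countable_topology}) \<Rightarrow> 'a set \<Rightarrow> bool"
    (infixr \<open>locally'_integrable'_on\<close> 46) where
  "f locally_integrable_on S \<longleftrightarrow>
     (\<forall>K. compact K \<longrightarrow> K \<subseteq> S \<longrightarrow> f absolutely_integrable_on K)"

text \<open>\<open>u\<close> belongs to \<open>W\<^sup>1\<^sup>,\<^sup>1\<close>-loc of \<open>\<Omega>\<close>, and \<open>V\<close> represents its weak derivative.\<close>

definition W11loc_deriv ::
    "(real ^ 'n) set \<Rightarrow> (real ^ 'n \<Rightarrow> real ^ 'm) \<Rightarrow> (real ^ 'n \<Rightarrow> real ^ 'n ^ 'm) \<Rightarrow> bool" where
  "W11loc_deriv \<Omega> u V \<longleftrightarrow>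
     u locally_integrable_on \<Omega> \<and> V locally_integrable_on \<Omega> \<and>
     (\<forall>\<psi>. test_function \<Omega> \<psi> \<longrightarrow> (\<forall>i j.
        (LINT x:\<Omega>|lebesgue. u x $ i * frechet_derivative \<psi> (at x) (axis j 1)) =
        - (LINT x:\<Omega>|lebesgue. V x $ i $ j * \<psi> x)))"

definition W11_norm ::
    "(real ^ 'n) set \<Rightarrow> (real ^ 'n \<Rightarrow> real ^ 'm) \<Rightarrow> (real ^ 'n \<Rightarrow> real ^ 'n ^ 'm) \<Rightarrow> ennreal" where
  "W11_norm K u V =
     (\<integral>\<^sup>+x\<in>K. ennreal (norm (u x)) \<partial>lebesgue) + (\<integral>\<^sup>+x\<in>K. ennreal (norm (V x)) \<partial>lebesgue)"

text \<open>
  \<open>b\<close> belongs to \<open>L\<^sup>1\<close>-loc of \<open>I\<close> with values in \<open>W\<^sup>1\<^sup>,\<^sup>1\<close>-loc of \<open>\<Omega>\<close>, and \<open>Db\<close> is a (jointly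
  measurable) representative of its weak derivative with respect to the space variable only.
  Joint Lebesgue measurability of \<open>b\<close> and \<open>Db\<close> encodes the strong measurability of
  \<open>t \<mapsto> b(t, \<cdot>)\<close>, the space \<open>W\<^sup>1\<^sup>,\<^sup>1\<close> being separable.
\<close>

definition L1loc_W11loc_deriv ::
    "real set \<Rightarrow> (real ^ 'n) set \<Rightarrow> (real \<times> (real ^ 'n) \<Rightarrow> real ^ 'm)
      \<Rightarrow> (real \<times> (real ^ 'n) \<Rightarrow> real ^ 'n ^ 'm) \<Rightarrow> bool" where
  "L1loc_W11loc_deriv I \<Omega> b Db \<longleftrightarrow>
     b \<in> borel_measurable (lebesgue_on (I \<times> \<Omega>)) \<and>
     Db \<in> borel_measurable (lebesgue_on (I \<times> \<Omega>)) \<and>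
     (AE t in lebesgue. t \<in> I \<longrightarrow> W11loc_deriv \<Omega> (\<lambda>x. b (t, x)) (\<lambda>x. Db (t, x))) \<and>
     (\<forall>J K. compact J \<longrightarrow> J \<subseteq> I \<longrightarrow> compact K \<longrightarrow> K \<subseteq> \<Omega> \<longrightarrow>
        (\<integral>\<^sup>+t\<in>J. W11_norm K (\<lambda>x. b (t, x)) (\<lambda>x. Db (t, x)) \<partial>lebesgue) < \<infinity>)"

text \<open>The classical derivative in the space variable, for smooth functions.\<close>

definition spatial_jacobian ::
    "(real \<times> (real ^ 'n) \<Rightarrow> real ^ 'm) \<Rightarrow> real \<times> (real ^ 'n) \<Rightarrow> real ^ 'n ^ 'm" where
  "spatial_jacobian f = (\<lambda>(t, x). jacobian (\<lambda>y. f (t, y)) (at x))"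

definition N_functional ::
    "real set \<Rightarrow> (real ^ 'n) set \<Rightarrow> (real \<Rightarrow> real) \<Rightarrow> (real \<times> (real ^ 'n) \<Rightarrow> real)
      \<Rightarrow> (real \<times> (real ^ 'n) \<Rightarrow> real) \<Rightarrow> ennreal" where
  "N_functional I \<Omega> \<phi> w g =
     (\<integral>\<^sup>+t\<in>I. (\<integral>\<^sup>+x\<in>\<Omega>. ennreal (w (t, x) * \<phi> (g (t, x))) \<partial>lebesgue) \<partial>lebesgue)"

definition L1_converges ::
    "'a::euclidean_space set \<Rightarrow> (nat \<Rightarrow> 'a \<Rightarrow> 'b::{banach, second_countable_topology})
      \<Rightarrow> ('a \<Rightarrow> 'b) \<Rightarrow> bool" where
  "L1_converges S f g \<longleftrightarrow>
     (\<forall>h. f h absolutely_integrable_on S) \<and> g absolutely_integrable_on S \<and>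
     (\<lambda>h. LINT z:S|lebesgue. norm (f h z - g z)) \<longlonglongrightarrow> 0"

definition L1loc_converges ::
    "'a::euclidean_space set \<Rightarrow> (nat \<Rightarrow> 'a \<Rightarrow> 'b::{banach, second_countable_topology})
      \<Rightarrow> ('a \<Rightarrow> 'b) \<Rightarrow> bool" where
  "L1loc_converges S f g \<longleftrightarrow> (\<forall>K. compact K \<longrightarrow> K \<subseteq> S \<longrightarrow> L1_converges K f g)"

end

theory Submission
  imports Defs
begin

text \<open>
  With a smooth locally finite partition of unity \<open>\<theta>\<^sub>i\<close> of \<open>I \<times> \<Omega>\<close> and space-time mollifiers \<open>\<rho>\<^sub>i\<close>
  of small radius, take \<open>B = (\<Sum>i. \<theta>\<^sub>i (b * \<rho>\<^sub>i))\<close>, where \<open>*\<close> is convolution: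
  mollify first and cut off afterwards. As
  the gradients of the \<open>\<theta>\<^sub>i\<close> sum to zero, the spatial derivative is
  \<open>(\<Sum>i. \<theta>\<^sub>i (Db * \<rho>\<^sub>i)) + (\<Sum>i. (b * \<rho>\<^sub>i - b) \<otimes> D\<theta>\<^sub>i)\<close>. The first sum is a true convex combination, so that
  Jensen's inequality bounds \<open>\<phi>\<close> of its norm by \<open>(\<Sum>i. \<theta>\<^sub>i (\<phi>(|Db|) * \<rho>\<^sub>i))\<close>; the opposite order
  (cut off, then mollify) would produce weights whose sum slightly exceeds one, which \<open>\<phi>\<close>, possibly of
  exponential growth, does not tolerate. The second sum is uniformly small because \<open>b\<close> is continuous,
  and the growth hypothesis on \<open>\<phi>\<close> absorbs it at the price of a constant factor. Hence
  \<open>w \<phi>(|DB|)\<close> exceeds a fixed multiple of \<open>w \<phi>(|Db|)\<close> only by an amount small in \<open>L\<^sup>1\<close>, and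
  almost everywhere convergence of a subsequence gives the claim by dominated convergence.
\<close>

section \<open>Smooth functions\<close>

text \<open>The weight \<open>w\<close> is only measurable and locally bounded, so it never passes
  under a convolution: Jensen's inequality is used for \<phi> alone, and \<open>w\<close> is
  replaced by an upper bound on each compact piece. The i-th local error is therefore made smaller
  than a multiple of 2^-(i+1) divided by bounds for the gradient of the i-th cutoff, for
  \<open>w\<close> and for the volume of the piece; then all errors are summable. The lower bound of
  \<open>w\<close> makes \<open>\<phi>(|Db|)\<close> locally integrable, without which it could not
  be mollified.

  Only the space derivative of \<open>b\<close> is a function, yet the approximants must be smooth
  in time too. The analysis is therefore carried out on an open set \<open>U\<close> of a Euclidean
  space, with a finite family of directions \<open>e j\<close> in which a weak derivative exists;
  time enters only through the choice \<open>e j = (0, axis j 1)\<close> at the end.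

  The constant in front of \<open>w \<phi>(|Db|)\<close> may exceed one, so the bound by itself says
  nothing about convergence of the integrals. It serves as a majorant: the integrand is truncated
  there, and only the truncated part goes through dominated convergence.\<close>

lemma Ck_on_cong:
  assumes "open S" "\<And>x. x \<in> S \<Longrightarrow> f x = g x" "Ck_on k S f"
  shows "Ck_on k S g"
  using assms(2,3)
proof (induction k arbitrary: f g)
  case 0
  then show ?case by (metis Ck_on.simps(1) continuous_on_cong)
next
  case (Suc k)
  have d: "f differentiable (at x)" if "x \<in> S" for x
    using Suc.prems(2) that by simp
  have e: "frechet_derivative f (at x) = frechet_derivative g (at x)" if "x \<in> S" for x
    using frechet_derivative_transform_within_open[OF d[OF that] assms(1) that Suc.prems(1)] by simp
  have "g differentiable (at x)" if "x \<in> S" for x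
    using d[OF that] Suc.prems(1) \<open>open S\<close> that
    by (meson differentiable_def has_derivative_transform_within_open)
  moreover have "Ck_on k S (\<lambda>x. frechet_derivative g (at x) v)" for v
    by (rule Suc.IH[of "\<lambda>x. frechet_derivative f (at x) v"]) (use e Suc.prems(2) in auto)
  ultimately show ?case by simp
qed

lemma Ck_on_subset: "Ck_on k S f \<Longrightarrow> T \<subseteq> S \<Longrightarrow> Ck_on k T f"
proof (induction k arbitrary: f)
  case 0
  then show ?case by (auto intro: continuous_on_subset)
next
  case (Suc k)
  then show ?case by (auto simp: subset_iff)
qed

text \<open>Being C^k at a point depends on a neighbourhood only. This makes the glued series
  smooth, since near each point it is a finite sum.\<close>

lemma Ck_on_local:
  assumes "\<And>x. x \<in> S \<Longrightarrow> \<exists>T. open T \<and> x \<in> T \<and> Ck_on k T f"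
  shows "Ck_on k S f"
  using assms
proof (induction k arbitrary: f)
  case 0
  show ?case
    unfolding Ck_on.simps
  proof (rule continuous_at_imp_continuous_on, rule ballI)
    fix x assume "x \<in> S"
    then show "isCont f x"
      using 0 by (metis Ck_on.simps(1) continuous_on_eq_continuous_at)
  qed
next
  case (Suc k)
  have "f differentiable (at x)" if "x \<in> S" for x
    using Suc.prems[OF that] by auto
  moreover have "Ck_on k S (\<lambda>x. frechet_derivative f (at x) v)" for v
    by (rule Suc.IH) (use Suc.prems in fastforce)
  ultimately show ?case by simp
qed

lemma Ck_on_Suc_D: "Ck_on (Suc k) S f \<Longrightarrow> Ck_on k S f"
proof (induction k arbitrary: f)
  case 0
  then show ?case
    by (auto intro!: continuous_at_imp_continuous_on differentiable_imp_continuous_within)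
next
  case (Suc k)
  then show ?case by (metis Ck_on.simps(2))
qed

lemma Ck_on_const: "Ck_on k S (\<lambda>x. c)"
  by (induction k arbitrary: c) auto

lemma Ck_on_bounded_linear:
  assumes "bounded_linear f"
  shows "Ck_on k S f"
proof (cases k)
  case 0
  then show ?thesis using assms by (simp add: linear_continuous_on)
next
  case (Suc n)
  have "(f has_derivative f) (at x)" for x
    using assms by (rule bounded_linear_imp_has_derivative)
  then have "f differentiable (at x)" "frechet_derivative f (at x) = f" for x
    by (auto simp: differentiable_def frechet_derivative_at[symmetric])
  then show ?thesis using Suc by (simp add: Ck_on_const)
qed

lemma Ck_on_add:
  assumes "open S" "Ck_on k S f" "Ck_on k S g"
  shows "Ck_on k S (\<lambda>x. f x + g x)"
  using assms(2,3)
proof (induction k arbitrary: f g)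
  case 0
  then show ?case by (auto intro: continuous_on_add)
next
  case (Suc k)
  have d: "((\<lambda>x. f x + g x) has_derivative
      (\<lambda>v. frechet_derivative f (at x) v + frechet_derivative g (at x) v)) (at x)" if "x \<in> S" for x
    using Suc.prems that by (intro has_derivative_add) (auto simp flip: frechet_derivative_works)
  have "Ck_on k S (\<lambda>x. frechet_derivative (\<lambda>x. f x + g x) (at x) v)" for v
  proof (rule Ck_on_cong[OF \<open>open S\<close>])
    show "Ck_on k S (\<lambda>x. frechet_derivative f (at x) v + frechet_derivative g (at x) v)"
      by (rule Suc.IH) (use Suc.prems in auto)
  qed (simp flip: frechet_derivative_at[OF d])
  then show ?case using d by (auto simp: differentiable_def)
qed

lemma Ck_on_bilinear:
  assumes "bounded_bilinear h" "open S" "Ck_on k S f" "Ck_on k S g"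
  shows "Ck_on k S (\<lambda>x. h (f x) (g x))"
  using assms(3,4)
proof (induction k arbitrary: f g)
  case 0
  then show ?case using bounded_bilinear.continuous_on[OF assms(1)] by auto
next
  case (Suc k)
  have d: "((\<lambda>x. h (f x) (g x)) has_derivative
      (\<lambda>v. h (f x) (frechet_derivative g (at x) v) + h (frechet_derivative f (at x) v) (g x))) (at x)"
    if "x \<in> S" for x
    using Suc.prems that
    by (intro bounded_bilinear.FDERIV[OF assms(1)]) (auto simp flip: frechet_derivative_works)
  have "Ck_on k S (\<lambda>x. frechet_derivative (\<lambda>x. h (f x) (g x)) (at x) v)" for v
  proof (rule Ck_on_cong[OF \<open>open S\<close>])
    show "Ck_on k S (\<lambda>x. h (f x) (frechet_derivative g (at x) v) + h (frechet_derivative f (at x) v) (g x))"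
      by (intro Ck_on_add[OF \<open>open S\<close>] Suc.IH) (use Suc.prems Ck_on_Suc_D in auto)
  qed (simp flip: frechet_derivative_at[OF d])
  then show ?case using d by (auto simp: differentiable_def)
qed

lemmas Ck_on_scaleR = Ck_on_bilinear[OF bounded_bilinear_scaleR]
lemmas Ck_on_mult = Ck_on_bilinear[OF bounded_bilinear_mult]

lemma Ck_on_sum:
  assumes "open S" "\<And>i. i \<in> A \<Longrightarrow> Ck_on k S (f i)"
  shows "Ck_on k S (\<lambda>x. \<Sum>i\<in>A. f i x)"
  using assms(2)
  by (induction A rule: infinite_finite_induct) (auto intro: Ck_on_const Ck_on_add[OF assms(1)])

text \<open>Needed for two affine maps: the reflection \<open>y \<mapsto> z - y\<close>, which turns
  a mollifier into a test function, and the embedding \<open>x \<mapsto> (t, x)\<close> of a time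
  slice.\<close>

lemma frechet_derivative_comp_affine:
  assumes "bounded_linear L" "f differentiable (at (c + L x))"
  shows "(\<lambda>y. f (c + L y)) differentiable (at x)"
    "frechet_derivative (\<lambda>y. f (c + L y)) (at x) v = frechet_derivative f (at (c + L x)) (L v)"
proof -
  have "((\<lambda>y. c + L y) has_derivative L) (at x)"
    using bounded_linear_imp_has_derivative[OF assms(1)] by (auto intro!: derivative_eq_intros)
  then have d: "((\<lambda>y. f (c + L y)) has_derivative (\<lambda>v. frechet_derivative f (at (c + L x)) (L v))) (at x)"
    using has_derivative_compose assms(2) frechet_derivative_works by blast
  then show "(\<lambda>y. f (c + L y)) differentiable (at x)" by (auto simp: differentiable_def)
  show "frechet_derivative (\<lambda>y. f (c + L y)) (at x) v = frechet_derivative f (at (c + L x)) (L v)"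
    using frechet_derivative_at[OF d] by metis
qed

lemma Ck_on_comp_affine:
  assumes "bounded_linear L" "Ck_on k UNIV f"
  shows "Ck_on k UNIV (\<lambda>y. f (c + L y))"
  using assms(2)
proof (induction k arbitrary: f)
  case 0
  then show ?case
    using continuous_on_compose2[of UNIV f UNIV "\<lambda>y. c + L y"] linear_continuous_on[OF assms(1)]
    by (simp add: continuous_on_add continuous_on_const)
next
  case (Suc k)
  then have "Ck_on k UNIV (\<lambda>y. frechet_derivative f (at (c + L y)) (L v))" for v
    by auto
  with Suc.prems show ?case
    by (auto simp: frechet_derivative_comp_affine[OF assms(1)])
qed

lemma Cinf_onD:
  assumes "Cinf_on S f"
  shows "continuous_on S f" "x \<in> S \<Longrightarrow> f differentiable (at x)"
    "Cinf_on S (\<lambda>x. frechet_derivative f (at x) v)"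
    "continuous_on S (\<lambda>x. frechet_derivative f (at x) v)"
proof -
  show "continuous_on S f" using assms Ck_on.simps(1) unfolding Cinf_on_def by blast
  show "x \<in> S \<Longrightarrow> f differentiable (at x)" using assms Ck_on.simps(2) unfolding Cinf_on_def by blast
  show *: "Cinf_on S (\<lambda>x. frechet_derivative f (at x) v)"
    using assms Ck_on.simps(2) unfolding Cinf_on_def by blast
  show "continuous_on S (\<lambda>x. frechet_derivative f (at x) v)"
    using * Ck_on.simps(1) unfolding Cinf_on_def by blast
qed

text \<open>Closed under differentiation, so that smoothness of the bump function follows by induction.\<close>

definition flat :: "real poly \<Rightarrow> real \<Rightarrow> real" where
  "flat p x = (if x > 0 then poly p (inverse x) * exp (- inverse x) else 0)"

lemma tendsto_poly_exp_at_top: "((\<lambda>y. poly p y * exp (- y)) \<longlongrightarrow> (0::real)) at_top"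
proof -
  have "((\<lambda>y. \<Sum>i\<le>degree p. coeff p i * (y ^ i / exp y)) \<longlongrightarrow> (\<Sum>i\<le>degree p. coeff p i * 0)) at_top"
    by (intro tendsto_sum tendsto_mult tendsto_const tendsto_power_div_exp_0)
  then show ?thesis
    by (simp add: poly_altdef sum_distrib_right exp_minus divide_inverse mult.assoc)
qed

lemma tendsto_flat: "(flat p \<longlongrightarrow> 0) (at 0)"
proof -
  have "(flat p \<longlongrightarrow> 0) (at_right 0)"
  proof (rule Lim_transform_eventually)
    show "((\<lambda>x. poly p (inverse x) * exp (- inverse x)) \<longlongrightarrow> 0) (at_right 0)"
      by (rule filterlim_compose[OF tendsto_poly_exp_at_top filterlim_inverse_at_top_right])
  qed (auto simp: flat_def eventually_at intro: exI[of _ 1])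
  moreover have "(flat p \<longlongrightarrow> 0) (at_left 0)"
    by (rule tendsto_eventually) (auto simp: flat_def eventually_at intro: exI[of _ 1])
  ultimately show ?thesis by (simp add: filterlim_split_at)
qed

text \<open>With y = 1/x the operator d/dx becomes -y^2 d/dy, which sends p(y) exp(-y) to y^2 (p -
  p')(y) exp(-y). At 0 the difference quotient of \<open>flat p\<close> is again a flat function,
  with polynomial X p, and therefore tends to 0.\<close>

lemma DERIV_flat:
  "(flat p has_real_derivative flat (monom 1 2 * (p - pderiv p)) x) (at x)"
proof -
  let ?q = "monom 1 2 * (p - pderiv p)"
  consider "x > 0" | "x < 0" | "x = 0" by linarith
  then show ?thesis
  proof cases
    case 1
    have 2: "(inverse has_real_derivative - (inverse x * inverse x)) (at x)"
      by (rule DERIV_cong[OF DERIV_inverse]) (use 1 in simp_all)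
    have "((\<lambda>x. poly p (inverse x) * exp (- inverse x)) has_real_derivative
        poly (pderiv p) (inverse x) * (- (inverse x * inverse x)) * exp (- inverse x) +
        exp (- inverse x) * - (- (inverse x * inverse x)) * poly p (inverse x)) (at x)"
      by (intro DERIV_mult DERIV_chain2[OF poly_DERIV 2] DERIV_chain2[OF DERIV_exp DERIV_minus[OF 2]])
    then have "((\<lambda>x. poly p (inverse x) * exp (- inverse x)) has_real_derivative flat ?q x) (at x)"
      by (rule DERIV_cong) (use 1 in \<open>simp add: flat_def poly_monom power2_eq_square algebra_simps\<close>)
    then show ?thesis
      by (rule has_field_derivative_transform_within_open[of _ _ _ "{0<..}"])
         (use 1 in \<open>simp_all add: flat_def\<close>)
  next
    case 2
    have "((\<lambda>x. 0) has_real_derivative flat ?q x) (at x)"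
      using 2 by (simp add: flat_def)
    then show ?thesis
      by (rule has_field_derivative_transform_within_open[of _ _ _ "{..<0}"])
         (use 2 in \<open>simp_all add: flat_def\<close>)
  next
    case 3
    have "flat (monom 1 1 * p) = (\<lambda>y. (flat p y - flat p 0) / (y - 0))"
      by (rule ext) (simp add: flat_def poly_monom divide_inverse)
    then have "(\<lambda>y. (flat p y - flat p 0) / (y - 0)) \<midarrow>0\<rightarrow> 0"
      using tendsto_flat[of "monom 1 1 * p"] by metis
    then show ?thesis using 3 by (simp add: has_field_derivative_iff flat_def)
  qed
qed

text \<open>By the chain rule each directional derivative is a function of the same kind times a
  linear function of \<open>z\<close>; hence the induction runs over all \<open>p\<close> at
  once.\<close>

lemma Ck_on_flat_ball: "Ck_on k UNIV (\<lambda>z::'a::real_inner. flat p (r - z \<bullet> z))"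
proof (induction k arbitrary: p)
  case 0
  have "continuous_on UNIV (flat p)"
    using DERIV_flat by (meson DERIV_continuous_on DERIV_subset top_greatest)
  then show ?case
    using continuous_on_compose2[of UNIV "flat p" UNIV "\<lambda>z::'a. r - z \<bullet> z"]
    by (simp add: continuous_on_diff continuous_on_const continuous_on_inner continuous_on_id)
next
  case (Suc k)
  let ?q = "monom 1 2 * (p - pderiv p)"
  have d: "((\<lambda>z::'a. flat p (r - z \<bullet> z)) has_derivative (\<lambda>v. flat ?q (r - z \<bullet> z) * (-2 * (z \<bullet> v)))) (at z)"
    for z
    by (rule has_derivative_eq_rhs[OF has_derivative_compose
          [OF _ DERIV_flat[unfolded has_field_derivative_def]]])
       (auto intro!: derivative_eq_intros simp: inner_commute)
  have "Ck_on k UNIV (\<lambda>z::'a. flat ?q (r - z \<bullet> z) * (-2 * (z \<bullet> v)))" for v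
    by (intro Ck_on_mult Suc.IH Ck_on_const Ck_on_bounded_linear bounded_linear_inner_left) auto
  then show ?case
    using d by (auto simp: differentiable_def simp flip: frechet_derivative_at[OF d])
qed

section \<open>Mollification in \<open>L\<^sup>1\<close>\<close>

text \<open>No scaling family is fixed: the estimates use only the sign, the mass and the radius of
  the support, so they hold for every such kernel of small radius.\<close>

definition mollifier :: "real \<Rightarrow> ('a::euclidean_space \<Rightarrow> real) \<Rightarrow> bool" where
  "mollifier r \<rho> \<longleftrightarrow> Cinf_on UNIV \<rho> \<and> (\<forall>z. 0 \<le> \<rho> z) \<and> (\<forall>z. r \<le> norm z \<longrightarrow> \<rho> z = 0) \<and>
     has_bochner_integral lborel \<rho> 1"

text \<open>The variable \<open>z\<close> sits in the kernel, so that derivatives fall on \<rho> and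
  \<open>f\<close> may be merely integrable and vector-valued.\<close>

definition convolve ::
    "('a::euclidean_space \<Rightarrow> 'b::{banach, second_countable_topology}) \<Rightarrow> ('a \<Rightarrow> real) \<Rightarrow> 'a \<Rightarrow> 'b" where
  "convolve f \<rho> z = (\<integral>y. \<rho> (z - y) *\<^sub>R f y \<partial>lborel)"

lemma Cinf_on_flat_ball: "Cinf_on UNIV (\<lambda>z::'a::real_inner. flat p (r - z \<bullet> z))"
  by (simp add: Cinf_on_def Ck_on_flat_ball)

text \<open>The classical bump exp(-1/(r^2 - |z|^2)), normalised. Its mass is nonzero because it is
  positive on a ball, and a ball is not negligible.\<close>

lemma mollifier_exists:
  assumes "0 < r"
  obtains \<rho> :: "'a::euclidean_space \<Rightarrow> real" where "mollifier r \<rho>"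
proof -
  define \<psi> where "\<psi> = (\<lambda>z::'a. flat 1 (r\<^sup>2 - z \<bullet> z))"
  have C: "Cinf_on UNIV \<psi>" unfolding \<psi>_def by (rule Cinf_on_flat_ball)
  have pos: "0 \<le> \<psi> z" for z by (simp add: \<psi>_def flat_def)
  have out: "\<psi> z = 0" if "r \<le> norm z" for z
    using that assms power_mono[of r "norm z" 2]
    by (auto simp: \<psi>_def flat_def power2_norm_eq_inner)
  have ins: "\<psi> z \<noteq> 0" if "norm z < r" for z
    using that assms power_strict_mono[of "norm z" r 2]
    by (auto simp: \<psi>_def flat_def power2_norm_eq_inner)
  have "integrable lborel (\<lambda>z. indicator (cball 0 r) z *\<^sub>R \<psi> z)"
    by (rule borel_integrable_compact) (use Cinf_onD(1)[OF C] continuous_on_subset in auto)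
  also have "(\<lambda>z. indicator (cball 0 r) z *\<^sub>R \<psi> z) = \<psi>"
    using out by (auto simp: indicator_def fun_eq_iff)
  finally have int: "integrable lborel \<psi>" .
  have "integral\<^sup>L lborel \<psi> \<noteq> 0"
  proof
    assume "integral\<^sup>L lborel \<psi> = 0"
    then have "AE z in lborel. \<psi> z = 0"
      using integral_nonneg_eq_0_iff_AE[OF int] pos by auto
    then have "AE z in lborel. z \<notin> ball (0::'a) r"
      by (rule eventually_mono) (use ins in auto)
    then have "ball (0::'a) r \<in> null_sets lborel"
      by (subst AE_iff_null_sets) auto
    then have "negligible (ball (0::'a) r)"
      by (simp add: negligible_iff_null_sets null_sets_completionI)
    then show False using assms open_not_negligible[of "ball (0::'a) r"] by auto
  qed
  then have pos': "0 < integral\<^sup>L lborel \<psi>"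
    using Bochner_Integration.integral_nonneg[of lborel \<psi>] pos by (simp add: less_le)
  have "mollifier r (\<lambda>z. inverse (integral\<^sup>L lborel \<psi>) * \<psi> z)"
    unfolding mollifier_def
  proof (intro conjI allI impI)
    show "Cinf_on UNIV (\<lambda>z. inverse (integral\<^sup>L lborel \<psi>) * \<psi> z)"
      using C by (auto simp: Cinf_on_def intro!: Ck_on_mult Ck_on_const)
    have "has_bochner_integral lborel (\<lambda>z. inverse (integral\<^sup>L lborel \<psi>) * \<psi> z)
        (inverse (integral\<^sup>L lborel \<psi>) * integral\<^sup>L lborel \<psi>)"
      using int by (intro has_bochner_integral_mult_right) (simp add: has_bochner_integral_integrable)
    then show "has_bochner_integral lborel (\<lambda>z. inverse (integral\<^sup>L lborel \<psi>) * \<psi> z) 1"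
      using pos' by simp
  qed (use pos pos' out in auto)
  then show ?thesis by (rule that)
qed

section \<open>Reflections and translations of Lebesgue measure\<close>

lemma lborel_distr_diff: "distr lborel borel (\<lambda>y. z - y) = (lborel :: 'a::euclidean_space measure)"
  by (subst (2) lborel_affine[of "-1" z]) (auto simp: density_1)

lemma integral_lborel_diff:
  fixes f :: "'a::euclidean_space \<Rightarrow> 'b::{banach, second_countable_topology}"
  assumes "f \<in> borel_measurable borel"
  shows "(\<integral>y. f (z - y) \<partial>lborel) = (\<integral>y. f y \<partial>lborel)"
    and "integrable lborel (\<lambda>y. f (z - y)) \<longleftrightarrow> integrable lborel f"
proof -
  have "(\<integral>y. f y \<partial>lborel) = (\<integral>y. f y \<partial>distr lborel borel (\<lambda>y. z - y))"
    by (simp add: lborel_distr_diff)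
  also have "\<dots> = (\<integral>y. f (z - y) \<partial>lborel)"
    using assms by (subst integral_distr) auto
  finally show "(\<integral>y. f (z - y) \<partial>lborel) = (\<integral>y. f y \<partial>lborel)" ..
  have "integrable lborel f \<longleftrightarrow> integrable (distr lborel borel (\<lambda>y. z - y)) f"
    by (simp add: lborel_distr_diff)
  then show "integrable lborel (\<lambda>y. f (z - y)) \<longleftrightarrow> integrable lborel f"
    using assms by (subst (asm) integrable_distr_eq) auto
qed

lemma nn_integral_lborel_translate:
  fixes f :: "'a::euclidean_space \<Rightarrow> ennreal"
  assumes "f \<in> borel_measurable borel"
  shows "(\<integral>\<^sup>+y. f (y - u) \<partial>lborel) = (\<integral>\<^sup>+y. f y \<partial>lborel)"
proof -
  have "(\<integral>\<^sup>+y. f y \<partial>lborel) = (\<integral>\<^sup>+y. f y \<partial>distr lborel borel ((+) (-u)))"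
    by (simp add: lborel_distr_plus)
  also have "\<dots> = (\<integral>\<^sup>+y. f (y - u) \<partial>lborel)"
    using assms by (subst nn_integral_distr) auto
  finally show ?thesis ..
qed

section \<open>Averages against a mollifier\<close>

lemma mollifierD:
  assumes "mollifier r \<rho>"
  shows "Cinf_on UNIV \<rho>" "0 \<le> \<rho> z" "r \<le> norm z \<Longrightarrow> \<rho> z = 0"
    "continuous_on UNIV \<rho>" "\<rho> \<in> borel_measurable borel"
    "integrable lborel \<rho>" "integral\<^sup>L lborel \<rho> = 1"
    "integrable lborel (\<lambda>y. \<rho> (z - y))" "(\<integral>y. \<rho> (z - y) \<partial>lborel) = 1"
proof -
  show 1: "Cinf_on UNIV \<rho>" "0 \<le> \<rho> z" "r \<le> norm z \<Longrightarrow> \<rho> z = 0"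
    and 2: "integrable lborel \<rho>" "integral\<^sup>L lborel \<rho> = 1"
    using assms by (auto simp: mollifier_def has_bochner_integral_iff)
  show "continuous_on UNIV \<rho>" using Cinf_onD(1)[OF 1(1)] .
  then show m: "\<rho> \<in> borel_measurable borel" by (rule borel_measurable_continuous_onI)
  show "integrable lborel (\<lambda>y. \<rho> (z - y))" "(\<integral>y. \<rho> (z - y) \<partial>lborel) = 1"
    using integral_lborel_diff[OF m] 2 by auto
qed

lemma mollifier_bounded:
  assumes "mollifier r \<rho>"
  obtains C where "\<And>z. norm (\<rho> z) \<le> C"
proof -
  have "bounded (\<rho> ` cball 0 r)"
    by (intro compact_imp_bounded compact_continuous_image compact_cball)
       (use mollifierD(4)[OF assms] continuous_on_subset in auto)
  then obtain C where C: "\<And>z. z \<in> cball 0 r \<Longrightarrow> norm (\<rho> z) \<le> C"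
    unfolding bounded_iff by blast
  have "norm (\<rho> z) \<le> max C 0" for z
    using C[of z] mollifierD(3)[OF assms, of z] by (cases "norm z \<le> r") (auto simp: max_def)
  then show ?thesis by (rule that)
qed

lemma integrable_mollifier_scaleR:
  fixes f :: "'a::euclidean_space \<Rightarrow> 'b::{banach, second_countable_topology}"
  assumes "mollifier r \<rho>" "integrable lborel f"
  shows "integrable lborel (\<lambda>y. \<rho> (z - y) *\<^sub>R f y)"
proof -
  obtain C where C: "\<And>z. norm (\<rho> z) \<le> C" using mollifier_bounded[OF assms(1)] by blast
  have [measurable]: "\<rho> \<in> borel_measurable borel" "f \<in> borel_measurable borel"
    using mollifierD(5)[OF assms(1)] assms(2) by auto
  show ?thesis
    by (rule Bochner_Integration.integrable_bound[OF integrable_scaleR_right[OF assms(2), of C]])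
       (auto intro!: AE_I2 mult_right_mono order_trans[OF C[unfolded real_norm_def] abs_ge_self])
qed

text \<open>The kernel has mass one, so \<open>convolve f \<rho> z - c\<close> is an average of
  \<open>f - c\<close> over the ball of radius \<open>r\<close> about \<open>z\<close>. With
  \<open>c = f z\<close> this yields uniform approximation; with \<eta> = 0 it shows that a locally
  constant value survives mollification.\<close>

lemma convolve_dist_le:
  assumes "mollifier r \<rho>" "integrable lborel f" "\<And>y. norm (z - y) < r \<Longrightarrow> norm (f y - c) \<le> \<eta>"
  shows "norm (convolve f \<rho> z - c) \<le> \<eta>"
proof -
  note m = mollifierD[OF assms(1)]
  have "convolve f \<rho> z - c = (\<integral>y. \<rho> (z - y) *\<^sub>R f y \<partial>lborel) - (\<integral>y. \<rho> (z - y) *\<^sub>R c \<partial>lborel)"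
    using m(8,9)[of z] by (simp add: convolve_def)
  also have "\<dots> = (\<integral>y. \<rho> (z - y) *\<^sub>R (f y - c) \<partial>lborel)"
    using m(8)[of z] integrable_mollifier_scaleR[OF assms(1,2), of z]
    by (simp add: scaleR_diff_right)
  finally have eq: "convolve f \<rho> z - c = (\<integral>y. \<rho> (z - y) *\<^sub>R (f y - c) \<partial>lborel)" .
  have le: "norm (\<rho> (z - y) *\<^sub>R (f y - c)) \<le> \<rho> (z - y) * \<eta>" for y
    using assms(3)[of y] m(2,3)[of "z - y"] by (cases "norm (z - y) < r") (auto intro!: mult_left_mono)
  have "integrable lborel (\<lambda>y. \<rho> (z - y) *\<^sub>R (f y - c))"
    using m(8)[of z] integrable_mollifier_scaleR[OF assms(1,2), of z]
    by (simp add: scaleR_diff_right)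
  then have "norm (\<integral>y. \<rho> (z - y) *\<^sub>R (f y - c) \<partial>lborel) \<le> (\<integral>y. \<rho> (z - y) * \<eta> \<partial>lborel)"
    using m(8)[of z] le
    by (intro order_trans[OF integral_norm_bound] integral_mono integrable_norm) auto
  then show ?thesis using m(8,9)[of z] eq by simp
qed

lemma convolve_real_bounds:
  fixes f :: "'a::euclidean_space \<Rightarrow> real"
  assumes "mollifier r \<rho>" "integrable lborel f" "\<And>y. 0 \<le> f y" "\<And>y. f y \<le> 1"
  shows "0 \<le> convolve f \<rho> z" "convolve f \<rho> z \<le> 1"
proof -
  \<comment> \<open>The interval from 0 to 1 is the ball of radius 1/2 about 1/2, so both bounds
    follow from one distance estimate.\<close>
  have "norm (convolve f \<rho> z - 1/2) \<le> 1/2"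
  proof (rule convolve_dist_le[OF assms(1,2)])
    show "norm (f y - 1/2) \<le> 1/2" for y
      using assms(3,4)[of y] unfolding real_norm_def by arith
  qed
  then show "0 \<le> convolve f \<rho> z" "convolve f \<rho> z \<le> 1" unfolding real_norm_def by arith+
qed

section \<open>Smoothness of convolutions\<close>

text \<open>Differentiation under the integral sign over a box containing the support of
  \<open>f\<close>. The kernel is an arbitrary smooth function rather than a mollifier, because the
  result is iterated with the derivatives of the kernel.\<close>

lemma convolve_has_derivative:
  fixes f :: "'a::euclidean_space \<Rightarrow> 'b::euclidean_space"
  assumes f: "continuous_on UNIV f" and supp: "\<And>y. y \<notin> cbox a c \<Longrightarrow> f y = 0" and g: "Cinf_on UNIV g"
  shows "(convolve f g has_derivative (\<lambda>v. convolve f (\<lambda>x. frechet_derivative g (at x) v) z)) (at z)"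
proof -
  \<comment> \<open>\<open>leibniz_rule\<close> speaks of the gauge integral over a box; this
    identifies it with the Lebesgue integral that defines \<open>convolve\<close>.\<close>
  have conv: "integral (cbox a c) (\<lambda>y. h (z - y) *\<^sub>R f y) = convolve f h z"
    if "continuous_on UNIV h" for h :: "'a \<Rightarrow> real" and z
  proof -
    have "continuous_on (cbox a c) (\<lambda>y. h (z - y) *\<^sub>R f y)"
      by (intro continuous_intros continuous_on_compose2[OF that] continuous_on_subset[OF f]) auto
    then have "set_integrable lborel (cbox a c) (\<lambda>y. h (z - y) *\<^sub>R f y)"
      unfolding set_integrable_def by (intro borel_integrable_compact) auto
    from set_borel_integral_eq_integral(2)[OF this]
    have "integral (cbox a c) (\<lambda>y. h (z - y) *\<^sub>R f y) = (LINT y:cbox a c|lborel. h (z - y) *\<^sub>R f y)"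
      by simp
    also have "\<dots> = convolve f h z"
      unfolding convolve_def set_lebesgue_integral_def
      by (rule Bochner_Integration.integral_cong) (use supp in \<open>auto simp: indicator_def\<close>)
    finally show ?thesis .
  qed
  note cg = Cinf_onD(1)[OF g] and cg' = Cinf_onD(4)[OF g]
  have dg: "(g has_derivative frechet_derivative g (at x)) (at x)" for x
    using Cinf_onD(2)[OF g] by (simp flip: frechet_derivative_works)
  have bl: "bounded_linear (\<lambda>v. frechet_derivative g (at x) v *\<^sub>R w)" for x and w :: 'b
    by (rule bounded_linear_compose[OF bounded_linear_scaleR_left has_derivative_bounded_linear[OF dg]])
  \<comment> \<open>The derivative has to be a bounded linear map depending continuously on both
    variables. In finite dimension this continuity can be checked one vector at a time.\<close>
  define fx where "fx z y = Blinfun (\<lambda>v. frechet_derivative g (at (z - y)) v *\<^sub>R f y)" for z y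
  have fx: "blinfun_apply (fx z y) v = frechet_derivative g (at (z - y)) v *\<^sub>R f y" for z y v
    unfolding fx_def by (simp add: bounded_linear_Blinfun_apply[OF bl])
  have cfx: "continuous_on UNIV (\<lambda>(z, y). fx z y)"
  proof (rule continuous_on_blinfun_componentwise)
    fix v
    have "continuous_on UNIV (\<lambda>p. frechet_derivative g (at (fst p - snd p)) v *\<^sub>R f (snd p))"
      by (intro continuous_intros continuous_on_compose2[OF cg'] continuous_on_compose2[OF f]) auto
    then show "continuous_on UNIV (\<lambda>p. blinfun_apply (case p of (z, y) \<Rightarrow> fx z y) v)"
      by (simp add: case_prod_beta fx)
  qed
  have "((\<lambda>z. integral (cbox a c) (\<lambda>y. g (z - y) *\<^sub>R f y)) has_derivative
      blinfun_apply (integral (cbox a c) (fx z))) (at z within UNIV)"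
  proof (rule leibniz_rule)
    fix x t
    have "((\<lambda>x. g (x - t)) has_derivative frechet_derivative g (at (x - t))) (at x)"
      by (rule has_derivative_compose[of "\<lambda>x. x - t" "\<lambda>v. v", OF _ dg])
         (auto intro!: derivative_eq_intros)
    then show "((\<lambda>x. g (x - t) *\<^sub>R f t) has_derivative blinfun_apply (fx x t)) (at x within UNIV)"
      unfolding fx[abs_def] by (intro has_derivative_scaleR_left) simp
  next
    show "(\<lambda>y. g (x - y) *\<^sub>R f y) integrable_on cbox a c" for x
      by (intro integrable_continuous continuous_intros continuous_on_compose2[OF cg]
          continuous_on_subset[OF f]) auto
  qed (use cfx continuous_on_subset in auto)
  moreover
  have "blinfun_apply (integral (cbox a c) (fx z)) v = convolve f (\<lambda>x. frechet_derivative g (at x) v) z" for v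
  proof -
    have "continuous_on (cbox a c) (fx z)"
      using continuous_on_compose2[OF cfx, of "cbox a c" "\<lambda>y. (z, y)"]
      by (simp add: continuous_on_Pair continuous_on_const continuous_on_id)
    then have "fx z integrable_on cbox a c" by (rule integrable_continuous)
    from integral_linear[OF this blinfun.bounded_linear_left[of v]]
    have "blinfun_apply (integral (cbox a c) (fx z)) v = integral (cbox a c) (\<lambda>y. blinfun_apply (fx z y) v)"
      by (simp add: o_def)
    then show ?thesis using conv[OF cg', of z v] by (simp add: fx)
  qed
  then have "blinfun_apply (integral (cbox a c) (fx z)) = (\<lambda>v. convolve f (\<lambda>x. frechet_derivative g (at x) v) z)"
    by (rule ext)
  ultimately show ?thesis
    by (simp add: conv[OF cg])
qed

lemma convolve_smooth:
  fixes f :: "'a::euclidean_space \<Rightarrow> 'b::euclidean_space"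
  assumes f: "continuous_on UNIV f" and supp: "\<And>y. y \<notin> cbox a c \<Longrightarrow> f y = 0" and g: "Cinf_on UNIV g"
  shows "Cinf_on UNIV (convolve f g)"
    and "frechet_derivative (convolve f g) (at z) v = convolve f (\<lambda>x. frechet_derivative g (at x) v) z"
proof -
  have *: "convolve f g differentiable (at z)"
    "frechet_derivative (convolve f g) (at z) v = convolve f (\<lambda>x. frechet_derivative g (at x) v) z"
    if "Cinf_on UNIV g" for g z v
  proof -
    have d: "(convolve f g has_derivative (\<lambda>v. convolve f (\<lambda>x. frechet_derivative g (at x) v) z)) (at z)"
      by (rule convolve_has_derivative[OF f supp that])
    then show "convolve f g differentiable (at z)" by (auto simp: differentiable_def)
    show "frechet_derivative (convolve f g) (at z) v = convolve f (\<lambda>x. frechet_derivative g (at x) v) z"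
      using frechet_derivative_at[OF d] by metis
  qed
  then show "frechet_derivative (convolve f g) (at z) v = convolve f (\<lambda>x. frechet_derivative g (at x) v) z"
    using g by blast
  have "Ck_on k UNIV (convolve f g)" for k
    using g
  proof (induction k arbitrary: g)
    case 0
    then show ?case using *(1) by (auto intro!: continuous_at_imp_continuous_on differentiable_imp_continuous_within)
  next
    case (Suc k)
    then show ?case using * Cinf_onD(3)[OF Suc.prems] by (auto simp: fun_eq_iff)
  qed
  then show "Cinf_on UNIV (convolve f g)" by (simp add: Cinf_on_def)
qed

section \<open>Continuity of translations in L1\<close>

text \<open>The L1 distance is translation invariant, so replacing \<open>f\<close> by
  \<open>g\<close> costs \<eta>/3 both before and after the shift. The property thus passes to L1
  limits.\<close>

lemma translation_L1_approx:
  fixes f :: "'a::euclidean_space \<Rightarrow> 'b::{banach, second_countable_topology}"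
  assumes f: "f \<in> borel_measurable borel"
    and g: "\<And>\<eta>. 0 < \<eta> \<Longrightarrow> \<exists>g. g \<in> borel_measurable borel \<and>
      (\<integral>\<^sup>+z. norm (g z - f z) \<partial>lborel) \<le> ennreal \<eta> \<and>
      (\<exists>\<delta>>0. \<forall>u. norm u < \<delta> \<longrightarrow> (\<integral>\<^sup>+z. norm (g (z - u) - g z) \<partial>lborel) \<le> ennreal \<eta>)"
    and "0 < \<eta>"
  shows "\<exists>\<delta>>0. \<forall>u. norm u < \<delta> \<longrightarrow> (\<integral>\<^sup>+z. norm (f (z - u) - f z) \<partial>lborel) \<le> ennreal \<eta>"
proof -
  obtain g \<delta> where m: "g \<in> borel_measurable borel"
    and 1: "(\<integral>\<^sup>+z. norm (g z - f z) \<partial>lborel) \<le> ennreal (\<eta>/3)" and "\<delta> > 0"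
    and 2: "\<And>u. norm u < \<delta> \<Longrightarrow> (\<integral>\<^sup>+z. norm (g (z - u) - g z) \<partial>lborel) \<le> ennreal (\<eta>/3)"
    using g[of "\<eta>/3"] \<open>0 < \<eta>\<close> by (auto simp del: ennreal_numeral)
  note [measurable] = f m
  show ?thesis
  proof (intro exI conjI allI impI)
    fix u :: 'a assume u: "norm u < \<delta>"
    have 3: "(\<integral>\<^sup>+z. norm (g (z - u) - f (z - u)) \<partial>lborel) \<le> ennreal (\<eta>/3)"
      using nn_integral_lborel_translate[of "\<lambda>z. norm (g z - f z)" u] 1 by simp
    have tri: "norm (f (z - u) - f z) \<le>
        norm (g (z - u) - f (z - u)) + norm (g (z - u) - g z) + norm (g z - f z)" for z
      using norm_triangle_ineq[of "(f (z - u) - g (z - u)) + (g (z - u) - g z)" "g z - f z"]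
        norm_triangle_ineq[of "f (z - u) - g (z - u)" "g (z - u) - g z"]
      by (simp add: norm_minus_commute)
    have "(\<integral>\<^sup>+z. norm (f (z - u) - f z) \<partial>lborel) \<le>
        (\<integral>\<^sup>+z. norm (g (z - u) - f (z - u)) + ennreal (norm (g (z - u) - g z)) + norm (g z - f z) \<partial>lborel)"
      using tri by (intro nn_integral_mono) (simp flip: ennreal_plus)
    also have "\<dots> = (\<integral>\<^sup>+z. norm (g (z - u) - f (z - u)) \<partial>lborel) +
        (\<integral>\<^sup>+z. norm (g (z - u) - g z) \<partial>lborel) + (\<integral>\<^sup>+z. norm (g z - f z) \<partial>lborel)"
      by (simp add: nn_integral_add)
    also have "\<dots> \<le> ennreal (\<eta>/3) + ennreal (\<eta>/3) + ennreal (\<eta>/3)"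
      by (intro add_mono 1 2 3 u)
    also have "\<dots> = ennreal \<eta>" using \<open>0 < \<eta>\<close> by (simp flip: ennreal_plus)
    finally show "(\<integral>\<^sup>+z. norm (f (z - u) - f z) \<partial>lborel) \<le> ennreal \<eta>" .
  qed fact
qed

lemma translation_L1_continuous_compact_support:
  fixes g :: "'a::euclidean_space \<Rightarrow> 'b::{banach, second_countable_topology}"
  assumes g: "continuous_on UNIV g" and supp: "\<And>z. R \<le> norm z \<Longrightarrow> g z = 0" and "0 < \<eta>"
  shows "\<exists>\<delta>>0. \<forall>u. norm u < \<delta> \<longrightarrow> (\<integral>\<^sup>+z. norm (g (z - u) - g z) \<partial>lborel) \<le> ennreal \<eta>"
proof -
  define S where "S = cball (0::'a) (R + 1)"
  \<comment> \<open>The added 1 keeps the divisor positive even if \<open>S\<close> is null.\<close>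
  define M where "M = measure lborel S + 1"
  have M: "M > 0" unfolding M_def by (rule add_nonneg_pos) (rule measure_nonneg, simp)
  have eS: "emeasure lborel S \<le> ennreal M"
    unfolding M_def S_def
    using emeasure_lborel_cball_finite[of "0::'a" "R+1"]
    by (subst emeasure_eq_ennreal_measure) (auto intro!: ennreal_leI simp del: ennreal_plus)
  \<comment> \<open>For |u| < 1 the difference \<open>g (z - u) - g z\<close> lives in the ball of
    radius \<open>R + 1\<close>, and the larger ball contains \<open>z - u\<close> as well.\<close>
  have "uniformly_continuous_on (cball (0::'a) (R + 2)) g"
    by (intro compact_uniformly_continuous compact_cball continuous_on_subset[OF g]) auto
  then obtain d where d: "d > 0" "\<And>x y. \<lbrakk>x \<in> cball 0 (R+2); y \<in> cball 0 (R+2); dist y x < d\<rbrakk> \<Longrightarrow> dist (g y) (g x) < \<eta> / M"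
    using \<open>0 < \<eta>\<close> M by (elim uniformly_continuous_onE[of _ _ "\<eta> / M"]) simp_all
  show ?thesis
  proof (intro exI[of _ "min d 1"] conjI allI impI)
    fix u :: 'a assume u: "norm u < min d 1"
    have "norm (g (z - u) - g z) \<le> \<eta> / M * indicator S z" for z
    proof (cases "norm z \<le> R + 1")
      case True
      have "norm (z - u) \<le> norm z + norm u" by (rule norm_triangle_ineq4)
      then have "norm (g (z - u) - g z) < \<eta> / M"
        using True d(2)[of z "z - u"] u by (simp add: dist_norm norm_minus_commute)
      then show ?thesis using True by (simp add: S_def indicator_def)
    next
      case False
      have "norm z \<le> norm (z - u) + norm u" using norm_triangle_ineq[of "z - u" u] by simp
      then show ?thesis using False u supp[of z] supp[of "z - u"] by (simp add: S_def indicator_def)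
    qed
    note le = this
    have "(\<integral>\<^sup>+z. norm (g (z - u) - g z) \<partial>lborel) \<le> (\<integral>\<^sup>+z. ennreal (\<eta> / M) * indicator S z \<partial>lborel)"
    proof (intro nn_integral_mono)
      fix z
      show "ennreal (norm (g (z - u) - g z)) \<le> ennreal (\<eta> / M) * indicator S z"
        using ennreal_leI[OF le[of z]] M \<open>0 < \<eta>\<close> by (cases "z \<in> S") simp_all
    qed
    also have "\<dots> = ennreal (\<eta> / M) * emeasure lborel S"
      by (subst nn_integral_cmult_indicator) (auto simp: S_def)
    also have "\<dots> \<le> ennreal (\<eta> / M) * ennreal M" by (intro mult_left_mono eS) simp
    also have "\<dots> = ennreal \<eta>" using M \<open>0 < \<eta>\<close> by (simp flip: ennreal_mult)
    finally show "(\<integral>\<^sup>+z. norm (g (z - u) - g z) \<partial>lborel) \<le> ennreal \<eta>" .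
  qed (use d in auto)
qed

text \<open>By regularity of the measure, \<open>A\<close> lies between a closed \<open>C\<close>
  and an open \<open>V\<close> of nearly the same measure. A Urysohn function for this pair differs
  from the indicator only on \<open>V - C\<close>, is continuous, and has bounded support because
  \<open>V\<close> is cut by the ball.\<close>

lemma translation_L1_indicator_bounded:
  fixes c :: "'b::{banach, second_countable_topology}" and A :: "'a::euclidean_space set"
  assumes A: "A \<in> sets borel" "A \<subseteq> ball 0 R" and "0 < \<eta>"
  shows "\<exists>\<delta>>0. \<forall>u. norm u < \<delta> \<longrightarrow>
    (\<integral>\<^sup>+z. norm (indicator A (z - u) *\<^sub>R c - indicator A z *\<^sub>R c) \<partial>lborel) \<le> ennreal \<eta>"
proof (rule translation_L1_approx[OF _ _ \<open>0 < \<eta>\<close>])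
  show "(\<lambda>z. indicat_real A z *\<^sub>R c) \<in> borel_measurable borel" using A by measurable
next
  fix \<eta> :: real assume "0 < \<eta>"
  \<comment> \<open>Each of the two regularity errors is below \<open>e\<close>, so the total error
    is at most |c| * 2e, which this choice keeps below \<eta>; the 1 covers
    \<open>c = 0\<close>.\<close>
  define e where "e = \<eta> / (2 * (norm c + 1))"
  have "e > 0" using \<open>0 < \<eta>\<close> by (simp add: e_def add_nonneg_pos)
  have AL: "A \<in> sets lebesgue" using A(1) by auto
  obtain T where T: "open T" "A \<subseteq> T" "emeasure lebesgue (T - A) < ennreal e"
    using sets_lebesgue_outer_open[OF AL \<open>e > 0\<close>] by metis
  obtain C where C: "closed C" "C \<subseteq> A" "emeasure lebesgue (A - C) < ennreal e"
    using sets_lebesgue_inner_closed[OF AL \<open>e > 0\<close>] by metis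
  define V where "V = T \<inter> ball 0 R"
  have V: "open V" "A \<subseteq> V" using T A by (auto simp: V_def)
  obtain h :: "'a \<Rightarrow> real" where h: "continuous_on UNIV h" "\<And>x. h x \<in> closed_segment 1 0"
     "\<And>x. x \<in> C \<Longrightarrow> h x = 1" "\<And>x. x \<in> - V \<Longrightarrow> h x = 0"
    using Urysohn[of C "- V" 1 "0::real"] C V by auto
  have h01: "0 \<le> h x" "h x \<le> 1" for x using h(2)[of x] by (auto simp: closed_segment_eq_real_ivl)
  have cg: "continuous_on UNIV (\<lambda>z. h z *\<^sub>R c)" by (intro continuous_intros h)
  have le: "norm (h z *\<^sub>R c - indicator A z *\<^sub>R c) \<le> norm c * indicator (V - C) z" for z
  proof -
    have "\<bar>h z - indicator A z\<bar> \<le> indicator (V - C) z"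
      using h(3)[of z] h(4)[of z] h01[of z] C(2) V(2) by (auto simp: indicator_def)
    from mult_right_mono[OF this, of "norm c"] show ?thesis
      by (simp add: mult.commute flip: scaleR_diff_left)
  qed
  have [measurable]: "V \<in> sets borel" "C \<in> sets borel" "T \<in> sets borel" "A \<in> sets borel"
    using V C T A by auto
  have "emeasure lborel (V - C) \<le> emeasure lborel ((T - A) \<union> (A - C))"
    by (rule emeasure_mono) (use V_def in auto)
  also have "\<dots> \<le> emeasure lborel (T - A) + emeasure lborel (A - C)"
    by (rule emeasure_subadditive) auto
  also have "\<dots> \<le> ennreal e + ennreal e"
    using T(3) C(3) by (intro add_mono) auto
  finally have VC: "emeasure lborel (V - C) \<le> ennreal (2 * e)"
    using \<open>e > 0\<close> by (simp flip: ennreal_plus)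
  have "(\<integral>\<^sup>+z. norm (h z *\<^sub>R c - indicator A z *\<^sub>R c) \<partial>lborel) \<le>
      (\<integral>\<^sup>+z. ennreal (norm c) * indicator (V - C) z \<partial>lborel)"
  proof (rule nn_integral_mono)
    fix z show "ennreal (norm (h z *\<^sub>R c - indicator A z *\<^sub>R c)) \<le> ennreal (norm c) * indicator (V - C) z"
      using ennreal_leI[OF le[of z]] by (simp add: ennreal_mult ennreal_indicator)
  qed
  also have "\<dots> = ennreal (norm c) * emeasure lborel (V - C)"
    by (subst nn_integral_cmult_indicator) auto
  also have "\<dots> \<le> ennreal (norm c) * ennreal (2 * e)"
    by (intro mult_left_mono VC) simp
  also have "\<dots> \<le> ennreal \<eta>"
  proof -
    have "norm c * (2 * e) = \<eta> * (norm c / (norm c + 1))"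
      using add_nonneg_pos[OF norm_ge_zero[of c] zero_less_one] by (simp add: e_def field_simps)
    also have "\<dots> \<le> \<eta> * 1"
      using \<open>0 < \<eta>\<close> by (intro mult_left_mono) (auto simp: divide_le_eq_1 add_nonneg_pos)
    finally show ?thesis using \<open>e > 0\<close> by (simp add: ennreal_leI flip: ennreal_mult)
  qed
  finally have "(\<integral>\<^sup>+z. norm (h z *\<^sub>R c - indicator A z *\<^sub>R c) \<partial>lborel) \<le> ennreal \<eta>" .
  moreover have "\<exists>\<delta>>0. \<forall>u. norm u < \<delta> \<longrightarrow> (\<integral>\<^sup>+z. norm (h (z - u) *\<^sub>R c - h z *\<^sub>R c) \<partial>lborel) \<le> ennreal \<eta>"
    by (rule translation_L1_continuous_compact_support[OF cg, of R, OF _ \<open>0 < \<eta>\<close>])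
       (use h(4) in \<open>auto simp: V_def\<close>)
  ultimately show "\<exists>g. g \<in> borel_measurable borel \<and>
      (\<integral>\<^sup>+z. norm (g z - indicat_real A z *\<^sub>R c) \<partial>lborel) \<le> ennreal \<eta> \<and>
      (\<exists>\<delta>>0. \<forall>u. norm u < \<delta> \<longrightarrow> (\<integral>\<^sup>+z. norm (g (z - u) - g z) \<partial>lborel) \<le> ennreal \<eta>)"
    using borel_measurable_continuous_onI[OF cg] by blast
qed

lemma translation_L1_lim:
  fixes f :: "'a::euclidean_space \<Rightarrow> 'b::{banach, second_countable_topology}"
  assumes s: "\<And>i. s i \<in> borel_measurable borel"
      "\<And>i \<eta>. 0 < \<eta> \<Longrightarrow> \<exists>\<delta>>0. \<forall>u. norm u < \<delta> \<longrightarrow> (\<integral>\<^sup>+z. norm (s i (z - u) - s i z) \<partial>lborel) \<le> ennreal \<eta>"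
    and f: "f \<in> borel_measurable borel" and lim: "(\<lambda>i. \<integral>\<^sup>+z. norm (f z - s i z) \<partial>lborel) \<longlonglongrightarrow> 0"
    and "0 < \<eta>"
  shows "\<exists>\<delta>>0. \<forall>u. norm u < \<delta> \<longrightarrow> (\<integral>\<^sup>+z. norm (f (z - u) - f z) \<partial>lborel) \<le> ennreal \<eta>"
proof (rule translation_L1_approx[OF f _ \<open>0 < \<eta>\<close>])
  fix \<eta> :: real assume "0 < \<eta>"
  then have "\<forall>\<^sub>F i in sequentially. (\<integral>\<^sup>+z. norm (f z - s i z) \<partial>lborel) < ennreal \<eta>"
    using order_tendstoD(2)[OF lim, of "ennreal \<eta>"] by simp
  then obtain i where "(\<integral>\<^sup>+z. norm (f z - s i z) \<partial>lborel) < ennreal \<eta>"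
    using eventually_happens'[OF sequentially_bot] by blast
  then show "\<exists>g. g \<in> borel_measurable borel \<and>
      (\<integral>\<^sup>+z. norm (g z - f z) \<partial>lborel) \<le> ennreal \<eta> \<and>
      (\<exists>\<delta>>0. \<forall>u. norm u < \<delta> \<longrightarrow> (\<integral>\<^sup>+z. norm (g (z - u) - g z) \<partial>lborel) \<le> ennreal \<eta>)"
    using s \<open>0 < \<eta>\<close> by (intro exI[of _ "s i"]) (simp add: norm_minus_commute less_imp_le)
qed

text \<open>\<open>integrable_induct\<close> leaves indicators, sums and limits. A set of finite
  measure need not be bounded, so its indicator is first exhausted by intersections with
  balls.\<close>

lemma translation_L1_continuous:
  fixes f :: "'a::euclidean_space \<Rightarrow> 'b::{banach, second_countable_topology}"
  assumes "integrable lborel f" "0 < \<eta>"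
  shows "\<exists>\<delta>>0. \<forall>u. norm u < \<delta> \<longrightarrow> (\<integral>\<^sup>+z. norm (f (z - u) - f z) \<partial>lborel) \<le> ennreal \<eta>"
  using assms
proof (induction f arbitrary: \<eta> rule: integrable_induct)
  case (base A c)
  show ?case
  proof (rule translation_L1_lim[OF _ _ _ _ base(3)])
    show "(\<lambda>z. indicat_real (A \<inter> ball 0 (real i)) z *\<^sub>R c) \<in> borel_measurable borel" for i
      using base by (intro borel_measurable_scaleR borel_measurable_indicator) auto
    show "(\<lambda>z. indicat_real A z *\<^sub>R c) \<in> borel_measurable borel"
      using base by (intro borel_measurable_scaleR borel_measurable_indicator) auto
    show "\<exists>\<delta>>0. \<forall>u. norm u < \<delta> \<longrightarrow>
      (\<integral>\<^sup>+z. norm (indicator (A \<inter> ball 0 (real i)) (z - u) *\<^sub>R c - indicator (A \<inter> ball 0 (real i)) z *\<^sub>R c) \<partial>lborel) \<le> ennreal \<eta>"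
      if "0 < \<eta>" for i \<eta>
      by (rule translation_L1_indicator_bounded[OF _ _ that, where R="real i"]) (use base in auto)
    show "(\<lambda>i. \<integral>\<^sup>+z. norm (indicator A z *\<^sub>R c - indicator (A \<inter> ball 0 (real i)) z *\<^sub>R c) \<partial>lborel) \<longlonglongrightarrow> 0"
    proof (rule nn_integral_dominated_convergence_norm[where w="\<lambda>z. norm c * indicator A z"])
      show "(\<integral>\<^sup>+z. norm c * indicator A z \<partial>lborel) < \<infinity>"
        using base by (simp add: ennreal_mult ennreal_indicator nn_integral_cmult_indicator ennreal_mult_less_top)
      show "AE z in lborel. (\<lambda>i. indicat_real (A \<inter> ball 0 (real i)) z *\<^sub>R c) \<longlonglongrightarrow> indicator A z *\<^sub>R c"
      proof (rule AE_I2, rule tendsto_eventually)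
        fix z :: 'a
        obtain N where "norm z < real N" using reals_Archimedean2 by blast
        then show "\<forall>\<^sub>F i in sequentially. indicat_real (A \<inter> ball 0 (real i)) z *\<^sub>R c = indicator A z *\<^sub>R c"
          by (intro eventually_sequentiallyI[of N]) (auto simp: indicator_def)
      qed
    qed (use base in \<open>auto simp: indicator_def\<close>)
  qed
next
  case (add f g)
  obtain d1 d2 where d: "d1 > 0" "d2 > 0"
    "\<And>u. norm u < d1 \<Longrightarrow> (\<integral>\<^sup>+z. norm (f (z - u) - f z) \<partial>lborel) \<le> ennreal (\<eta>/2)"
    "\<And>u. norm u < d2 \<Longrightarrow> (\<integral>\<^sup>+z. norm (g (z - u) - g z) \<partial>lborel) \<le> ennreal (\<eta>/2)"
    using add.IH[of "\<eta>/2"] \<open>0 < \<eta>\<close> by (auto simp del: ennreal_numeral)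
  have [measurable]: "f \<in> borel_measurable borel" "g \<in> borel_measurable borel" using add.hyps by auto
  show ?case
  proof (intro exI[of _ "min d1 d2"] conjI allI impI)
    fix u :: 'a assume u: "norm u < min d1 d2"
    have "(\<integral>\<^sup>+z. norm (f (z - u) + g (z - u) - (f z + g z)) \<partial>lborel) \<le>
        (\<integral>\<^sup>+z. ennreal (norm (f (z - u) - f z)) + norm (g (z - u) - g z) \<partial>lborel)"
      by (intro nn_integral_mono) (simp add: norm_diff_triangle_ineq flip: ennreal_plus)
    also have "\<dots> = (\<integral>\<^sup>+z. norm (f (z - u) - f z) \<partial>lborel) + (\<integral>\<^sup>+z. norm (g (z - u) - g z) \<partial>lborel)"
      by (simp add: nn_integral_add)
    also have "\<dots> \<le> ennreal (\<eta>/2) + ennreal (\<eta>/2)" by (intro add_mono d) (use u in auto)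
    also have "\<dots> = ennreal \<eta>" using \<open>0 < \<eta>\<close> by (simp flip: ennreal_plus)
    finally show "(\<integral>\<^sup>+z. norm (f (z - u) + g (z - u) - (f z + g z)) \<partial>lborel) \<le> ennreal \<eta>" .
  qed (use d in auto)
next
  case (lim f s)
  show ?case
  proof (rule translation_L1_lim[OF _ _ _ _ lim.prems, where s=s])
    show "(\<lambda>i. \<integral>\<^sup>+z. norm (f z - s i z) \<partial>lborel) \<longlonglongrightarrow> 0"
    \<comment> \<open>The approximants supplied by \<open>integrable_induct\<close> are bounded by
      twice the norm of the limit.\<close>
    proof (rule nn_integral_dominated_convergence_norm[where w="\<lambda>z. 2 * norm (f z)"])
      show "(\<integral>\<^sup>+z. 2 * norm (f z) \<partial>lborel) < \<infinity>"
        using lim.hyps(4) borel_measurable_integrable[OF lim.hyps(4)]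
        by (simp add: integrable_iff_bounded ennreal_mult nn_integral_cmult ennreal_mult_less_top)
    qed (use lim.hyps in auto)
  qed (use lim in auto)
qed

text \<open>Since the kernel has mass one, \<open>convolve f \<rho> - f\<close> is the
  \<rho>-average of the translation differences of \<open>f\<close>. Tonelli moves the L1 norm
  inside the average, where only shifts of size below \<open>r\<close> count; so \<delta> depends on
  \<open>f\<close> and \<eta> but not on the kernel.\<close>

lemma convolve_L1_approx:
  fixes f :: "'a::euclidean_space \<Rightarrow> 'b::{banach, second_countable_topology}"
  assumes f: "integrable lborel f" and "0 < \<eta>"
  shows "\<exists>\<delta>>0. \<forall>r \<rho>. r \<le> \<delta> \<longrightarrow> mollifier r \<rho> \<longrightarrow>
    (\<integral>\<^sup>+z. norm (convolve f \<rho> z - f z) \<partial>lborel) \<le> ennreal \<eta>"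
proof -
  obtain \<delta> where "\<delta> > 0"
    and \<delta>: "\<And>u. norm u < \<delta> \<Longrightarrow> (\<integral>\<^sup>+z. norm (f (z - u) - f z) \<partial>lborel) \<le> ennreal \<eta>"
    using translation_L1_continuous[OF assms] by blast
  have "(\<integral>\<^sup>+z. norm (convolve f \<rho> z - f z) \<partial>lborel) \<le> ennreal \<eta>"
    if "r \<le> \<delta>" and mo: "mollifier r \<rho>" for r \<rho>
  proof -
    note m = mollifierD[OF mo]
    have fm[measurable]: "f \<in> borel_measurable borel" using f by auto
    have [measurable]: "\<rho> \<in> borel_measurable borel" by (rule m(5))
    have le: "ennreal (norm (convolve f \<rho> z - f z)) \<le> (\<integral>\<^sup>+u. ennreal (\<rho> u) * norm (f (z - u) - f z) \<partial>lborel)" for z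
    proof -
      have meas: "(\<lambda>y. \<rho> (z - y) *\<^sub>R f y) \<in> borel_measurable borel" by measurable
      have i: "integrable lborel (\<lambda>u. \<rho> u *\<^sub>R f (z - u))"
        using integral_lborel_diff(2)[OF meas, of z] integrable_mollifier_scaleR[OF mo f, of z] by simp
      have "convolve f \<rho> z = (\<integral>u. \<rho> u *\<^sub>R f (z - u) \<partial>lborel)"
        using integral_lborel_diff(1)[OF meas, of z] by (simp add: convolve_def)
      also have "\<dots> - f z = (\<integral>u. \<rho> u *\<^sub>R (f (z - u) - f z) \<partial>lborel)"
        using i m(6,7) by (simp add: scaleR_diff_right)
      finally have "convolve f \<rho> z - f z = (\<integral>u. \<rho> u *\<^sub>R (f (z - u) - f z) \<partial>lborel)" .
      also have "ennreal (norm \<dots>) \<le> (\<integral>\<^sup>+u. norm (\<rho> u *\<^sub>R (f (z - u) - f z)) \<partial>lborel)"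
        using i m(6) by (intro integral_norm_bound_ennreal) (simp add: scaleR_diff_right)
      finally show ?thesis using m(2) by (simp add: ennreal_mult)
    qed
    have "(\<integral>\<^sup>+z. norm (convolve f \<rho> z - f z) \<partial>lborel) \<le>
        (\<integral>\<^sup>+z. \<integral>\<^sup>+u. ennreal (\<rho> u) * norm (f (z - u) - f z) \<partial>lborel \<partial>lborel)"
      by (intro nn_integral_mono le)
    also have "\<dots> = (\<integral>\<^sup>+u. \<integral>\<^sup>+z. ennreal (\<rho> u) * norm (f (z - u) - f z) \<partial>lborel \<partial>lborel)"
      by (rule lborel_pair.Fubini') measurable
    also have "\<dots> = (\<integral>\<^sup>+u. ennreal (\<rho> u) * (\<integral>\<^sup>+z. norm (f (z - u) - f z) \<partial>lborel) \<partial>lborel)"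
      by (simp add: nn_integral_cmult)
    also have "\<dots> \<le> (\<integral>\<^sup>+u. ennreal (\<rho> u) * ennreal \<eta> \<partial>lborel)"
    proof (rule nn_integral_mono)
      fix u
      show "ennreal (\<rho> u) * (\<integral>\<^sup>+z. norm (f (z - u) - f z) \<partial>lborel) \<le> ennreal (\<rho> u) * ennreal \<eta>"
        using m(3)[of u] \<delta>[of u] \<open>r \<le> \<delta>\<close> by (cases "norm u < r") (auto intro!: mult_left_mono)
    qed
    also have "\<dots> = ennreal \<eta>"
      using nn_integral_eq_integral[OF m(6)] m(2,7) by (simp add: nn_integral_multc)
    finally show ?thesis .
  qed
  then show ?thesis using \<open>\<delta> > 0\<close> by blast
qed

section \<open>Jensen's inequality for mollification\<close>

text \<open>Writing \<open>s\<close> as a convex combination of 0 and \<open>t\<close> gives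
  \<open>\<phi> s \<le> (s/t) * \<phi> t\<close>, and nonnegativity of \<open>\<phi> t\<close>
  allows the factor to be dropped.\<close>

lemma convex_on_nonneg_mono:
  fixes \<phi> :: "real \<Rightarrow> real"
  assumes "convex_on {0..} \<phi>" "\<phi> 0 = 0" "\<And>a. 0 \<le> a \<Longrightarrow> 0 \<le> \<phi> a" "0 \<le> s" "s \<le> t"
  shows "\<phi> s \<le> \<phi> t"
proof (cases "t = 0")
  case False
  have "\<phi> ((1 - s/t) *\<^sub>R 0 + (s/t) *\<^sub>R t) \<le> (1 - s/t) * \<phi> 0 + (s/t) * \<phi> t"
    by (rule convex_onD[OF assms(1)]) (use assms False in auto)
  also have "\<dots> \<le> \<phi> t"
    using assms False mult_right_mono[of "s / t" 1 "\<phi> t"] by simp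
  finally show ?thesis using False by simp
qed (use assms in auto)

text \<open>The right derivative at \<open>m\<close> provides the supporting line in Jensen's inequality.\<close>

lemma convolve_jensen:
  fixes f :: "'a::euclidean_space \<Rightarrow> 'b::{banach, second_countable_topology}" and \<phi> :: "real \<Rightarrow> real"
  assumes \<phi>: "convex_on {0..} \<phi>" "\<phi> 0 = 0" "\<And>a. 0 \<le> a \<Longrightarrow> 0 \<le> \<phi> a"
    and mo: "mollifier r \<rho>" and f: "integrable lborel f" and \<phi>f: "integrable lborel (\<lambda>y. \<phi> (norm (f y)))"
  shows "\<phi> (norm (convolve f \<rho> z)) \<le> convolve (\<lambda>y. \<phi> (norm (f y))) \<rho> z"
proof -
  note m = mollifierD[OF mo]
  \<comment> \<open>Jensen's inequality is applied to the scalar function \<open>norm f\<close>. Its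
    average \<open>s\<close> dominates the norm of the average of \<open>f\<close>, and monotonicity
    of \<phi> bridges the two.\<close>
  define s where "s = convolve (\<lambda>y. norm (f y)) \<rho> z"
  have i1: "integrable lborel (\<lambda>y. \<rho> (z - y) * norm (f y))"
    using integrable_mollifier_scaleR[OF mo integrable_norm[OF f], of z] by simp
  have i2: "integrable lborel (\<lambda>y. \<rho> (z - y) * \<phi> (norm (f y)))"
    using integrable_mollifier_scaleR[OF mo \<phi>f, of z] by simp
  have s: "s = (\<integral>y. \<rho> (z - y) * norm (f y) \<partial>lborel)" by (simp add: s_def convolve_def)
  have "norm (convolve f \<rho> z) \<le> (\<integral>y. norm (\<rho> (z - y) *\<^sub>R f y) \<partial>lborel)"
    unfolding convolve_def by (rule integral_norm_bound)
  then have le: "norm (convolve f \<rho> z) \<le> s" using m(2) by (simp add: s)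
  have "\<phi> s \<le> convolve (\<lambda>y. \<phi> (norm (f y))) \<rho> z"
  proof (cases "s = 0")
    \<comment> \<open>The supporting line is available at interior points of the half-line only; at
      the endpoint \<open>\<phi> s\<close> is 0.\<close>
    case True
    then show ?thesis using \<phi> m(2) by (auto simp: convolve_def intro!: Bochner_Integration.integral_nonneg)
  next
    case False
    then have "0 < s" using le norm_ge_zero[of "convolve f \<rho> z"] by linarith
    then obtain A where A: "\<And>y. 0 \<le> y \<Longrightarrow> \<phi> s + A * (y - s) \<le> \<phi> y"
      using convex_le_Inf_differential[OF \<phi>(1), of s] by (auto simp: interior_real_atLeast)
    have "\<phi> s = (\<integral>y. \<rho> (z - y) * (\<phi> s - A * s) + A * (\<rho> (z - y) * norm (f y)) \<partial>lborel)"
      using i1 m(8,9)[of z] s by simp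
    also have "\<dots> \<le> (\<integral>y. \<rho> (z - y) * \<phi> (norm (f y)) \<partial>lborel)"
    proof (rule integral_mono)
      fix y
      show "\<rho> (z - y) * (\<phi> s - A * s) + A * (\<rho> (z - y) * norm (f y)) \<le> \<rho> (z - y) * \<phi> (norm (f y))"
        using mult_left_mono[OF A[of "norm (f y)"] m(2)[of "z - y"]] by (simp add: algebra_simps)
    qed (use i1 i2 m(8)[of z] in auto)
    finally show ?thesis by (simp add: convolve_def)
  qed
  then show ?thesis
    using convex_on_nonneg_mono[OF \<phi> norm_ge_zero le] by linarith
qed

section \<open>Local approximation\<close>

lemma integrable_continuous_compact_support:
  fixes f :: "'a::euclidean_space \<Rightarrow> 'b::{banach, second_countable_topology}"
  assumes "continuous_on UNIV f" "compact L" "\<And>z. z \<notin> L \<Longrightarrow> f z = 0"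
  shows "integrable lborel f"
proof -
  have "integrable lborel (\<lambda>z. indicator L z *\<^sub>R f z)"
    using assms by (intro borel_integrable_compact continuous_on_subset[OF assms(1)]) auto
  also have "(\<lambda>z. indicator L z *\<^sub>R f z) = f"
    using assms(3) by (auto simp: indicator_def fun_eq_iff)
  finally show ?thesis .
qed

text \<open>A trapezoidal function of the distance to \<open>K\<close>, equal to 1 up to distance
  e/2 and to 0 from 3e/4 on, is mollified at radius e/4. The margins leave the value 1 on
  \<open>K\<close> and 0 at distance more than e.\<close>

lemma smooth_cutoff:
  fixes K V :: "'a::euclidean_space set"
  assumes "compact K" "open V" "K \<subseteq> V"
  obtains \<zeta> :: "'a \<Rightarrow> real" and L where "Cinf_on UNIV \<zeta>" "\<And>z. 0 \<le> \<zeta> z" "\<And>z. \<zeta> z \<le> 1"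
    "\<And>z. z \<in> K \<Longrightarrow> \<zeta> z = 1" "compact L" "L \<subseteq> V" "\<And>z. z \<notin> L \<Longrightarrow> \<zeta> z = 0"
proof (cases "K = {}")
  \<comment> \<open>\<open>infdist\<close> to the empty set is 0 by convention, so the construction
    from the distance would not give a compact \<open>L\<close> here.\<close>
  case True
  show ?thesis
    by (rule that[of "\<lambda>_. 0" "{}"]) (auto simp: True Cinf_on_def Ck_on_const)
next
  case False
  obtain e where e: "e > 0" "(\<Union>x\<in>K. cball x e) \<subseteq> V"
    using compact_subset_open_imp_cball_epsilon_subset[OF assms] by auto
  define f where "f = (\<lambda>y. max 0 (min 1 (3 - 4 * infdist y K / e)))"
  define L where "L = {x. infdist x K \<le> e}"
  have cL: "compact L" unfolding L_def by (rule compact_infdist_le[OF False assms(1) e(1)])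
  have LV: "L \<subseteq> V"
  proof
    fix x assume "x \<in> L"
    obtain k where "k \<in> K" "infdist x K = dist x k"
      using infdist_attains_inf[OF compact_imp_closed[OF assms(1)] False] by blast
    then show "x \<in> V" using \<open>x \<in> L\<close> e(2) by (force simp: L_def dist_commute)
  qed
  have cf: "continuous_on UNIV f"
    unfolding f_def by (intro continuous_intros continuous_on_infdist) (use e in auto)
  have f0: "f y = 0" if "3 * e / 4 \<le> infdist y K" for y
    using that e(1) by (simp add: f_def field_simps max_def min_def)
  have f1: "f y = 1" if "infdist y K \<le> e / 2" for y
    using that e(1) by (simp add: f_def field_simps max_def min_def)
  have f01: "0 \<le> f y" "f y \<le> 1" for y by (auto simp: f_def)
  have fL: "f y = 0" if "y \<notin> L" for y using f0[of y] that e(1) by (simp add: L_def)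
  have fi: "integrable lborel f" by (rule integrable_continuous_compact_support[OF cf cL fL])
  obtain \<rho> :: "'a \<Rightarrow> real" where \<rho>: "mollifier (e/4) \<rho>" using mollifier_exists[of "e/4"] e(1) by auto
  obtain a c where "L \<subseteq> cbox a c" using bounded_subset_cbox_symmetric[OF compact_imp_bounded[OF cL]] by blast
  then have fac: "f y = 0" if "y \<notin> cbox a c" for y using that fL by blast
  show ?thesis
  proof (rule that[of "convolve f \<rho>" L])
    show "Cinf_on UNIV (convolve f \<rho>)"
      by (rule convolve_smooth(1)[OF cf fac mollifierD(1)[OF \<rho>]])
    show "0 \<le> convolve f \<rho> z" "convolve f \<rho> z \<le> 1" for z
      using convolve_real_bounds[OF \<rho> fi f01] by auto
    show "convolve f \<rho> z = 1" if "z \<in> K" for z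
    proof -
      have "f y - 1 = 0" if "norm (z - y) < e / 4" for y
        using infdist_le[OF \<open>z \<in> K\<close>, of y] that f1[of y] e(1) by (simp add: dist_norm norm_minus_commute)
      then have "norm (convolve f \<rho> z - 1) \<le> 0"
        by (intro convolve_dist_le[OF \<rho> fi]) auto
      then show ?thesis by simp
    qed
    show "convolve f \<rho> z = 0" if "z \<notin> L" for z
    proof -
      have "f y - 0 = 0" if y: "norm (z - y) < e / 4" for y
      proof -
        have "infdist z K \<le> infdist y K + dist z y" by (rule infdist_triangle)
        then show ?thesis using f0[of y] y \<open>z \<notin> L\<close> e(1) by (simp add: L_def dist_norm)
      qed
      then have "norm (convolve f \<rho> z - 0) \<le> 0"
        by (intro convolve_dist_le[OF \<rho> fi]) auto
      then show ?thesis by simp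
    qed
  qed (use cL LV in auto)
qed

text \<open>The values of \<open>b\<close> outside \<open>U\<close> are arbitrary; the cutoff
  vanishes there, and the open sets \<open>U\<close> and \<open>- L\<close> cover the space.\<close>

lemma continuous_on_UNIV_cutoff:
  fixes \<zeta> :: "'a::t2_space \<Rightarrow> real" and b :: "'a \<Rightarrow> 'b::real_normed_vector"
  assumes "open U" "continuous_on U b" "continuous_on UNIV \<zeta>"
    and "compact L" "L \<subseteq> U" "\<And>z. z \<notin> L \<Longrightarrow> \<zeta> z = 0"
  shows "continuous_on UNIV (\<lambda>z. \<zeta> z *\<^sub>R b z)"
proof -
  have "continuous_on U (\<lambda>z. \<zeta> z *\<^sub>R b z)"
    by (intro continuous_intros assms(2) continuous_on_subset[OF assms(3)]) auto
  moreover have "continuous_on (- L) (\<lambda>z. \<zeta> z *\<^sub>R b z)"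
    by (rule continuous_on_eq[of _ "\<lambda>_. 0"]) (use assms(6) in auto)
  ultimately have "continuous_on (U \<union> - L) (\<lambda>z. \<zeta> z *\<^sub>R b z)"
    using assms(1) compact_imp_closed[OF assms(4)] by (intro continuous_on_open_Un) auto
  moreover have "U \<union> - L = UNIV" using assms(5) by auto
  ultimately show ?thesis by simp
qed

text \<open>The function \<open>y \<mapsto> \<rho> (z - y)\<close> is the test function that
  converts the weak derivative into the derivative of a convolution. The last fact needs the strict
  inequality: the derivative is computed in the open complement of the closed ball.\<close>

lemma mollifier_reflect:
  fixes \<rho> :: "'a::euclidean_space \<Rightarrow> real"
  assumes "mollifier r \<rho>"
  shows "Cinf_on UNIV (\<lambda>y. \<rho> (z - y))"
    "frechet_derivative (\<lambda>y. \<rho> (z - y)) (at y) v = - frechet_derivative \<rho> (at (z - y)) v"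
    "closure {y. \<rho> (z - y) \<noteq> 0} \<subseteq> cball z r"
    "r < norm x \<Longrightarrow> frechet_derivative \<rho> (at x) v = 0"
proof -
  note m = mollifierD[OF assms]
  have bl: "bounded_linear (\<lambda>y::'a. - y)" by (rule bounded_linear_minus[OF bounded_linear_ident])
  show "Cinf_on UNIV (\<lambda>y. \<rho> (z - y))"
    using Ck_on_comp_affine[OF bl, of _ \<rho> z] m(1) by (simp add: Cinf_on_def)
  have d: "\<rho> differentiable (at x)" for x using Cinf_onD(2)[OF m(1)] by simp
  show "frechet_derivative (\<lambda>y. \<rho> (z - y)) (at y) v = - frechet_derivative \<rho> (at (z - y)) v"
    using frechet_derivative_comp_affine(2)[OF bl, of \<rho> z y v] d
      linear_neg[OF linear_frechet_derivative[OF d]] by simp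
  show "closure {y. \<rho> (z - y) \<noteq> 0} \<subseteq> cball z r"
  proof (rule closure_minimal)
    show "{y. \<rho> (z - y) \<noteq> 0} \<subseteq> cball z r"
      using m(3) by (force simp: dist_norm)
  qed auto
  show "frechet_derivative \<rho> (at x) v = 0" if "r < norm x"
  proof -
    have "frechet_derivative \<rho> (at x) = frechet_derivative (\<lambda>_. 0) (at x)"
      by (rule frechet_derivative_transform_within_open[OF d, of "- cball 0 r"])
         (use that m(3) in auto)
    then show ?thesis by simp
  qed
qed

lemma vec_matrix_nth_integral:
  fixes f :: "'a \<Rightarrow> real ^ 'n ^ 'm"
  assumes "integrable M f"
  shows "(\<integral>x. f x \<partial>M) $ i $ j = (\<integral>x. f x $ i $ j \<partial>M)"
proof -
  have "bounded_linear (\<lambda>A :: real ^ 'n ^ 'm. A $ i $ j)"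
    by (rule bounded_linear_compose[OF bounded_linear_vec_nth bounded_linear_vec_nth])
  from integral_bounded_linear[OF this assms] show ?thesis by simp
qed

text \<open>For a small-radius mollifier, \<open>B\<close> mollifies a smoothly cut off
  \<open>b\<close>, while \<open>G\<close> and \<open>H\<close> mollify \<open>D\<close> and
  \<open>\<phi> (norm D)\<close> restricted to \<open>L\<close>. From points of \<open>K\<close> the
  kernel sees only \<open>L\<close>, where both truncations are invisible, so \<open>G\<close> is
  the derivative of \<open>B\<close> on \<open>K\<close> with no term from the cutoff.
  \<open>H\<close> is recorded separately because Jensen bounds \<open>\<phi> (norm G)\<close> by
  it, and \<open>H\<close> is a function whose L1 distance to \<open>\<phi> (norm D)\<close> is
  controlled.\<close>

lemma local_approx:
  fixes U :: "'a::euclidean_space set" and e :: "'n::finite \<Rightarrow> 'a"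
    and b :: "'a \<Rightarrow> real ^ 'm" and D :: "'a \<Rightarrow> real ^ 'n ^ 'm" and \<phi> :: "real \<Rightarrow> real"
  assumes U: "open U" and b: "continuous_on U b" and D: "D \<in> borel_measurable borel"
    and D_int: "\<And>K. compact K \<Longrightarrow> K \<subseteq> U \<Longrightarrow> integrable lborel (\<lambda>z. indicator K z *\<^sub>R D z)"
    and weak: "\<And>\<psi> i j. Cinf_on UNIV \<psi> \<Longrightarrow> compact (closure {z. \<psi> z \<noteq> 0}) \<Longrightarrow> closure {z. \<psi> z \<noteq> 0} \<subseteq> U \<Longrightarrow>
      (LINT z:U|lborel. b z $ i * frechet_derivative \<psi> (at z) (e j)) = - (LINT z:U|lborel. D z $ i $ j * \<psi> z)"
    and \<phi>: "convex_on {0..} \<phi>" "\<phi> 0 = 0" "\<And>a. 0 \<le> a \<Longrightarrow> 0 \<le> \<phi> a"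
    and \<phi>_int: "\<And>K. compact K \<Longrightarrow> K \<subseteq> U \<Longrightarrow> integrable lborel (\<lambda>z. indicator K z * \<phi> (norm (D z)))"
    and K: "compact K" "K \<subseteq> interior L" and L: "compact L" "L \<subseteq> U" and "0 < \<eta>"
  obtains B G H where "Cinf_on UNIV B" "G \<in> borel_measurable borel" "H \<in> borel_measurable borel"
    "\<And>z. z \<in> K \<Longrightarrow> norm (B z - b z) \<le> \<eta>"
    "\<And>z i j. z \<in> K \<Longrightarrow> frechet_derivative B (at z) (e j) $ i = G z $ i $ j"
    "\<And>z. z \<in> K \<Longrightarrow> \<phi> (norm (G z)) \<le> H z"
    "(\<integral>\<^sup>+z\<in>K. norm (G z - D z) \<partial>lborel) \<le> ennreal \<eta>"
    "(\<integral>\<^sup>+z\<in>K. \<bar>H z - \<phi> (norm (D z))\<bar> \<partial>lborel) \<le> ennreal \<eta>"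
proof -
  obtain \<epsilon>1 where \<epsilon>1: "\<epsilon>1 > 0" "(\<Union>x\<in>K. cball x \<epsilon>1) \<subseteq> interior L"
    using compact_subset_open_imp_cball_epsilon_subset[OF K(1) open_interior K(2)] by auto
  have inL: "y \<in> L" if "z \<in> K" "norm (z - y) \<le> \<epsilon>1" for z y
    using that \<epsilon>1(2) interior_subset[of L] by (force simp: dist_norm)
  have KL: "K \<subseteq> L" using K(2) interior_subset by blast
  obtain \<zeta> L' where \<zeta>: "Cinf_on UNIV \<zeta>" "\<And>z. z \<in> L \<Longrightarrow> \<zeta> z = (1::real)" "compact L'" "L' \<subseteq> U"
      "\<And>z. z \<notin> L' \<Longrightarrow> \<zeta> z = 0"
    using smooth_cutoff[OF L(1) U L(2)] by metis
  \<comment> \<open>\<open>b\<close> has to stay continuous and therefore gets a smooth cutoff; for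
    \<open>D\<close>, which is only integrable, an indicator will do.\<close>
  define f where "f = (\<lambda>z. \<zeta> z *\<^sub>R b z)"
  have cf: "continuous_on UNIV f" unfolding f_def
    by (rule continuous_on_UNIV_cutoff[OF U b Cinf_onD(1)[OF \<zeta>(1)] \<zeta>(3-5)])
  have fL': "f z = 0" if "z \<notin> L'" for z using \<zeta>(5)[OF that] by (simp add: f_def)
  have fb: "f z = b z" if "z \<in> L" for z using \<zeta>(2)[OF that] by (simp add: f_def)
  have fi: "integrable lborel f" by (rule integrable_continuous_compact_support[OF cf \<zeta>(3) fL'])
  obtain a c where "L' \<subseteq> cbox a c" using bounded_subset_cbox_symmetric[OF compact_imp_bounded[OF \<zeta>(3)]] by blast
  then have fac: "f y = 0" if "y \<notin> cbox a c" for y using that fL' by blast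
  have "uniformly_continuous_on L f"
    by (intro compact_uniformly_continuous L continuous_on_subset[OF cf]) auto
  then obtain \<epsilon>2 where \<epsilon>2: "\<epsilon>2 > 0" "\<And>x y. \<lbrakk>x \<in> L; y \<in> L; dist y x < \<epsilon>2\<rbrakk> \<Longrightarrow> dist (f y) (f x) < \<eta>"
    using \<open>0 < \<eta>\<close> by (elim uniformly_continuous_onE[of _ _ \<eta>]) simp_all
  define DL where "DL = (\<lambda>z. indicator L z *\<^sub>R D z)"
  have \<phi>DL: "\<phi> (norm (DL z)) = indicator L z * \<phi> (norm (D z))" for z
    using \<phi>(2) by (simp add: DL_def indicator_def)
  have DLi: "integrable lborel DL" unfolding DL_def by (rule D_int[OF L])
  have \<phi>i: "integrable lborel (\<lambda>z. \<phi> (norm (DL z)))" unfolding \<phi>DL by (rule \<phi>_int[OF L])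
  obtain \<delta>1 where \<delta>1: "\<delta>1 > 0" "\<And>r \<rho>. r \<le> \<delta>1 \<Longrightarrow> mollifier r \<rho> \<Longrightarrow>
      (\<integral>\<^sup>+z. norm (convolve DL \<rho> z - DL z) \<partial>lborel) \<le> ennreal \<eta>"
    using convolve_L1_approx[OF DLi \<open>0 < \<eta>\<close>] by blast
  obtain \<delta>2 where \<delta>2: "\<delta>2 > 0" "\<And>r \<rho>. r \<le> \<delta>2 \<Longrightarrow> mollifier r \<rho> \<Longrightarrow>
      (\<integral>\<^sup>+z. norm (convolve (\<lambda>z. \<phi> (norm (DL z))) \<rho> z - \<phi> (norm (DL z))) \<partial>lborel) \<le> ennreal \<eta>"
    using convolve_L1_approx[OF \<phi>i \<open>0 < \<eta>\<close>] by blast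
  \<comment> \<open>Four constraints: the kernel stays inside \<open>L\<close>, \<open>f\<close>
    oscillates by less than \<eta>, and the two mollification errors in L1 are at most
    \<eta>.\<close>
  define r where "r = min (min \<epsilon>1 \<epsilon>2) (min \<delta>1 \<delta>2)"
  have r: "r > 0" "r \<le> \<epsilon>1" "r \<le> \<epsilon>2" "r \<le> \<delta>1" "r \<le> \<delta>2"
    using \<epsilon>1 \<epsilon>2 \<delta>1 \<delta>2 by (auto simp: r_def)
  obtain \<rho> :: "'a \<Rightarrow> real" where \<rho>: "mollifier r \<rho>" using mollifier_exists[OF r(1)] by blast
  note m = mollifierD[OF \<rho>] and mr = mollifier_reflect[OF \<rho>]
  have [measurable]: "\<rho> \<in> borel_measurable borel" "DL \<in> borel_measurable borel"
      "(\<lambda>z. \<phi> (norm (DL z))) \<in> borel_measurable borel"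
    using m(5) DLi \<phi>i by auto
  show ?thesis
  proof (rule that)
    show "Cinf_on UNIV (convolve f \<rho>)" by (rule convolve_smooth(1)[OF cf fac m(1)])
    show "convolve DL \<rho> \<in> borel_measurable borel"
      "convolve (\<lambda>z. \<phi> (norm (DL z))) \<rho> \<in> borel_measurable borel"
      unfolding convolve_def[abs_def] by measurable
    fix z assume z: "z \<in> K"
    then have zL: "z \<in> L" using KL by blast
    have "norm (convolve f \<rho> z - f z) \<le> \<eta>"
    proof (rule convolve_dist_le[OF \<rho> fi])
      fix y assume "norm (z - y) < r"
      then show "norm (f y - f z) \<le> \<eta>"
        using \<epsilon>2(2)[OF zL, of y] inL[OF z, of y] r by (simp add: dist_norm norm_minus_commute)
    qed
    then show "norm (convolve f \<rho> z - b z) \<le> \<eta>" using fb[OF zL] by simp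
    show "\<phi> (norm (convolve DL \<rho> z)) \<le> convolve (\<lambda>z. \<phi> (norm (DL z))) \<rho> z"
      by (rule convolve_jensen[OF \<phi> \<rho> DLi \<phi>i])
    fix i j
    let ?\<psi> = "\<lambda>y. \<rho> (z - y)"
    have supp: "closure {y. ?\<psi> y \<noteq> 0} \<subseteq> U"
      using mr(3)[of z] inL[OF z] r(2) L(2) by (force simp: dist_norm)
    have comp: "compact (closure {y. ?\<psi> y \<noteq> 0})"
      using mr(3)[of z] by (meson bounded_cball bounded_subset closed_closure compact_eq_bounded_closed)
    let ?h = "\<lambda>x. frechet_derivative \<rho> (at x) (e j)"
    have ci: "integrable lborel (\<lambda>y. ?h (z - y) *\<^sub>R f y)"
      by (rule integrable_continuous_compact_support[OF _ \<zeta>(3)])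
         (use fL' in \<open>auto intro!: continuous_intros cf continuous_on_compose2[OF Cinf_onD(4)[OF m(1)]]\<close>)
    have "frechet_derivative (convolve f \<rho>) (at z) (e j) $ i = (\<integral>y. ?h (z - y) *\<^sub>R f y \<partial>lborel) $ i"
      by (simp add: convolve_smooth(2)[OF cf fac m(1)]) (simp add: convolve_def)
    also have "\<dots> = (\<integral>y. (?h (z - y) *\<^sub>R f y) $ i \<partial>lborel)"
      using integral_bounded_linear[OF bounded_linear_vec_nth ci] by simp
    \<comment> \<open>The minus sign comes from the reflection in \<open>?\<psi>\<close> and cancels
      the one in the definition of the weak derivative.\<close>
    also have "\<dots> = (LINT y:U|lborel. - (b y $ i * frechet_derivative ?\<psi> (at y) (e j)))"
      unfolding set_lebesgue_integral_def
    proof (rule Bochner_Integration.integral_cong[OF refl])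
      fix y
      show "(?h (z - y) *\<^sub>R f y) $ i = indicator U y *\<^sub>R - (b y $ i * frechet_derivative ?\<psi> (at y) (e j))"
      proof (cases "norm (z - y) \<le> \<epsilon>1")
        case True
        then have "y \<in> L" using inL[OF z] by blast
        then show ?thesis using L(2) fb[of y] by (auto simp: mr(2))
      next
        case False
        then have "?h (z - y) = 0" using mr(4)[of "z - y"] r(2) by auto
        then show ?thesis by (simp add: mr(2))
      qed
    qed
    also have "\<dots> = (LINT y:U|lborel. D y $ i $ j * ?\<psi> y)"
      using weak[OF mr(1) comp supp, of i j] by (simp add: set_lebesgue_integral_def)
    also have "\<dots> = (\<integral>y. (\<rho> (z - y) *\<^sub>R DL y) $ i $ j \<partial>lborel)"
      unfolding set_lebesgue_integral_def
    proof (rule Bochner_Integration.integral_cong[OF refl])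
      fix y
      show "indicator U y *\<^sub>R (D y $ i $ j * ?\<psi> y) = (\<rho> (z - y) *\<^sub>R DL y) $ i $ j"
      proof (cases "norm (z - y) \<le> \<epsilon>1")
        case True
        then have "y \<in> L" using inL[OF z] by blast
        then show ?thesis using L(2) by (auto simp: DL_def)
      next
        case False
        then have "\<rho> (z - y) = 0" using m(3)[of "z - y"] r(2) by auto
        then show ?thesis by simp
      qed
    qed
    also have "\<dots> = convolve DL \<rho> z $ i $ j"
      unfolding convolve_def by (rule vec_matrix_nth_integral[symmetric, OF integrable_mollifier_scaleR[OF \<rho> DLi]])
    finally show "frechet_derivative (convolve f \<rho>) (at z) (e j) $ i = convolve DL \<rho> z $ i $ j" .
  next
    have "(\<integral>\<^sup>+z\<in>K. norm (convolve DL \<rho> z - D z) \<partial>lborel) \<le> (\<integral>\<^sup>+z. norm (convolve DL \<rho> z - DL z) \<partial>lborel)"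
      by (rule nn_integral_mono) (use KL in \<open>auto simp: DL_def indicator_def\<close>)
    also have "\<dots> \<le> ennreal \<eta>" by (rule \<delta>1(2)[OF r(4) \<rho>])
    finally show "(\<integral>\<^sup>+z\<in>K. norm (convolve DL \<rho> z - D z) \<partial>lborel) \<le> ennreal \<eta>" .
    have "(\<integral>\<^sup>+z\<in>K. \<bar>convolve (\<lambda>z. \<phi> (norm (DL z))) \<rho> z - \<phi> (norm (D z))\<bar> \<partial>lborel) \<le>
        (\<integral>\<^sup>+z. norm (convolve (\<lambda>z. \<phi> (norm (DL z))) \<rho> z - \<phi> (norm (DL z))) \<partial>lborel)"
      by (rule nn_integral_mono) (use KL in \<open>auto simp: DL_def indicator_def\<close>)
    also have "\<dots> \<le> ennreal \<eta>" by (rule \<delta>2(2)[OF r(5) \<rho>])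
    finally show "(\<integral>\<^sup>+z\<in>K. \<bar>convolve (\<lambda>z. \<phi> (norm (DL z))) \<rho> z - \<phi> (norm (D z))\<bar> \<partial>lborel) \<le> ennreal \<eta>" .
  qed
qed

section \<open>Gluing with a partition of unity\<close>

text \<open>The directions \<open>e\<close> need not span: for space-time they are the space axes,
  so the time derivative never enters.\<close>

definition directional_jacobian ::
    "('n::finite \<Rightarrow> 'a::real_normed_vector) \<Rightarrow> ('a \<Rightarrow> real ^ 'm) \<Rightarrow> 'a \<Rightarrow> real ^ 'n ^ 'm" where
  "directional_jacobian e f z = (\<chi> i j. frechet_derivative f (at z) (e j) $ i)"

definition directional_gradient ::
    "('n::finite \<Rightarrow> 'a::real_normed_vector) \<Rightarrow> ('a \<Rightarrow> real) \<Rightarrow> 'a \<Rightarrow> real ^ 'n" where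
  "directional_gradient e f z = (\<chi> j. frechet_derivative f (at z) (e j))"

definition outer_product :: "real ^ 'm \<Rightarrow> real ^ 'n \<Rightarrow> real ^ 'n ^ 'm" where
  "outer_product u v = (\<chi> i j. u $ i * v $ j)"

lemma norm_outer_product: "norm (outer_product u v) = norm u * norm v"
proof -
  have "norm (outer_product u v $ i) = norm (u $ i) * norm v" for i
  proof -
    have "outer_product u v $ i = (u $ i) *\<^sub>R v"
      by (simp add: outer_product_def vec_eq_iff)
    then show ?thesis by simp
  qed
  then have "norm (outer_product u v) = L2_set (\<lambda>i. norm (u $ i) * norm v) UNIV"
    by (simp only: norm_vec_def[of "outer_product u v"])
  also have "\<dots> = norm u * norm v"
    by (simp add: L2_set_left_distrib norm_vec_def)
  finally show ?thesis .
qed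

lemma directional_jacobian_sum_scaleR:
  assumes "\<And>i. i \<in> A \<Longrightarrow> \<theta> i differentiable (at z)" "\<And>i. i \<in> A \<Longrightarrow> B i differentiable (at z)"
  shows "directional_jacobian e (\<lambda>x. \<Sum>i\<in>A. \<theta> i x *\<^sub>R B i x) z =
    (\<Sum>i\<in>A. \<theta> i z *\<^sub>R directional_jacobian e (B i) z +
       outer_product (B i z) (directional_gradient e (\<theta> i) z))"
proof -
  have "((\<lambda>x. \<Sum>i\<in>A. \<theta> i x *\<^sub>R B i x) has_derivative
      (\<lambda>v. \<Sum>i\<in>A. \<theta> i z *\<^sub>R frechet_derivative (B i) (at z) v +
        frechet_derivative (\<theta> i) (at z) v *\<^sub>R B i z)) (at z)"
    using assms by (intro has_derivative_sum has_derivative_scaleR) (auto simp flip: frechet_derivative_works)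
  from frechet_derivative_at[OF this] show ?thesis
    by (simp add: directional_jacobian_def directional_gradient_def outer_product_def vec_eq_iff
        fun_eq_iff sum_component mult.commute)
qed

lemma directional_gradient_sum:
  assumes "\<And>i. i \<in> A \<Longrightarrow> \<theta> i differentiable (at z)"
  shows "directional_gradient e (\<lambda>x. \<Sum>i\<in>A. \<theta> i x) z = (\<Sum>i\<in>A. directional_gradient e (\<theta> i) z)"
proof -
  have "((\<lambda>x. \<Sum>i\<in>A. \<theta> i x) has_derivative (\<lambda>v. \<Sum>i\<in>A. frechet_derivative (\<theta> i) (at z) v)) (at z)"
    using assms by (intro has_derivative_sum) (auto simp flip: frechet_derivative_works)
  from frechet_derivative_at[OF this] show ?thesis
    by (simp add: directional_gradient_def vec_eq_iff fun_eq_iff sum_component)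
qed

text \<open>Used twice: each cutoff has zero gradient off its compact piece, and the gradients of
  the partition sum to zero because the partial sums are locally 1.\<close>

lemma directional_gradient_locally_const:
  assumes "open S" "z \<in> S" "\<And>x. x \<in> S \<Longrightarrow> f x = c"
  shows "directional_gradient e f z = 0"
proof -
  have "frechet_derivative (\<lambda>_. c) (at z) = frechet_derivative f (at z)"
    by (rule frechet_derivative_transform_within_open[OF _ assms(1,2)]) (use assms(3) in auto)
  then have "frechet_derivative f (at z) = (\<lambda>_. 0)" by simp
  then show ?thesis by (simp add: directional_gradient_def vec_eq_iff)
qed

lemma continuous_on_directional:
  shows "Cinf_on S f \<Longrightarrow> continuous_on S (directional_gradient e f)"
    and "Cinf_on S g \<Longrightarrow> continuous_on S (directional_jacobian e g)"
proof -
  show "Cinf_on S f \<Longrightarrow> continuous_on S (directional_gradient e f)"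
    unfolding directional_gradient_def by (intro continuous_on_vec_lambda Cinf_onD(4))
  assume "Cinf_on S g"
  then have "continuous_on S (\<lambda>z. frechet_derivative g (at z) (e j) $ i)" for i j
    by (intro continuous_on_component Cinf_onD(4))
  then show "continuous_on S (directional_jacobian e g)"
    unfolding directional_jacobian_def by (intro continuous_on_vec_lambda)
qed

text \<open>Cutoffs \<zeta> along a compact exhaustion are subtracted successively, so partial sums
  telescope: the sum up to \<open>j\<close> is the j-th cutoff, which is 1 on \<open>K j\<close>. No
  division by a sum is required.\<close>

lemma smooth_partition_of_unity:
  fixes U :: "'a::euclidean_space set"
  assumes "open U"
  obtains K and \<theta> :: "nat \<Rightarrow> 'a \<Rightarrow> real" where
    "\<And>i. compact (K i)" "\<And>i. K i \<subseteq> U" "\<And>i. K i \<subseteq> interior (K (Suc i))" "\<Union> (range K) = U"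
    "\<And>i. Cinf_on UNIV (\<theta> i)" "\<And>i z. 0 \<le> \<theta> i z" "\<And>i z. \<theta> i z \<le> 1"
    "\<And>i z. z \<notin> K (Suc i) \<Longrightarrow> \<theta> i z = 0" "\<And>i j z. z \<in> K j \<Longrightarrow> j < i \<Longrightarrow> \<theta> i z = 0"
    "\<And>j z. z \<in> K j \<Longrightarrow> (\<Sum>i\<le>j. \<theta> i z) = 1"
proof -
  obtain K where K: "\<And>i. compact (K i)" "\<And>i. K i \<subseteq> U" "\<And>i. K i \<subseteq> interior (K (Suc i))" "\<Union> (range K) = U"
    by (rule open_Union_compact_subsets[OF assms]) blast
  have "K i \<subseteq> K (Suc i)" for i using K(3)[of i] interior_subset by blast
  then have mono: "K i \<subseteq> K j" if "i \<le> j" for i j using that by (rule lift_Suc_mono_le)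
  have "\<exists>\<zeta>. Cinf_on UNIV \<zeta> \<and> (\<forall>z. 0 \<le> \<zeta> z \<and> \<zeta> z \<le> 1) \<and> (\<forall>z\<in>K i. \<zeta> z = (1::real)) \<and>
      (\<forall>z. z \<notin> K (Suc i) \<longrightarrow> \<zeta> z = 0)" for i
  proof -
    obtain \<zeta> :: "'a \<Rightarrow> real" and L where "Cinf_on UNIV \<zeta>" "\<And>z. 0 \<le> \<zeta> z" "\<And>z. \<zeta> z \<le> 1"
      "\<And>z. z \<in> K i \<Longrightarrow> \<zeta> z = 1" "compact L" "L \<subseteq> interior (K (Suc i))" "\<And>z. z \<notin> L \<Longrightarrow> \<zeta> z = 0"
      by (rule smooth_cutoff[OF K(1) open_interior K(3)[of i]]) (rule that)
    then show ?thesis using interior_subset[of "K (Suc i)"] by blast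
  qed
  then obtain \<zeta> where \<zeta>: "\<And>i. Cinf_on UNIV (\<zeta> i)" "\<And>i z. 0 \<le> \<zeta> i z" "\<And>i z. \<zeta> i z \<le> 1"
      "\<And>i z. z \<in> K i \<Longrightarrow> \<zeta> i z = (1::real)" "\<And>i z. z \<notin> K (Suc i) \<Longrightarrow> \<zeta> i z = 0"
    by metis
  define \<theta> where "\<theta> = (\<lambda>i z. \<zeta> i z - (if i = 0 then 0 else \<zeta> (i - 1) z))"
  have tel: "(\<Sum>i\<le>j. \<theta> i z) = \<zeta> j z" for j z
    by (induction j) (auto simp: \<theta>_def)
  show ?thesis
  proof (rule that[OF K])
    fix i z
    show "Cinf_on UNIV (\<theta> i)"
    proof (cases i)
      case 0
      then have "\<theta> i = \<zeta> 0" by (simp add: \<theta>_def fun_eq_iff)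
      then show ?thesis using \<zeta>(1) by simp
    next
      case (Suc n)
      then have "\<theta> i = (\<lambda>z. \<zeta> i z + (-1) * \<zeta> n z)" by (simp add: \<theta>_def fun_eq_iff)
      then show ?thesis
        using \<zeta>(1) unfolding Cinf_on_def
        by (simp only:) (intro allI Ck_on_add[OF open_UNIV] Ck_on_mult[OF open_UNIV] Ck_on_const; blast)
    qed
    \<comment> \<open>On \<open>K i\<close> the i-th cutoff is already 1, and off \<open>K i\<close>
      the previous one is already 0.\<close>
    show "0 \<le> \<theta> i z"
      using \<zeta>(2)[of i z] \<zeta>(3)[of "i - 1" z] \<zeta>(4)[of z i] \<zeta>(5)[of z "i - 1"]
      by (cases "z \<in> K i") (auto simp: \<theta>_def)
    show "\<theta> i z \<le> 1"
      using \<zeta>(2)[of "i - 1" z] \<zeta>(3)[of i z] by (auto simp: \<theta>_def)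
    show "\<theta> i z = 0" if "z \<notin> K (Suc i)"
    proof -
      have "z \<notin> K i" using that mono[of i "Suc i"] by auto
      then show ?thesis using that \<zeta>(5)[of z i] \<zeta>(5)[of z "i - 1"] by (auto simp: \<theta>_def)
    qed
    show "\<theta> i z = 0" if "z \<in> K j" "j < i" for j
    proof -
      have "z \<in> K i" "z \<in> K (i - 1)" using that mono[of j i] mono[of j "i - 1"] by (simp_all add: subset_iff)
      then show ?thesis using that \<zeta>(4)[of z i] \<zeta>(4)[of z "i - 1"] by (simp add: \<theta>_def)
    qed
    show "(\<Sum>i\<le>j. \<theta> i z) = 1" if "z \<in> K j" for j
      using \<zeta>(4)[OF that] by (simp add: tel)
  qed
qed

text \<open>The number of relevant terms depends on the point. Passing from the finite sum to the
  full series of nonnegative terms removes this dependence before integration, and the weights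
  2^-(i+1) add up to 1.\<close>

lemma nn_integral_geometric_bound:
  fixes F :: "'a \<Rightarrow> ennreal" and T :: "nat \<Rightarrow> 'a \<Rightarrow> ennreal"
  assumes F: "\<And>z. z \<in> U \<Longrightarrow> \<exists>j. F z \<le> (\<Sum>i\<le>j. T i z)"
    and [measurable]: "\<And>i. T i \<in> borel_measurable M"
    and T: "\<And>i. (\<integral>\<^sup>+z. T i z \<partial>M) \<le> ennreal (c * (1/2) ^ Suc i)" and "0 \<le> c"
  shows "(\<integral>\<^sup>+z\<in>U. F z \<partial>M) \<le> ennreal c"
proof -
  have "F z * indicator U z \<le> (\<Sum>i. T i z)" for z
  proof (cases "z \<in> U")
    case True
    then obtain j where "F z \<le> (\<Sum>i\<le>j. T i z)" using F by blast
    also have "\<dots> \<le> (\<Sum>i. T i z)" by (intro sum_le_suminf) auto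
    finally show ?thesis using True by simp
  qed simp
  then have "(\<integral>\<^sup>+z\<in>U. F z \<partial>M) \<le> (\<integral>\<^sup>+z. (\<Sum>i. T i z) \<partial>M)" by (intro nn_integral_mono)
  also have "\<dots> = (\<Sum>i. \<integral>\<^sup>+z. T i z \<partial>M)" by (rule nn_integral_suminf) measurable
  also have "\<dots> \<le> (\<Sum>i. ennreal (c * (1/2) ^ Suc i))" by (intro suminf_le T) auto
  also have "\<dots> = ennreal c"
    using sums_mult[OF power_half_series, of c] \<open>0 \<le> c\<close> by (intro suminf_ennreal_eq) auto
  finally show ?thesis .
qed

text \<open>The derivative of the glued function is a convex combination plus an error of size
  \<delta>. The growth hypothesis with \<delta> \<le> 1 gives \<open>\<phi> (s + \<delta>) \<le> k *
  (\<phi> 1 + 1) * \<phi> s + k * \<phi> 1 * \<delta>\<close>. The first coefficient is the multiple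
  subtracted in the last estimate, and the sum of both coefficients is the constant on its right.
  The factor 2 in the gradient estimate counts the two sums in the derivative.\<close>

lemma glued_approximation:
  fixes U :: "'a::euclidean_space set" and e :: "'n::finite \<Rightarrow> 'a"
    and b :: "'a \<Rightarrow> real ^ 'm" and D :: "'a \<Rightarrow> real ^ 'n ^ 'm" and \<phi> :: "real \<Rightarrow> real"
  assumes U: "open U" and b: "continuous_on U b" and D: "D \<in> borel_measurable borel"
    and D_int: "\<And>K. compact K \<Longrightarrow> K \<subseteq> U \<Longrightarrow> integrable lborel (\<lambda>z. indicator K z *\<^sub>R D z)"
    and weak: "\<And>\<psi> i j. Cinf_on UNIV \<psi> \<Longrightarrow> compact (closure {z. \<psi> z \<noteq> 0}) \<Longrightarrow> closure {z. \<psi> z \<noteq> 0} \<subseteq> U \<Longrightarrow>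
      (LINT z:U|lborel. b z $ i * frechet_derivative \<psi> (at z) (e j)) = - (LINT z:U|lborel. D z $ i $ j * \<psi> z)"
    and \<phi>: "convex_on {0..} \<phi>" "\<phi> 0 = 0" "\<And>a. 0 \<le> a \<Longrightarrow> 0 \<le> \<phi> a"
    and \<phi>_meas: "(\<lambda>z. \<phi> (norm (D z))) \<in> borel_measurable borel"
    and \<phi>_int: "\<And>K. compact K \<Longrightarrow> K \<subseteq> U \<Longrightarrow> integrable lborel (\<lambda>z. indicator K z * \<phi> (norm (D z)))"
    and k: "0 < k" "\<And>a c. 0 \<le> a \<Longrightarrow> 0 \<le> c \<Longrightarrow> \<phi> (a + c) \<le> k * (\<phi> a * \<phi> c + \<phi> a + \<phi> c)"
    and w: "\<And>z. z \<in> U \<Longrightarrow> 0 < w z" "\<And>K. compact K \<Longrightarrow> K \<subseteq> U \<Longrightarrow> \<exists>C. \<forall>z\<in>K. w z \<le> C"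
    and \<epsilon>: "0 < \<epsilon>" "\<epsilon> \<le> 1"
  obtains B where "Cinf_on U B" "\<And>z. z \<in> U \<Longrightarrow> norm (B z - b z) \<le> \<epsilon>"
    "(\<integral>\<^sup>+z\<in>U. norm (directional_jacobian e B z - D z) \<partial>lborel) \<le> ennreal (2 * \<epsilon>)"
    "(\<integral>\<^sup>+z\<in>U. ennreal (w z * (\<phi> (norm (directional_jacobian e B z)) - k * (\<phi> 1 + 1) * \<phi> (norm (D z)))) \<partial>lborel)
      \<le> ennreal (k * (2 * \<phi> 1 + 1) * \<epsilon>)"
proof -
  obtain K and \<theta> :: "nat \<Rightarrow> 'a \<Rightarrow> real" where
    K: "\<And>i. compact (K i)" "\<And>i. K i \<subseteq> U" "\<And>i. K i \<subseteq> interior (K (Suc i))" "\<Union> (range K) = U"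
    and \<theta>: "\<And>i. Cinf_on UNIV (\<theta> i)" "\<And>i z. 0 \<le> \<theta> i z" "\<And>i z. \<theta> i z \<le> 1"
    "\<And>i z. z \<notin> K (Suc i) \<Longrightarrow> \<theta> i z = 0" "\<And>i j z. z \<in> K j \<Longrightarrow> j < i \<Longrightarrow> \<theta> i z = 0"
    "\<And>j z. z \<in> K j \<Longrightarrow> (\<Sum>i\<le>j. \<theta> i z) = 1"
    by (rule smooth_partition_of_unity[OF U]) (rule that)
  define g where "g = (\<lambda>i. directional_gradient e (\<theta> i))"
  have g0: "g i z = 0" if "z \<notin> K (Suc i)" for i z
    unfolding g_def
    by (rule directional_gradient_locally_const[of "- K (Suc i)"])
       (use that \<theta>(4) compact_imp_closed[OF K(1)] in auto)
  have "\<exists>M\<ge>0. \<forall>z. norm (g i z) \<le> M" for i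
  proof -
    have "continuous_on (K (Suc i)) (g i)"
      unfolding g_def using continuous_on_subset[OF continuous_on_directional(1)[OF \<theta>(1)]] by blast
    then have "bounded (g i ` K (Suc i))"
      using K(1) by (intro compact_imp_bounded compact_continuous_image)
    then obtain M where M: "\<And>z. z \<in> K (Suc i) \<Longrightarrow> norm (g i z) \<le> M" unfolding bounded_iff by blast
    have "norm (g i z) \<le> max M 0" for z
      using M[of z] g0[of z i] by (cases "z \<in> K (Suc i)") auto
    then show ?thesis by (intro exI[of _ "max M 0"]) auto
  qed
  then obtain M where M: "\<And>i. 0 \<le> M i" "\<And>i z. norm (g i z) \<le> M i" by metis
  have "\<exists>C\<ge>0. \<forall>z\<in>K (Suc i). w z \<le> C" for i
    using w(2)[OF K(1,2), of "Suc i"] by (metis max.coboundedI1 max.cobounded2)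
  then obtain W where W: "\<And>i. 0 \<le> W i" "\<And>i z. z \<in> K (Suc i) \<Longrightarrow> w z \<le> W i" by metis
  define \<mu> where "\<mu> i = measure lborel (K (Suc i))" for i
  have \<mu>0: "0 \<le> \<mu> i" for i by (simp add: \<mu>_def)
  have \<mu>: "emeasure lborel (K (Suc i)) = ennreal (\<mu> i)" for i
    unfolding \<mu>_def using emeasure_compact_finite[OF K(1)[of "Suc i"]]
    by (intro emeasure_eq_ennreal_measure) auto
  \<comment> \<open>The tolerance absorbs the gradient bound \<open>M i\<close>, the weight bound
    \<open>W i\<close> and the volume \<open>\<mu> i\<close>. Adding 1 to each keeps the quotient
    meaningful and lets any of the three factors be replaced by 1 in
    \<open>\<eta>le\<close>.\<close>
  define \<eta> where "\<eta> i = \<epsilon> * (1/2) ^ Suc i / ((1 + M i) * (1 + W i) * (1 + \<mu> i))" for i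
  have Q: "1 + M i \<ge> 1" "1 + W i \<ge> 1" "1 + \<mu> i \<ge> 1" for i using M W \<mu>0 by auto
  have \<eta>pos: "0 < \<eta> i" for i
    using \<epsilon>(1) Q[of i] unfolding \<eta>_def by (intro divide_pos_pos mult_pos_pos) auto
  have \<eta>le: "a * c * d * \<eta> i \<le> \<epsilon> * (1/2) ^ Suc i"
    if "0 \<le> a" "a \<le> 1 + M i" "0 \<le> c" "c \<le> 1 + W i" "0 \<le> d" "d \<le> 1 + \<mu> i" for a c d i
  proof -
    have "a * c * d \<le> (1 + M i) * (1 + W i) * (1 + \<mu> i)"
      using that Q[of i] by (intro mult_mono mult_nonneg_nonneg) auto
    then have "a * c * d * \<eta> i \<le> (1 + M i) * (1 + W i) * (1 + \<mu> i) * \<eta> i"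
      using \<eta>pos[of i] by (intro mult_right_mono) auto
    also have "\<dots> = \<epsilon> * (1/2) ^ Suc i" using Q[of i] by (simp add: \<eta>_def)
    finally show ?thesis .
  qed
  define P where "P i B G H \<longleftrightarrow> Cinf_on UNIV B \<and> G \<in> borel_measurable borel \<and> H \<in> borel_measurable borel \<and>
    (\<forall>z\<in>K (Suc i). norm (B z - b z) \<le> \<eta> i) \<and>
    (\<forall>z\<in>K (Suc i). directional_jacobian e B z = G z) \<and>
    (\<forall>z\<in>K (Suc i). \<phi> (norm (G z)) \<le> H z) \<and>
    (\<integral>\<^sup>+z\<in>K (Suc i). norm (G z - D z) \<partial>lborel) \<le> ennreal (\<eta> i) \<and>
    (\<integral>\<^sup>+z\<in>K (Suc i). \<bar>H z - \<phi> (norm (D z))\<bar> \<partial>lborel) \<le> ennreal (\<eta> i)" for i B G H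
  have "\<exists>B G H. P i B G H" for i
  proof -
    obtain B G H where "Cinf_on UNIV B" "G \<in> borel_measurable borel" "H \<in> borel_measurable borel"
      "\<And>z. z \<in> K (Suc i) \<Longrightarrow> norm (B z - b z) \<le> \<eta> i"
      "\<And>z l j. z \<in> K (Suc i) \<Longrightarrow> frechet_derivative B (at z) (e j) $ l = G z $ l $ j"
      "\<And>z. z \<in> K (Suc i) \<Longrightarrow> \<phi> (norm (G z)) \<le> H z"
      "(\<integral>\<^sup>+z\<in>K (Suc i). norm (G z - D z) \<partial>lborel) \<le> ennreal (\<eta> i)"
      "(\<integral>\<^sup>+z\<in>K (Suc i). \<bar>H z - \<phi> (norm (D z))\<bar> \<partial>lborel) \<le> ennreal (\<eta> i)"
      by (rule local_approx[OF U b D D_int weak \<phi> \<phi>_int K(1) K(3)[of "Suc i"] K(1) K(2) \<eta>pos[of i]])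
        (assumption | rule that)+
    then show ?thesis
      by (intro exI[of _ B] exI[of _ G] exI[of _ H]) (simp add: P_def directional_jacobian_def vec_eq_iff)
  qed
  then obtain B G H where P: "\<And>i. P i (B i) (G i) (H i)" by metis
  have B: "\<And>i. Cinf_on UNIV (B i)" "\<And>i. G i \<in> borel_measurable borel" "\<And>i. H i \<in> borel_measurable borel"
    "\<And>i z. z \<in> K (Suc i) \<Longrightarrow> norm (B i z - b z) \<le> \<eta> i"
    "\<And>i z. z \<in> K (Suc i) \<Longrightarrow> directional_jacobian e (B i) z = G i z"
    "\<And>i z. z \<in> K (Suc i) \<Longrightarrow> \<phi> (norm (G i z)) \<le> H i z"
    "\<And>i. (\<integral>\<^sup>+z\<in>K (Suc i). norm (G i z - D z) \<partial>lborel) \<le> ennreal (\<eta> i)"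
    "\<And>i. (\<integral>\<^sup>+z\<in>K (Suc i). \<bar>H i z - \<phi> (norm (D z))\<bar> \<partial>lborel) \<le> ennreal (\<eta> i)"
    using P unfolding P_def by blast+
  note [measurable] = B(2,3) D \<phi>_meas
  have KS[measurable]: "K i \<in> sets borel" for i using K(1) by (simp add: borel_compact)
  define d where "d i z = outer_product (B i z - b z) (g i z)" for i z
  have d: "norm (d i z) \<le> M i * \<eta> i * indicator (K (Suc i)) z" for i z
  proof (cases "z \<in> K (Suc i)")
    case True
    have "norm (d i z) \<le> \<eta> i * M i"
      unfolding d_def norm_outer_product using B(4)[OF True] M(2)[of i z] \<eta>pos[of i]
      by (intro mult_mono) auto
    then show ?thesis using True by (simp add: mult.commute)
  next
    case False
    then show ?thesis by (simp add: d_def norm_outer_product g0)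
  qed
  \<comment> \<open>On \<open>K j\<close> all terms beyond \<open>j\<close> vanish, so the series is
    a finite sum there; its derivative is computed on the interior, where this holds in a
    neighbourhood.\<close>
  define S where "S z = (\<Sum>i. \<theta> i z *\<^sub>R B i z)" for z
  have S: "S z = (\<Sum>i\<le>j. \<theta> i z *\<^sub>R B i z)" if "z \<in> K j" for z j
    unfolding S_def by (rule suminf_finite) (use \<theta>(5)[OF that] in auto)
  have nbh: "\<exists>j. z \<in> interior (K j)" if "z \<in> U" for z
    using that K(3,4) by blast
  have intK: "z \<in> K j" if "z \<in> interior (K j)" for z j using that interior_subset by blast
  have jac: "directional_jacobian e S z = (\<Sum>i\<le>j. \<theta> i z *\<^sub>R G i z) + (\<Sum>i\<le>j. d i z)"
    if z: "z \<in> interior (K j)" for z j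
  proof -
    have diff: "\<theta> i differentiable (at z)" "B i differentiable (at z)" for i
      using Cinf_onD(2)[OF \<theta>(1)] Cinf_onD(2)[OF B(1)] by auto
    have "frechet_derivative (\<lambda>x. \<Sum>i\<le>j. \<theta> i x *\<^sub>R B i x) (at z) = frechet_derivative S (at z)"
      by (rule frechet_derivative_transform_within_open[OF _ open_interior z])
         (use diff in \<open>auto simp: S[OF intK] intro!: differentiable_sum differentiable_scaleR\<close>)
    then have "directional_jacobian e S z = directional_jacobian e (\<lambda>x. \<Sum>i\<le>j. \<theta> i x *\<^sub>R B i x) z"
      by (simp add: directional_jacobian_def)
    also have "\<dots> = (\<Sum>i\<le>j. \<theta> i z *\<^sub>R directional_jacobian e (B i) z + outer_product (B i z) (g i z))"
      unfolding g_def by (rule directional_jacobian_sum_scaleR) (use diff in auto)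
    also have "\<dots> = (\<Sum>i\<le>j. \<theta> i z *\<^sub>R G i z + (d i z + outer_product (b z) (g i z)))"
    proof (rule sum.cong[OF refl])
      fix i
      \<comment> \<open>\<open>B i\<close> is controlled on \<open>K (Suc i)\<close> only; elsewhere
        the cutoff annihilates both sides.\<close>
      have "\<theta> i z *\<^sub>R directional_jacobian e (B i) z = \<theta> i z *\<^sub>R G i z"
        using B(5)[of z i] \<theta>(4)[of z i] by (cases "z \<in> K (Suc i)") auto
      moreover have "outer_product (B i z) (g i z) = d i z + outer_product (b z) (g i z)"
        by (simp add: d_def outer_product_def vec_eq_iff algebra_simps)
      ultimately show "\<theta> i z *\<^sub>R directional_jacobian e (B i) z + outer_product (B i z) (g i z) =
          \<theta> i z *\<^sub>R G i z + (d i z + outer_product (b z) (g i z))" by simp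
    qed
    also have "\<dots> = (\<Sum>i\<le>j. \<theta> i z *\<^sub>R G i z) + ((\<Sum>i\<le>j. d i z) + (\<Sum>i\<le>j. outer_product (b z) (g i z)))"
      by (simp add: sum.distrib)
    also have "(\<Sum>i\<le>j. outer_product (b z) (g i z)) = outer_product (b z) (\<Sum>i\<le>j. g i z)"
      by (simp add: outer_product_def vec_eq_iff sum_component sum_distrib_left)
    also have "(\<Sum>i\<le>j. g i z) = directional_gradient e (\<lambda>x. \<Sum>i\<le>j. \<theta> i x) z"
      unfolding g_def by (rule directional_gradient_sum[symmetric]) (use diff in auto)
    also have "\<dots> = 0"
      by (rule directional_gradient_locally_const[OF open_interior z]) (rule \<theta>(6)[OF intK])
    finally show ?thesis by (simp add: outer_product_def vec_eq_iff)
  qed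
  show ?thesis
  proof (rule that)
    show "Cinf_on U S"
      unfolding Cinf_on_def
    proof (intro allI Ck_on_local)
      fix n z assume "z \<in> U"
      then obtain j where j: "z \<in> interior (K j)" using nbh by blast
      have "Ck_on n (interior (K j)) S"
      proof (rule Ck_on_cong[OF open_interior])
        show "Ck_on n (interior (K j)) (\<lambda>x. \<Sum>i\<le>j. \<theta> i x *\<^sub>R B i x)"
          using \<theta>(1) B(1) unfolding Cinf_on_def
          by (intro Ck_on_sum Ck_on_scaleR open_interior) (blast intro: Ck_on_subset[OF _ subset_UNIV])+
      qed (simp add: S[OF intK])
      then show "\<exists>T. open T \<and> z \<in> T \<and> Ck_on n T S" using j open_interior by blast
    qed
    fix z assume "z \<in> U"
    then obtain j where j: "z \<in> interior (K j)" using nbh by blast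
    have "S z - b z = (\<Sum>i\<le>j. \<theta> i z *\<^sub>R (B i z - b z))"
      using \<theta>(6)[OF intK[OF j]] by (simp add: S[OF intK[OF j]] scaleR_diff_right sum_subtractf flip: scaleR_sum_left)
    also have "norm \<dots> \<le> (\<Sum>i\<le>j. \<theta> i z * \<epsilon>)"
    proof (rule sum_norm_le)
      fix i
      have "\<eta> i \<le> \<epsilon>"
      proof -
        have "1 * 1 * 1 * \<eta> i \<le> \<epsilon> * (1/2) ^ Suc i" by (rule \<eta>le) (use Q in auto)
        also have "\<dots> \<le> \<epsilon>" using \<epsilon>(1) by (intro mult_left_le power_le_one) auto
        finally show ?thesis by simp
      qed
      then show "norm (\<theta> i z *\<^sub>R (B i z - b z)) \<le> \<theta> i z * \<epsilon>"
        using B(4)[of z i] \<theta>(2)[of i z] \<theta>(4)[of z i]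
        by (cases "z \<in> K (Suc i)") (auto intro!: mult_left_mono)
    qed
    also have "\<dots> = \<epsilon>" using \<theta>(6)[OF intK[OF j]] by (simp flip: sum_distrib_right)
    finally show "norm (S z - b z) \<le> \<epsilon>" .
  next
    show "(\<integral>\<^sup>+z\<in>U. norm (directional_jacobian e S z - D z) \<partial>lborel) \<le> ennreal (2 * \<epsilon>)"
    proof (rule nn_integral_geometric_bound[where
          T="\<lambda>i z. ennreal (norm (G i z - D z)) * indicator (K (Suc i)) z + ennreal (M i * \<eta> i) * indicator (K (Suc i)) z"])
      fix z assume "z \<in> U"
      then obtain j where j: "z \<in> interior (K j)" using nbh by blast
      have "directional_jacobian e S z - D z = (\<Sum>i\<le>j. \<theta> i z *\<^sub>R (G i z - D z) + d i z)"
        using \<theta>(6)[OF intK[OF j]]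
        by (simp add: jac[OF j] scaleR_diff_right sum_subtractf sum.distrib flip: scaleR_sum_left)
      also have "norm \<dots> \<le> (\<Sum>i\<le>j. norm (G i z - D z) * indicator (K (Suc i)) z + M i * \<eta> i * indicator (K (Suc i)) z)"
      proof (rule sum_norm_le)
        fix i
        have "norm (\<theta> i z *\<^sub>R (G i z - D z)) \<le> norm (G i z - D z) * indicator (K (Suc i)) z"
          using \<theta>(2,3)[of i z] \<theta>(4)[of z i] by (cases "z \<in> K (Suc i)") (auto intro!: mult_left_le_one_le)
        then show "norm (\<theta> i z *\<^sub>R (G i z - D z) + d i z) \<le>
            norm (G i z - D z) * indicator (K (Suc i)) z + M i * \<eta> i * indicator (K (Suc i)) z"
          using d[of i z] norm_triangle_ineq[of "\<theta> i z *\<^sub>R (G i z - D z)" "d i z"] by linarith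
      qed
      finally have "ennreal (norm (directional_jacobian e S z - D z)) \<le>
          ennreal (\<Sum>i\<le>j. norm (G i z - D z) * indicator (K (Suc i)) z + M i * \<eta> i * indicator (K (Suc i)) z)"
        by (rule ennreal_leI)
      also have "\<dots> = (\<Sum>i\<le>j. ennreal (norm (G i z - D z)) * indicator (K (Suc i)) z + ennreal (M i * \<eta> i) * indicator (K (Suc i)) z)"
        using M(1) \<eta>pos
        by (subst sum_ennreal[symmetric])
           (auto simp: ennreal_mult' ennreal_indicator less_imp_le intro!: sum.cong)
      finally show "\<exists>j. ennreal (norm (directional_jacobian e S z - D z)) \<le>
          (\<Sum>i\<le>j. ennreal (norm (G i z - D z)) * indicator (K (Suc i)) z + ennreal (M i * \<eta> i) * indicator (K (Suc i)) z)" ..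
    next
      fix i
      have "(\<integral>\<^sup>+z. ennreal (norm (G i z - D z)) * indicator (K (Suc i)) z + ennreal (M i * \<eta> i) * indicator (K (Suc i)) z \<partial>lborel)
          = (\<integral>\<^sup>+z\<in>K (Suc i). norm (G i z - D z) \<partial>lborel) + ennreal (M i * \<eta> i) * ennreal (\<mu> i)"
        by (simp add: nn_integral_add nn_integral_cmult_indicator \<mu>)
      \<comment> \<open>The 1 occupies the place of the weight bound in \<open>\<eta>le\<close>,
        since this integral carries no weight.\<close>
      also have "\<dots> \<le> ennreal (\<eta> i) + ennreal (M i * 1 * \<mu> i * \<eta> i)"
        using M(1)[of i] \<mu>0[of i] \<eta>pos[of i] by (intro add_mono B(7)) (simp add: mult_ac flip: ennreal_mult')
      also have "\<dots> \<le> ennreal (\<epsilon> * (1/2) ^ Suc i) + ennreal (\<epsilon> * (1/2) ^ Suc i)"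
      proof (intro add_mono ennreal_leI)
        show "\<eta> i \<le> \<epsilon> * (1/2) ^ Suc i" using \<eta>le[of 1 i 1 1] Q[of i] by simp
        show "M i * 1 * \<mu> i * \<eta> i \<le> \<epsilon> * (1/2) ^ Suc i" by (rule \<eta>le) (use Q M(1) \<mu>0 in auto)
      qed
      also have "\<dots> = ennreal (2 * \<epsilon> * (1/2) ^ Suc i)" using \<epsilon>(1) by (simp flip: ennreal_plus)
      finally show "(\<integral>\<^sup>+z. ennreal (norm (G i z - D z)) * indicator (K (Suc i)) z + ennreal (M i * \<eta> i) * indicator (K (Suc i)) z \<partial>lborel)
          \<le> ennreal (2 * \<epsilon> * (1/2) ^ Suc i)" .
    qed (use \<epsilon> in auto)
  next
    define C where "C = k * (\<phi> 1 + 1)"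
    define E where "E = k * \<phi> 1"
    have \<phi>1: "0 \<le> \<phi> 1" using \<phi>(3)[of 1] by simp
    have CE: "0 \<le> C" "0 \<le> E" using k(1) \<phi>1 by (auto simp: C_def E_def)
    have CE_sum: "C + E = k * (2 * \<phi> 1 + 1)" by (simp add: C_def E_def algebra_simps)
    have Wt: "0 \<le> C * W i" "0 \<le> E * W i * M i * \<eta> i" for i
      using CE W(1)[of i] M(1)[of i] less_imp_le[OF \<eta>pos[of i]] by simp_all
    let ?T = "\<lambda>i z. ennreal (C * W i) * (ennreal \<bar>H i z - \<phi> (norm (D z))\<bar> * indicator (K (Suc i)) z) +
        ennreal (E * W i * M i * \<eta> i) * indicator (K (Suc i)) z"
    have "(\<integral>\<^sup>+z\<in>U. ennreal (w z * (\<phi> (norm (directional_jacobian e S z)) - C * \<phi> (norm (D z)))) \<partial>lborel)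
      \<le> ennreal ((C + E) * \<epsilon>)"
    proof (rule nn_integral_geometric_bound[where T="?T"])
      fix z assume zU: "z \<in> U"
      then obtain j where j: "z \<in> interior (K j)" using nbh by blast
      note \<theta>1 = \<theta>(6)[OF intK[OF j]]
      define s where "s = (\<Sum>i\<le>j. \<theta> i z * norm (G i z))"
      define \<delta> where "\<delta> = (\<Sum>i\<le>j. norm (d i z))"
      have s0: "0 \<le> s" using \<theta>(2) by (auto simp: s_def intro!: sum_nonneg)
      have \<delta>0: "0 \<le> \<delta>" by (auto simp: \<delta>_def intro!: sum_nonneg)
      \<comment> \<open>Here \<epsilon> \<le> 1 enters: the errors are below the geometric weights,
        whose sum is 1.\<close>
      have \<delta>1: "\<delta> \<le> 1"
      proof -
        have "\<delta> \<le> (\<Sum>i\<le>j. (1/2) ^ Suc i)"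
          unfolding \<delta>_def
        proof (rule sum_mono)
          fix i
          have "norm (d i z) \<le> M i * 1 * 1 * \<eta> i"
            using d[of i z] mult_nonneg_nonneg[OF M(1)[of i] less_imp_le[OF \<eta>pos[of i]]]
            by (cases "z \<in> K (Suc i)") simp_all
          also have "\<dots> \<le> \<epsilon> * (1/2) ^ Suc i" by (rule \<eta>le) (use Q M(1) in auto)
          also have "\<dots> \<le> 1 * (1/2) ^ Suc i" by (intro mult_right_mono \<epsilon>) auto
          finally show "norm (d i z) \<le> (1/2) ^ Suc i" by simp
        qed
        also have "\<dots> \<le> (\<Sum>i. (1/2) ^ Suc i)"
          using power_half_series by (intro sum_le_suminf) (auto simp: sums_iff)
        also have "\<dots> = 1" using power_half_series by (simp add: sums_iff)
        finally show ?thesis .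
      qed
      have "norm (directional_jacobian e S z) \<le> norm (\<Sum>i\<le>j. \<theta> i z *\<^sub>R G i z) + norm (\<Sum>i\<le>j. d i z)"
        unfolding jac[OF j] by (rule norm_triangle_ineq)
      also have "\<dots> \<le> s + \<delta>"
        unfolding s_def \<delta>_def using \<theta>(2) by (intro add_mono sum_norm_le) auto
      finally have "\<phi> (norm (directional_jacobian e S z)) \<le> \<phi> (s + \<delta>)"
        by (intro convex_on_nonneg_mono[OF \<phi>]) auto
      also have "\<dots> \<le> k * (\<phi> s * \<phi> \<delta> + \<phi> s + \<phi> \<delta>)" by (rule k(2)[OF s0 \<delta>0])
      \<comment> \<open>Two different bounds for \<open>\<phi> \<delta>\<close>: in the product
        monotonicity suffices, since that term joins the multiple of \<open>\<phi> s\<close>; alone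
        it must be small, and convexity between 0 and 1 gives
        \<open>\<delta> * \<phi> 1\<close>.\<close>
      also have "\<dots> \<le> k * (\<phi> s * \<phi> 1 + \<phi> s + \<delta> * \<phi> 1)"
      proof -
        have "\<phi> \<delta> \<le> \<phi> 1" by (rule convex_on_nonneg_mono[OF \<phi> \<delta>0 \<delta>1])
        moreover have "\<phi> ((1 - \<delta>) *\<^sub>R 0 + \<delta> *\<^sub>R 1) \<le> (1 - \<delta>) * \<phi> 0 + \<delta> * \<phi> 1"
          by (rule convex_onD[OF \<phi>(1)]) (use \<delta>0 \<delta>1 in auto)
        ultimately show ?thesis using k(1) \<phi>(2,3) s0 by (intro mult_left_mono add_mono) auto
      qed
      also have "\<dots> = C * \<phi> s + E * \<delta>" by (simp add: C_def E_def algebra_simps)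
      also have "\<phi> s \<le> (\<Sum>i\<le>j. \<theta> i z * H i z)"
      proof -
        have "\<phi> s \<le> (\<Sum>i\<le>j. \<theta> i z * \<phi> (norm (G i z)))"
          unfolding s_def using convex_on_sum[OF _ _ \<phi>(1) \<theta>1, of "\<lambda>i. norm (G i z)"] \<theta>(2) by simp
        also have "\<dots> \<le> (\<Sum>i\<le>j. \<theta> i z * H i z)"
        proof (rule sum_mono)
          fix i show "\<theta> i z * \<phi> (norm (G i z)) \<le> \<theta> i z * H i z"
            using B(6)[of z i] \<theta>(2)[of i z] \<theta>(4)[of z i] by (cases "z \<in> K (Suc i)") (auto intro!: mult_left_mono)
        qed
        finally show ?thesis .
      qed
      \<comment> \<open>Since the weights sum to one, \<open>\<phi> (norm (D z))\<close> can be
        distributed over them, which leaves the differences with \<open>H i\<close> that are small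
        in L1.\<close>
      finally have "\<phi> (norm (directional_jacobian e S z)) - C * \<phi> (norm (D z)) \<le>
          C * ((\<Sum>i\<le>j. \<theta> i z * H i z) - (\<Sum>i\<le>j. \<theta> i z) * \<phi> (norm (D z))) + E * \<delta>"
        using CE(1) by (simp add: \<theta>1 right_diff_distrib mult_left_mono)
      also have "\<dots> = (\<Sum>i\<le>j. C * (\<theta> i z * (H i z - \<phi> (norm (D z)))) + E * norm (d i z))"
        by (simp add: \<delta>_def sum.distrib sum_subtractf sum_distrib_left sum_distrib_right algebra_simps)
      finally have "w z * (\<phi> (norm (directional_jacobian e S z)) - C * \<phi> (norm (D z))) \<le>
          (\<Sum>i\<le>j. w z * (C * (\<theta> i z * (H i z - \<phi> (norm (D z)))) + E * norm (d i z)))"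
        using w(1)[OF zU] by (simp add: mult_left_mono flip: sum_distrib_left)
      also have "\<dots> \<le> (\<Sum>i\<le>j. (C * W i * \<bar>H i z - \<phi> (norm (D z))\<bar> + E * W i * M i * \<eta> i) * indicator (K (Suc i)) z)"
      proof (rule sum_mono)
        fix i
        show "w z * (C * (\<theta> i z * (H i z - \<phi> (norm (D z)))) + E * norm (d i z)) \<le>
          (C * W i * \<bar>H i z - \<phi> (norm (D z))\<bar> + E * W i * M i * \<eta> i) * indicator (K (Suc i)) z"
        proof (cases "z \<in> K (Suc i)")
          case True
          have "\<theta> i z * (H i z - \<phi> (norm (D z))) \<le> \<bar>H i z - \<phi> (norm (D z))\<bar>"
          proof -
            have "\<theta> i z * (H i z - \<phi> (norm (D z))) \<le> \<theta> i z * \<bar>H i z - \<phi> (norm (D z))\<bar>"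
              using \<theta>(2)[of i z] by (intro mult_left_mono) auto
            also have "\<dots> \<le> \<bar>H i z - \<phi> (norm (D z))\<bar>"
              using \<theta>(2,3)[of i z] by (intro mult_left_le_one_le) auto
            finally show ?thesis .
          qed
          then have "C * (\<theta> i z * (H i z - \<phi> (norm (D z)))) + E * norm (d i z) \<le>
              C * \<bar>H i z - \<phi> (norm (D z))\<bar> + E * (M i * \<eta> i)"
            using d[of i z] True CE by (intro add_mono mult_left_mono) auto
          then have "w z * (C * (\<theta> i z * (H i z - \<phi> (norm (D z)))) + E * norm (d i z)) \<le>
              w z * (C * \<bar>H i z - \<phi> (norm (D z))\<bar> + E * (M i * \<eta> i))"
            using w(1)[OF zU] by (intro mult_left_mono) auto
          also have "\<dots> \<le> W i * (C * \<bar>H i z - \<phi> (norm (D z))\<bar> + E * (M i * \<eta> i))"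
            using W(2)[OF True] CE M(1)[of i] \<eta>pos[of i]
            by (intro mult_right_mono add_nonneg_nonneg mult_nonneg_nonneg) auto
          finally show ?thesis using True by (simp add: algebra_simps)
        next
          case False
          then show ?thesis using d[of i z] \<theta>(4)[of z i] by simp
        qed
      qed
      finally have "ennreal (w z * (\<phi> (norm (directional_jacobian e S z)) - C * \<phi> (norm (D z)))) \<le>
          ennreal (\<Sum>i\<le>j. (C * W i * \<bar>H i z - \<phi> (norm (D z))\<bar> + E * W i * M i * \<eta> i) * indicator (K (Suc i)) z)"
        by (rule ennreal_leI)
      also have "\<dots> = (\<Sum>i\<le>j. ?T i z)"
      proof (subst sum_ennreal[symmetric])
        show "0 \<le> (C * W i * \<bar>H i z - \<phi> (norm (D z))\<bar> + E * W i * M i * \<eta> i) * indicator (K (Suc i)) z" for i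
          by (rule mult_nonneg_nonneg[OF add_nonneg_nonneg[OF mult_nonneg_nonneg[OF Wt(1) abs_ge_zero] Wt(2)]]) simp
        show "(\<Sum>i\<le>j. ennreal ((C * W i * \<bar>H i z - \<phi> (norm (D z))\<bar> + E * W i * M i * \<eta> i) * indicator (K (Suc i)) z)) =
            (\<Sum>i\<le>j. ?T i z)"
        proof (rule sum.cong[OF refl])
          fix i
          show "ennreal ((C * W i * \<bar>H i z - \<phi> (norm (D z))\<bar> + E * W i * M i * \<eta> i) * indicator (K (Suc i)) z) = ?T i z"
          proof (cases "z \<in> K (Suc i)")
            case True
            then show ?thesis
              using ennreal_plus[of "C * W i * \<bar>H i z - \<phi> (norm (D z))\<bar>" "E * W i * M i * \<eta> i"]
                ennreal_mult'[OF Wt(1)[of i], of "\<bar>H i z - \<phi> (norm (D z))\<bar>"] Wt[of i]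
              by simp
          qed simp
        qed
      qed
      finally show "\<exists>j. ennreal (w z * (\<phi> (norm (directional_jacobian e S z)) - C * \<phi> (norm (D z)))) \<le>
          (\<Sum>i\<le>j. ?T i z)" ..
    next
      fix i
      have "(\<integral>\<^sup>+z. ?T i z \<partial>lborel) = ennreal (C * W i) * (\<integral>\<^sup>+z\<in>K (Suc i). \<bar>H i z - \<phi> (norm (D z))\<bar> \<partial>lborel) +
          ennreal (E * W i * M i * \<eta> i) * ennreal (\<mu> i)"
        by (simp add: nn_integral_add nn_integral_cmult nn_integral_cmult_indicator \<mu>)
      also have "\<dots> \<le> ennreal (C * W i) * ennreal (\<eta> i) + ennreal (E * W i * M i * \<eta> i) * ennreal (\<mu> i)"
        by (intro add_mono mult_left_mono B(8)) auto
      also have "\<dots> = ennreal (C * (1 * W i * 1 * \<eta> i) + E * (M i * W i * \<mu> i * \<eta> i))"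
        using Wt[of i] \<eta>pos[of i] \<mu>0[of i] CE W(1)[of i] M(1)[of i]
        by (simp add: mult_ac flip: ennreal_mult' ennreal_plus)
      also have "\<dots> \<le> ennreal (C * (\<epsilon> * (1/2) ^ Suc i) + E * (\<epsilon> * (1/2) ^ Suc i))"
        by (intro ennreal_leI add_mono mult_left_mono CE \<eta>le) (use Q M(1) W(1) \<mu>0 in auto)
      also have "\<dots> = ennreal ((C + E) * \<epsilon> * (1/2) ^ Suc i)"
        by (simp only: distrib_right mult.assoc)
      finally show "(\<integral>\<^sup>+z. ?T i z \<partial>lborel) \<le> ennreal ((C + E) * \<epsilon> * (1/2) ^ Suc i)" .
    qed (use CE \<epsilon> in auto)
    then show "(\<integral>\<^sup>+z\<in>U. ennreal (w z * (\<phi> (norm (directional_jacobian e S z)) - k * (\<phi> 1 + 1) * \<phi> (norm (D z)))) \<partial>lborel)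
      \<le> ennreal (k * (2 * \<phi> 1 + 1) * \<epsilon>)"
      unfolding CE_sum unfolding C_def .
  qed
qed

section \<open>Passage to the limit\<close>

text \<open>Convexity gives continuity in the interior only. At the endpoint,
  \<open>\<phi> 0 = 0\<close> and nonnegativity exclude a jump: \<open>\<phi> t\<close> lies between
  0 and \<open>t * \<phi> 1\<close>.\<close>

lemma convex_on_nonneg_continuous:
  fixes \<phi> :: "real \<Rightarrow> real"
  assumes "convex_on {0..} \<phi>" "\<phi> 0 = 0" "\<And>a. 0 \<le> a \<Longrightarrow> 0 \<le> \<phi> a"
  shows "continuous_on {0..} \<phi>"
  unfolding continuous_on_eq_continuous_within
proof
  fix t :: real assume t: "t \<in> {0..}"
  show "continuous (at t within {0..}) \<phi>"
  proof (cases "t = 0")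
    case True
    have "((\<lambda>t. t * \<phi> 1) \<longlongrightarrow> 0 * \<phi> 1) (at 0 within {0..})"
      by (intro tendsto_intros)
    then have lim: "((\<lambda>t. t * \<phi> 1) \<longlongrightarrow> 0) (at 0 within {0..})" by simp
    have "(\<phi> \<longlongrightarrow> 0) (at 0 within {0..})"
    proof (rule tendsto_sandwich[OF _ _ tendsto_const lim])
      show "\<forall>\<^sub>F t in at 0 within {0..}. 0 \<le> \<phi> t"
        unfolding eventually_at using assms(3) by (intro exI[of _ 1]) auto
      have "\<phi> t \<le> t * \<phi> 1" if "0 \<le> t" "t \<le> 1" for t
        using convex_onD[OF assms(1), of t 0 1] that assms(2) by simp
      then show "\<forall>\<^sub>F t in at 0 within {0..}. \<phi> t \<le> t * \<phi> 1"
        unfolding eventually_at by (intro exI[of _ 1]) (auto simp: dist_real_def)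
    qed
    then show ?thesis using True assms(2) by (simp add: continuous_within)
  next
    case False
    have "continuous_on {0<..} \<phi>"
      by (rule convex_on_continuous) (auto intro: convex_on_subset[OF assms(1)])
    then have "isCont \<phi> t"
      using t False by (simp add: continuous_on_eq_continuous_at)
    then show ?thesis by (rule continuous_at_imp_continuous_at_within)
  qed
qed

text \<open>\<phi> is unconstrained on negative arguments, so measurability is taken from the
  monotone extension \<open>\<phi> (max 0 t)\<close>.\<close>

lemma borel_measurable_convex_nonneg:
  fixes \<phi> :: "real \<Rightarrow> real"
  assumes "convex_on {0..} \<phi>" "\<phi> 0 = 0" "\<And>a. 0 \<le> a \<Longrightarrow> 0 \<le> \<phi> a"
    and f: "f \<in> borel_measurable M" "\<And>x. 0 \<le> f x"
  shows "(\<lambda>x. \<phi> (f x)) \<in> borel_measurable M"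
proof -
  have "mono (\<lambda>t. \<phi> (max 0 t))"
    by (intro monoI convex_on_nonneg_mono[OF assms(1-3)]) auto
  then have "(\<lambda>x. \<phi> (max 0 (f x))) \<in> borel_measurable M"
    by (intro measurable_compose[OF f(1)] borel_measurable_mono)
  then show ?thesis using f(2) by (simp add: max_absorb2)
qed

text \<open>Glued approximations with \<epsilon> = 1/(h+1) have derivatives converging in L1, hence
  almost everywhere along a subsequence. The stated rates survive the passage to the subsequence
  because its h-th index is at least \<open>h\<close>.\<close>

lemma smooth_approximation:
  fixes U :: "'a::euclidean_space set" and e :: "'n::finite \<Rightarrow> 'a"
    and b :: "'a \<Rightarrow> real ^ 'm" and D :: "'a \<Rightarrow> real ^ 'n ^ 'm" and \<phi> :: "real \<Rightarrow> real"
  assumes U: "open U" and b: "continuous_on U b" and D: "D \<in> borel_measurable borel"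
    and D_int: "\<And>K. compact K \<Longrightarrow> K \<subseteq> U \<Longrightarrow> integrable lborel (\<lambda>z. indicator K z *\<^sub>R D z)"
    and weak: "\<And>\<psi> i j. Cinf_on UNIV \<psi> \<Longrightarrow> compact (closure {z. \<psi> z \<noteq> 0}) \<Longrightarrow> closure {z. \<psi> z \<noteq> 0} \<subseteq> U \<Longrightarrow>
      (LINT z:U|lborel. b z $ i * frechet_derivative \<psi> (at z) (e j)) = - (LINT z:U|lborel. D z $ i $ j * \<psi> z)"
    and \<phi>: "convex_on {0..} \<phi>" "\<phi> 0 = 0" "\<And>a. 0 \<le> a \<Longrightarrow> 0 \<le> \<phi> a"
    and k: "0 < k" "\<And>a c. 0 \<le> a \<Longrightarrow> 0 \<le> c \<Longrightarrow> \<phi> (a + c) \<le> k * (\<phi> a * \<phi> c + \<phi> a + \<phi> c)"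
    and w: "(\<lambda>z. indicator U z * w z) \<in> borel_measurable borel" "\<And>z. z \<in> U \<Longrightarrow> 0 < w z"
      "\<And>K. compact K \<Longrightarrow> K \<subseteq> U \<Longrightarrow> \<exists>c C. 0 < c \<and> c \<le> C \<and> (\<forall>z\<in>K. c \<le> w z \<and> w z \<le> C)"
    and w_int: "integrable lborel (\<lambda>z. indicator U z * (w z * \<phi> (norm (D z))))"
  obtains B where "\<And>h. Cinf_on U (B h)" "\<And>h z. z \<in> U \<Longrightarrow> norm (B h z - b z) \<le> inverse (real (Suc h))"
    "\<And>h. (\<integral>\<^sup>+z\<in>U. norm (directional_jacobian e (B h) z - D z) \<partial>lborel) \<le> ennreal (2 * inverse (real (Suc h)))"
    "\<And>h. (\<integral>\<^sup>+z\<in>U. norm (w z * \<phi> (norm (directional_jacobian e (B h) z)) - w z * \<phi> (norm (D z))) \<partial>lborel) < \<infinity>"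
    "(\<lambda>h. \<integral>\<^sup>+z\<in>U. norm (w z * \<phi> (norm (directional_jacobian e (B h) z)) - w z * \<phi> (norm (D z))) \<partial>lborel) \<longlonglongrightarrow> 0"
proof -
  define C where "C = k * (\<phi> 1 + 1)"
  define C' where "C' = k * (2 * \<phi> 1 + 1)"
  define \<epsilon> where "\<epsilon> h = inverse (real (Suc h))" for h
  have \<epsilon>: "0 < \<epsilon> h" "\<epsilon> h \<le> 1" for h by (auto simp: \<epsilon>_def inverse_le_1_iff)
  have C'0: "0 \<le> C'" using k(1) \<phi>(3)[of 1] by (simp add: C'_def)
  have \<phi>_meas: "(\<lambda>z. \<phi> (norm (D z))) \<in> borel_measurable borel"
    by (rule borel_measurable_convex_nonneg[OF \<phi>]) (use D in measurable)
  have U_meas[measurable]: "U \<in> sets borel" using U by auto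
  have \<phi>_int: "integrable lborel (\<lambda>z. indicator K z * \<phi> (norm (D z)))" if K: "compact K" "K \<subseteq> U" for K
  proof -
    \<comment> \<open>The lower bound of the weight turns integrability of
      \<open>w * \<phi> (norm D)\<close> into local integrability of
      \<open>\<phi> (norm D)\<close>.\<close>
    obtain c where c: "0 < c" "\<And>z. z \<in> K \<Longrightarrow> c \<le> w z" using w(3)[OF K] by blast
    have [measurable]: "K \<in> sets borel" using K(1) by (simp add: borel_compact)
    have "integrable lborel (\<lambda>z. inverse c * (indicator U z * (w z * \<phi> (norm (D z)))))"
      using w_int by simp
    then show ?thesis
    proof (rule Bochner_Integration.integrable_bound)
      show "AE z in lborel. norm (indicator K z * \<phi> (norm (D z))) \<le>
          norm (inverse c * (indicator U z * (w z * \<phi> (norm (D z)))))"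
      proof (rule AE_I2)
        fix z
        show "norm (indicator K z * \<phi> (norm (D z))) \<le> norm (inverse c * (indicator U z * (w z * \<phi> (norm (D z)))))"
        proof (cases "z \<in> K")
          case True
          have "c * \<phi> (norm (D z)) \<le> w z * \<phi> (norm (D z))"
            using c(2)[OF True] \<phi>(3) by (intro mult_right_mono) auto
          then have "\<phi> (norm (D z)) \<le> inverse c * (w z * \<phi> (norm (D z)))"
            using c(1) by (simp add: field_simps)
          then show ?thesis using True K(2) \<phi>(3)[of "norm (D z)"] by auto
        qed simp
      qed
    qed (use \<phi>_meas in measurable)
  qed
  have wC: "\<exists>C. \<forall>z\<in>K. w z \<le> C" if "compact K" "K \<subseteq> U" for K using w(3)[OF that] by blast
  define P where "P h B \<longleftrightarrow> Cinf_on U B \<and> (\<forall>z\<in>U. norm (B z - b z) \<le> \<epsilon> h) \<and>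
    (\<integral>\<^sup>+z\<in>U. norm (directional_jacobian e B z - D z) \<partial>lborel) \<le> ennreal (2 * \<epsilon> h) \<and>
    (\<integral>\<^sup>+z\<in>U. ennreal (w z * (\<phi> (norm (directional_jacobian e B z)) - C * \<phi> (norm (D z)))) \<partial>lborel)
      \<le> ennreal (C' * \<epsilon> h)" for h B
  have "\<exists>B. P h B" for h
  proof -
    obtain B where "Cinf_on U B" "\<And>z. z \<in> U \<Longrightarrow> norm (B z - b z) \<le> \<epsilon> h"
      "(\<integral>\<^sup>+z\<in>U. norm (directional_jacobian e B z - D z) \<partial>lborel) \<le> ennreal (2 * \<epsilon> h)"
      "(\<integral>\<^sup>+z\<in>U. ennreal (w z * (\<phi> (norm (directional_jacobian e B z)) - k * (\<phi> 1 + 1) * \<phi> (norm (D z)))) \<partial>lborel)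
        \<le> ennreal (k * (2 * \<phi> 1 + 1) * \<epsilon> h)"
      by (rule glued_approximation[OF U b D D_int weak \<phi> \<phi>_meas \<phi>_int k w(2) wC \<epsilon>[of h]])
        (assumption | rule that)+
    then show ?thesis unfolding P_def C_def C'_def by blast
  qed
  then obtain B where PB: "\<And>h. P h (B h)" by metis
  have B: "\<And>h. Cinf_on U (B h)" "\<And>h z. z \<in> U \<Longrightarrow> norm (B h z - b z) \<le> \<epsilon> h"
    "\<And>h. (\<integral>\<^sup>+z\<in>U. norm (directional_jacobian e (B h) z - D z) \<partial>lborel) \<le> ennreal (2 * \<epsilon> h)"
    "\<And>h. (\<integral>\<^sup>+z\<in>U. ennreal (w z * (\<phi> (norm (directional_jacobian e (B h) z)) - C * \<phi> (norm (D z)))) \<partial>lborel)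
      \<le> ennreal (C' * \<epsilon> h)"
    using PB unfolding P_def by blast+
  have \<epsilon>_lim: "\<epsilon> \<longlonglongrightarrow> 0" unfolding \<epsilon>_def[abs_def] by (rule LIMSEQ_inverse_real_of_nat)
  \<comment> \<open>The jacobians are continuous on \<open>U\<close> only; extension by zero makes
    them Borel on the whole space.\<close>
  define J where "J h z = indicator U z *\<^sub>R directional_jacobian e (B h) z" for h z
  have J_meas[measurable]: "J h \<in> borel_measurable borel" for h
    unfolding J_def[abs_def]
    by (rule borel_measurable_continuous_on_indicator[OF U_meas continuous_on_directional(2)[OF B(1)]])
  define D' where "D' z = indicator U z *\<^sub>R D z" for z
  have D'_meas[measurable]: "D' \<in> borel_measurable borel"
    unfolding D'_def[abs_def] using D by measurable
  have nJ: "ennreal (norm (J h z - D' z)) = ennreal (norm (directional_jacobian e (B h) z - D z)) * indicator U z" for h z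
    by (cases "z \<in> U") (auto simp: J_def D'_def)
  have J_le: "(\<integral>\<^sup>+z. norm (J h z - D' z) \<partial>lborel) \<le> ennreal (2 * \<epsilon> h)" for h
    using B(3)[of h] by (simp add: nJ)
  have J_int: "integrable lborel (\<lambda>z. J h z - D' z)" for h
    using J_le[of h] by (intro integrableI_bounded) (auto intro: le_less_trans)
  have "(\<lambda>h. \<integral>z. norm (J h z - D' z) \<partial>lborel) \<longlonglongrightarrow> 0"
  proof (rule tendsto_sandwich[OF _ _ tendsto_const])
    show "\<forall>\<^sub>F h in sequentially. (\<integral>z. norm (J h z - D' z) \<partial>lborel) \<le> 2 * \<epsilon> h"
    proof (rule always_eventually, rule allI)
      fix h
      have "ennreal (\<integral>z. norm (J h z - D' z) \<partial>lborel) \<le> ennreal (2 * \<epsilon> h)"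
        using J_le[of h] nn_integral_eq_integral[OF integrable_norm[OF J_int[of h]]] by simp
      then show "(\<integral>z. norm (J h z - D' z) \<partial>lborel) \<le> 2 * \<epsilon> h"
        using \<epsilon>(1)[of h] by (simp add: ennreal_le_iff)
    qed
    show "(\<lambda>h. 2 * \<epsilon> h) \<longlonglongrightarrow> 0" using tendsto_mult_left[OF \<epsilon>_lim, of 2] by simp
  qed (auto intro!: always_eventually Bochner_Integration.integral_nonneg)
  then obtain r where r: "strict_mono r" "AE z in lborel. (\<lambda>n. J (r n) z - D' z) \<longlonglongrightarrow> 0"
    using tendsto_L1_AE_subseq[of lborel "\<lambda>h z. J h z - D' z", OF J_int] by blast
  have \<epsilon>r: "\<epsilon> (r h) \<le> \<epsilon> h" for h
    using seq_suble[OF r(1), of h] by (simp add: \<epsilon>_def)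
  define F where "F n z = indicator U z * w z * \<phi> (norm (J (r n) z))" for n z
  define f where "f z = indicator U z * w z * \<phi> (norm (D' z))" for z
  \<comment> \<open>The maximum ensures \<open>f \<le> C1 * f\<close>, so truncating at
    \<open>C1 * f\<close> does not change the limit \<open>f\<close>.\<close>
  define C1 where "C1 = max C 1"
  have [measurable]: "(\<lambda>z. indicator U z * w z) \<in> borel_measurable borel" by (rule w(1))
  have [measurable]: "(\<lambda>z. \<phi> (norm (J h z))) \<in> borel_measurable borel"
      "(\<lambda>z. \<phi> (norm (D' z))) \<in> borel_measurable borel" for h
    using J_meas D'_meas by (auto intro!: borel_measurable_convex_nonneg[OF \<phi>])
  have F_meas[measurable]: "F n \<in> borel_measurable borel" for n unfolding F_def[abs_def] by measurable
  have f_meas[measurable]: "f \<in> borel_measurable borel" unfolding f_def[abs_def] by measurable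
  have f_eq: "f z = indicator U z * (w z * \<phi> (norm (D z)))" for z
    by (auto simp: f_def D'_def indicator_def)
  have f_int: "integrable lborel f" using w_int by (simp add: f_eq[abs_def])
  have f0: "0 \<le> f z" for z 
    using w(2)[of z] \<phi>(3)[of "norm (D z)"] by (cases "z \<in> U") (simp_all add: f_eq)
  have F0: "0 \<le> F n z" for n z 
    using w(2)[of z] \<phi>(3)[of "norm (J (r n) z)"] by (cases "z \<in> U") (simp_all add: F_def)
  have nF: "ennreal (norm (F n z - f z)) =
      ennreal (norm (w z * \<phi> (norm (directional_jacobian e (B (r n)) z)) - w z * \<phi> (norm (D z)))) * indicator U z" for n z
    by (cases "z \<in> U") (auto simp: F_def f_def J_def D'_def)
  text \<open>The part of \<open>F n\<close> above the integrable majorant \<open>C1 * f\<close> is small by construction; the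
    truncation of \<open>F n\<close> at this majorant is covered by dominated convergence.\<close>
  have excess: "(\<integral>\<^sup>+z. ennreal (F n z - C1 * f z) \<partial>lborel) \<le> ennreal (C' * \<epsilon> n)" for n
  proof -
    have "(\<integral>\<^sup>+z. ennreal (F n z - C1 * f z) \<partial>lborel) \<le>
      (\<integral>\<^sup>+z\<in>U. ennreal (w z * (\<phi> (norm (directional_jacobian e (B (r n)) z)) - C * \<phi> (norm (D z)))) \<partial>lborel)"
    proof (rule nn_integral_mono)
      fix z
      have "C * f z \<le> C1 * f z" by (intro mult_right_mono f0) (simp add: C1_def)
      then show "ennreal (F n z - C1 * f z) \<le>
          ennreal (w z * (\<phi> (norm (directional_jacobian e (B (r n)) z)) - C * \<phi> (norm (D z)))) * indicator U z"
        by (cases "z \<in> U") (auto simp: F_def f_def J_def D'_def algebra_simps intro!: ennreal_leI)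
    qed
    also have "\<dots> \<le> ennreal (C' * \<epsilon> (r n))" by (rule B(4))
    also have "\<dots> \<le> ennreal (C' * \<epsilon> n)" by (intro ennreal_leI mult_left_mono \<epsilon>r C'0)
    finally show ?thesis .
  qed
  let ?T = "\<lambda>n z. min (F n z) (C1 * f z)"
  have split: "(\<integral>\<^sup>+z. norm (F n z - f z) \<partial>lborel) \<le> (\<integral>\<^sup>+z. norm (f z - ?T n z) \<partial>lborel) + ennreal (C' * \<epsilon> n)" for n
  proof -
    \<comment> \<open>\<open>F n\<close> exceeds its truncation by the positive part of
      \<open>F n - C1 * f\<close>, and \<open>ennreal\<close> sends negative numbers to 0.\<close>
    have "ennreal (norm (F n z - f z)) \<le> ennreal (norm (f z - ?T n z)) + ennreal (F n z - C1 * f z)" for z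
    proof -
      have "norm (F n z - f z) \<le> norm (f z - ?T n z) + max 0 (F n z - C1 * f z)"
        by (auto simp: min_def max_def)
      then have "ennreal (norm (F n z - f z)) \<le> ennreal (norm (f z - ?T n z) + max 0 (F n z - C1 * f z))"
        by (rule ennreal_leI)
      also have "\<dots> = ennreal (norm (f z - ?T n z)) + ennreal (F n z - C1 * f z)"
        by (simp add: ennreal_plus ennreal_max_0)
      finally show ?thesis .
    qed
    then have "(\<integral>\<^sup>+z. norm (F n z - f z) \<partial>lborel) \<le>
        (\<integral>\<^sup>+z. ennreal (norm (f z - ?T n z)) + ennreal (F n z - C1 * f z) \<partial>lborel)"
      by (rule nn_integral_mono)
    also have "\<dots> = (\<integral>\<^sup>+z. norm (f z - ?T n z) \<partial>lborel) + (\<integral>\<^sup>+z. ennreal (F n z - C1 * f z) \<partial>lborel)"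
      by (rule nn_integral_add) measurable
    finally show ?thesis using add_left_mono[OF excess] order_trans by blast
  qed
  have T_le: "norm (?T n z) \<le> C1 * f z" for n z
    using F0[of n z] mult_nonneg_nonneg[OF _ f0[of z], of C1] by (auto simp: C1_def min_def)
  have C1f: "(\<integral>\<^sup>+z. ennreal (C1 * f z) \<partial>lborel) < \<infinity>"
  proof -
    have i: "integrable lborel (\<lambda>z. C1 * f z)" using f_int by simp
    show ?thesis
      using nn_integral_eq_integral[OF i] f0 by (simp add: C1_def)
  qed
  have T_lim: "(\<lambda>n. \<integral>\<^sup>+z. norm (f z - ?T n z) \<partial>lborel) \<longlonglongrightarrow> 0"
  proof (rule nn_integral_dominated_convergence_norm[where w="\<lambda>z. C1 * f z"])
    show "AE z in lborel. (\<lambda>n. ?T n z) \<longlonglongrightarrow> f z"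
      using r(2)
    proof eventually_elim
      case (elim z)
      have "(\<lambda>n. norm (J (r n) z)) \<longlonglongrightarrow> norm (D' z)"
        using elim by (intro tendsto_norm) (simp add: LIM_zero_iff)
      then have "(\<lambda>n. \<phi> (norm (J (r n) z))) \<longlonglongrightarrow> \<phi> (norm (D' z))"
        by (intro continuous_on_tendsto_compose[OF convex_on_nonneg_continuous[OF \<phi>]]) auto
      then have "(\<lambda>n. F n z) \<longlonglongrightarrow> f z"
        unfolding F_def f_def by (intro tendsto_intros)
      then have "(\<lambda>n. ?T n z) \<longlonglongrightarrow> min (f z) (C1 * f z)"
        by (intro tendsto_min tendsto_const)
      moreover have "f z \<le> C1 * f z"
        using mult_right_mono[of 1 C1 "f z"] f0[of z] by (simp add: C1_def)
      ultimately show ?case by (simp add: min_absorb1)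
    qed
  qed (use T_le C1f in auto)
  show ?thesis
  proof (rule that[of "\<lambda>h. B (r h)"])
    show "Cinf_on U (B (r h))" for h by (rule B(1))
    show "norm (B (r h) z - b z) \<le> inverse (real (Suc h))" if "z \<in> U" for h z
      using order_trans[OF B(2)[OF that, of "r h"] \<epsilon>r[of h]] by (simp add: \<epsilon>_def)
    show "(\<integral>\<^sup>+z\<in>U. norm (directional_jacobian e (B (r h)) z - D z) \<partial>lborel) \<le> ennreal (2 * inverse (real (Suc h)))" for h
    proof -
      have "ennreal (2 * \<epsilon> (r h)) \<le> ennreal (2 * \<epsilon> h)" using \<epsilon>r[of h] by (intro ennreal_leI) simp
      then show ?thesis using B(3)[of "r h"] order_trans unfolding \<epsilon>_def[of h] by blast
    qed
    have T_fin: "(\<integral>\<^sup>+z. norm (f z - ?T n z) \<partial>lborel) < \<infinity>" for n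
    proof -
      have "norm (f z - ?T n z) \<le> C1 * f z + C1 * f z" for z
      proof -
        have "f z \<le> C1 * f z" using mult_right_mono[of 1 C1 "f z"] f0[of z] by (simp add: C1_def)
        then show ?thesis
          using T_le[of n z] f0[of z] unfolding real_norm_def by linarith
      qed
      then have "(\<integral>\<^sup>+z. norm (f z - ?T n z) \<partial>lborel) \<le> (\<integral>\<^sup>+z. ennreal (C1 * f z) + ennreal (C1 * f z) \<partial>lborel)"
        using f0 by (intro nn_integral_mono) (simp add: C1_def flip: ennreal_plus)
      also have "\<dots> = (\<integral>\<^sup>+z. ennreal (C1 * f z) \<partial>lborel) + (\<integral>\<^sup>+z. ennreal (C1 * f z) \<partial>lborel)"
        by (rule nn_integral_add) measurable
      also have "\<dots> < \<infinity>" using C1f by simp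
      finally show ?thesis .
    qed
    show "(\<integral>\<^sup>+z\<in>U. norm (w z * \<phi> (norm (directional_jacobian e (B (r h)) z)) - w z * \<phi> (norm (D z))) \<partial>lborel) < \<infinity>" for h
      unfolding nF[symmetric] by (rule le_less_trans[OF split]) (use T_fin[of h] in simp)
    have lim: "(\<lambda>n. (\<integral>\<^sup>+z. norm (f z - ?T n z) \<partial>lborel) + ennreal (C' * \<epsilon> n)) \<longlonglongrightarrow> 0"
    proof -
      have "(\<lambda>n. ennreal (C' * \<epsilon> n)) \<longlonglongrightarrow> ennreal (C' * 0)"
        by (intro tendsto_ennrealI tendsto_mult_left \<epsilon>_lim)
      from tendsto_add[OF T_lim this] show ?thesis by simp
    qed
    have "(\<lambda>n. \<integral>\<^sup>+z. norm (F n z - f z) \<partial>lborel) \<longlonglongrightarrow> 0"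
      by (rule tendsto_sandwich[OF _ _ tendsto_const lim]) (use split in \<open>auto intro!: always_eventually\<close>)
    then show "(\<lambda>h. \<integral>\<^sup>+z\<in>U. norm (w z * \<phi> (norm (directional_jacobian e (B (r h)) z)) - w z * \<phi> (norm (D z))) \<partial>lborel) \<longlonglongrightarrow> 0"
      by (simp only: nF)
  qed
qed

section \<open>Space slices and Lebesgue measure\<close>

text \<open>\<open>Db\<close> is only Lebesgue measurable, whereas Fubini is applied to the product
  of the Borel measures \<open>lborel\<close>. The real-valued case is applied to each
  coordinate.\<close>

lemma lebesgue_borel_representative:
  fixes g :: "'a::euclidean_space \<Rightarrow> 'b::euclidean_space"
  assumes "g \<in> borel_measurable lebesgue"
  obtains G where "G \<in> borel_measurable borel" "AE z in lborel. g z = G z"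
proof -
  have "\<exists>h. h \<in> borel_measurable borel \<and> (AE z in lborel. g z \<bullet> i = h z)" for i
  proof -
    have "(\<lambda>z. g z \<bullet> i) \<in> borel_measurable lebesgue"
      by (intro borel_measurable_inner assms borel_measurable_const)
    from completion_ex_borel_measurable_real[OF this] show ?thesis by auto
  qed
  then obtain h where h: "\<And>i. h i \<in> borel_measurable borel" "\<And>i. AE z in lborel. g z \<bullet> i = h i z"
    by metis
  show ?thesis
  proof (rule that)
    show "(\<lambda>z. \<Sum>i\<in>Basis. h i z *\<^sub>R i) \<in> borel_measurable borel"
      by (intro borel_measurable_sum borel_measurable_scaleR h borel_measurable_const)
    have "AE z in lborel. \<forall>i\<in>Basis. g z \<bullet> i = h i z"
      by (rule AE_finite_allI[OF finite_Basis h(2)])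
    then show "AE z in lborel. g z = (\<Sum>i\<in>Basis. h i z *\<^sub>R i)"
    proof eventually_elim
      case (elim z)
      have "(\<Sum>i\<in>Basis. h i z *\<^sub>R i) = (\<Sum>i\<in>Basis. (g z \<bullet> i) *\<^sub>R i)"
        by (rule sum.cong) (use elim in auto)
      then show ?case by (simp add: euclidean_representation)
    qed
  qed
qed

text \<open>Carries the estimates, obtained as nonnegative integrals over \<open>lborel\<close> with
  a Borel representative \<open>G\<close>, over to the Bochner integrals over
  \<open>lebesgue\<close> in the definition of convergence.\<close>

lemma L1_convergesI:
  fixes f :: "nat \<Rightarrow> 'a::euclidean_space \<Rightarrow> 'b::euclidean_space"
  assumes f: "\<And>h. (\<lambda>z. indicator S z *\<^sub>R f h z) \<in> borel_measurable borel"
    and G: "integrable lborel (\<lambda>z. indicator S z *\<^sub>R G z)"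
    and g: "AE z in lborel. z \<in> S \<longrightarrow> g z = G z"
    and fin: "\<And>h. (\<integral>\<^sup>+z\<in>S. norm (f h z - G z) \<partial>lborel) < \<infinity>"
    and lim: "(\<lambda>h. \<integral>\<^sup>+z\<in>S. norm (f h z - G z) \<partial>lborel) \<longlonglongrightarrow> 0"
  shows "L1_converges S f g"
proof -
  define d where "d h z = indicator S z *\<^sub>R f h z - indicator S z *\<^sub>R G z" for h z
  have Gm: "(\<lambda>z. indicator S z *\<^sub>R G z) \<in> borel_measurable borel" using G by auto
  have dm[measurable]: "d h \<in> borel_measurable borel" for h
    unfolding d_def[abs_def] by (intro borel_measurable_diff f Gm)
  have nd: "ennreal (norm (d h z)) = ennreal (norm (f h z - G z)) * indicator S z" for h z
    by (cases "z \<in> S") (auto simp: d_def)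
  have di: "integrable lborel (d h)" for h
    using fin[of h] by (intro integrableI_bounded) (simp_all add: nd)
  have fi: "integrable lborel (\<lambda>z. indicator S z *\<^sub>R f h z)" for h
    using Bochner_Integration.integrable_add[OF di[of h] G] by (simp add: d_def)
  have gAE: "AE z in lebesgue. indicator S z *\<^sub>R G z = indicator S z *\<^sub>R g z"
    by (rule AE_completion) (use g in \<open>auto elim!: eventually_mono simp: indicator_def\<close>)
  have Gm': "(\<lambda>z. indicator S z *\<^sub>R G z) \<in> borel_measurable lebesgue" using Gm by (simp add: measurable_completion)
  \<comment> \<open>Lebesgue measure is complete, so \<open>g\<close> inherits measurability from a
    function equal to it almost everywhere.\<close>
  have gm: "(\<lambda>z. indicator S z *\<^sub>R g z) \<in> borel_measurable lebesgue"
    by (rule borel_measurable_AE[OF Gm' gAE])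
  have gi: "g absolutely_integrable_on S"
    unfolding set_integrable_def using integrable_cong_AE[OF Gm' gm gAE] integrable_completion[of "\<lambda>z. indicator S z *\<^sub>R G z" lborel] Gm G by simp
  have fai: "f h absolutely_integrable_on S" for h
    unfolding set_integrable_def using integrable_completion[of "\<lambda>z. indicator S z *\<^sub>R f h z" lborel] f fi by simp
  have eq: "(LINT z:S|lebesgue. norm (f h z - g z)) = enn2real (\<integral>\<^sup>+z\<in>S. norm (f h z - G z) \<partial>lborel)" for h
  proof -
    have "(LINT z:S|lebesgue. norm (f h z - g z)) = (\<integral>z. norm (indicator S z *\<^sub>R f h z - indicator S z *\<^sub>R g z) \<partial>lebesgue)"
      unfolding set_lebesgue_integral_def
      by (rule Bochner_Integration.integral_cong) (auto simp: indicator_def)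
    also have "\<dots> = (\<integral>z. norm (d h z) \<partial>lebesgue)"
    proof (rule integral_cong_AE)
      show "(\<lambda>z. norm (indicator S z *\<^sub>R f h z - indicator S z *\<^sub>R g z)) \<in> borel_measurable lebesgue"
        by (rule measurable_compose[OF borel_measurable_diff[OF measurable_completion gm] borel_measurable_norm]) (simp add: f)
      show "(\<lambda>z. norm (d h z)) \<in> borel_measurable lebesgue"
        by (rule measurable_compose[OF measurable_completion borel_measurable_norm]) (simp add: dm)
      show "AE z in lebesgue. norm (indicator S z *\<^sub>R f h z - indicator S z *\<^sub>R g z) = norm (d h z)"
        using gAE by eventually_elim (simp only: d_def)
    qed
    also have "\<dots> = (\<integral>z. norm (d h z) \<partial>lborel)"
      by (rule integral_completion) measurable
    also have "\<dots> = enn2real (\<integral>\<^sup>+z. norm (d h z) \<partial>lborel)"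
      by (rule integral_eq_nn_integral) auto
    finally show ?thesis by (simp add: nd)
  qed
  have "(\<lambda>h. enn2real (\<integral>\<^sup>+z\<in>S. norm (f h z - G z) \<partial>lborel)) \<longlonglongrightarrow> 0"
    by (rule tendsto_enn2real) (use lim in simp_all)
  then show ?thesis
    unfolding L1_converges_def eq using fai gi by simp
qed

text \<open>A null set of the product has null slices at almost every time, so \<open>g\<close> can
  be exchanged for the Borel function \<open>G\<close> inside the iterated integral before Tonelli
  is applied.\<close>

lemma iterated_nn_integral_lebesgue:
  fixes g G :: "'a::euclidean_space \<times> 'b::euclidean_space \<Rightarrow> ennreal"
  assumes G: "(\<lambda>z. G z * indicator (I \<times> \<Omega>) z) \<in> borel_measurable borel"
    and g: "AE z in lborel. z \<in> I \<times> \<Omega> \<longrightarrow> g z = G z"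
  shows "(\<integral>\<^sup>+t\<in>I. (\<integral>\<^sup>+x\<in>\<Omega>. g (t, x) \<partial>lebesgue) \<partial>lebesgue) = (\<integral>\<^sup>+z\<in>I \<times> \<Omega>. G z \<partial>lborel)"
proof -
  have ae: "AE t in lborel. AE x in lborel. (t, x) \<in> I \<times> \<Omega> \<longrightarrow> g (t, x) = G (t, x)"
    by (rule lborel_pair.AE_pair) (unfold lborel_prod, rule g)
  have "(\<integral>\<^sup>+t\<in>I. (\<integral>\<^sup>+x\<in>\<Omega>. g (t, x) \<partial>lebesgue) \<partial>lebesgue) = (\<integral>\<^sup>+t\<in>I. (\<integral>\<^sup>+x\<in>\<Omega>. g (t, x) \<partial>lborel) \<partial>lborel)"
    by (simp add: nn_integral_completion)
  also have "\<dots> = (\<integral>\<^sup>+t. (\<integral>\<^sup>+x. G (t, x) * indicator (I \<times> \<Omega>) (t, x) \<partial>lborel) \<partial>lborel)"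
  proof (rule nn_integral_cong_AE)
    show "AE t in lborel. (\<integral>\<^sup>+x\<in>\<Omega>. g (t, x) \<partial>lborel) * indicator I t =
        (\<integral>\<^sup>+x. G (t, x) * indicator (I \<times> \<Omega>) (t, x) \<partial>lborel)"
      using ae
    proof eventually_elim
      case (elim t)
      show ?case
      proof (cases "t \<in> I")
        case True
        have "(\<integral>\<^sup>+x\<in>\<Omega>. g (t, x) \<partial>lborel) = (\<integral>\<^sup>+x. G (t, x) * indicator (I \<times> \<Omega>) (t, x) \<partial>lborel)"
          by (rule nn_integral_cong_AE) (use elim True in \<open>auto elim!: eventually_mono simp: indicator_def\<close>)
        then show ?thesis using True by simp
      qed simp
    qed
  qed
  also have "\<dots> = (\<integral>\<^sup>+z. G z * indicator (I \<times> \<Omega>) z \<partial>(lborel \<Otimes>\<^sub>M lborel))"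
    by (rule lborel.nn_integral_fst) (simp add: lborel_prod G)
  finally show ?thesis by (simp add: lborel_prod)
qed

section \<open>Time slices and the weak derivative on space-time\<close>

lemma bounded_linear_Pair_zero: "bounded_linear (\<lambda>x. (0, x))"
  by (intro bounded_linear_Pair bounded_linear_zero bounded_linear_ident)

lemma frechet_derivative_slice:
  fixes f :: "real \<times> 'a::real_normed_vector \<Rightarrow> 'b::real_normed_vector"
  assumes "f differentiable (at (t, x))"
  shows "frechet_derivative (\<lambda>y. f (t, y)) (at x) v = frechet_derivative f (at (t, x)) (0, v)"
  using frechet_derivative_comp_affine(2)[OF bounded_linear_Pair_zero, of f "(t, 0)" x v] assms by simp

text \<open>The support of a slice lies in the projection of the space-time support, which is
  compact and contained in \<Omega>.\<close>

lemma test_function_slice: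
  fixes \<psi> :: "real \<times> (real ^ 'n) \<Rightarrow> real"
  assumes \<psi>: "Cinf_on UNIV \<psi>" "compact (closure {z. \<psi> z \<noteq> 0})" "closure {z. \<psi> z \<noteq> 0} \<subseteq> I \<times> \<Omega>"
  shows "test_function \<Omega> (\<lambda>x. \<psi> (t, x))"
proof -
  have "Cinf_on UNIV (\<lambda>x. \<psi> (t, x))"
    using Ck_on_comp_affine[OF bounded_linear_Pair_zero, of _ \<psi> "(t, 0)"] \<psi>(1)
    by (simp add: Cinf_on_def)
  moreover have comp: "compact (snd ` closure {z. \<psi> z \<noteq> 0})"
    by (intro compact_continuous_image continuous_on_snd continuous_on_id \<psi>(2))
  have "{x. \<psi> (t, x) \<noteq> 0} \<subseteq> snd ` closure {z. \<psi> z \<noteq> 0}"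
  proof
    fix x assume "x \<in> {x. \<psi> (t, x) \<noteq> 0}"
    then have "(t, x) \<in> closure {z. \<psi> z \<noteq> 0}" by (intro subsetD[OF closure_subset]) simp
    then show "x \<in> snd ` closure {z. \<psi> z \<noteq> 0}" by force
  qed
  then have cl: "closure {x. \<psi> (t, x) \<noteq> 0} \<subseteq> snd ` closure {z. \<psi> z \<noteq> 0}"
    by (rule closure_minimal) (rule compact_imp_closed[OF comp])
  moreover have "compact (closure {x. \<psi> (t, x) \<noteq> 0})"
    using compact_Int_closed[OF comp closed_closure[of "{x. \<psi> (t, x) \<noteq> 0}"]] cl by (simp add: inf.absorb2)
  moreover have "snd ` closure {z. \<psi> z \<noteq> 0} \<subseteq> \<Omega>" using \<psi>(3) by auto
  ultimately show ?thesis unfolding test_function_def by blast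
qed

text \<open>Each slice of \<psi> is a test function on \<Omega>, so the weak identity holds at
  almost every time; Fubini integrates it over time. Both integrands must be integrable on
  space-time for that.\<close>

lemma weak_derivative_spacetime:
  fixes b :: "real \<times> (real ^ 'n) \<Rightarrow> real ^ 'm" and Db D :: "real \<times> (real ^ 'n) \<Rightarrow> real ^ 'n ^ 'm"
  assumes I: "open I" and \<Omega>: "open \<Omega>" and W: "L1loc_W11loc_deriv I \<Omega> b Db"
    and b: "continuous_on (I \<times> \<Omega>) b"
    and D: "D \<in> borel_measurable borel" "AE z in lborel. z \<in> I \<times> \<Omega> \<longrightarrow> Db z = D z"
    and D_int: "\<And>K. compact K \<Longrightarrow> K \<subseteq> I \<times> \<Omega> \<Longrightarrow> integrable lborel (\<lambda>z. indicator K z *\<^sub>R D z)"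
    and \<psi>: "Cinf_on UNIV \<psi>" "compact (closure {z. \<psi> z \<noteq> 0})" "closure {z. \<psi> z \<noteq> 0} \<subseteq> I \<times> \<Omega>"
  shows "(LINT z:I \<times> \<Omega>|lborel. b z $ i * frechet_derivative \<psi> (at z) (0, axis j 1)) =
    - (LINT z:I \<times> \<Omega>|lborel. D z $ i $ j * \<psi> z)"
proof -
  define U where "U = I \<times> \<Omega>"
  have U: "open U" unfolding U_def by (intro open_Times I \<Omega>)
  define L where "L = closure {z. \<psi> z \<noteq> 0}"
  have L: "compact L" "L \<subseteq> U" using \<psi> by (auto simp: L_def U_def)
  have \<psi>0: "\<psi> z = 0" if "z \<notin> L" for z
  proof (rule ccontr)
    assume "\<psi> z \<noteq> 0"
    then have "z \<in> L" unfolding L_def by (intro subsetD[OF closure_subset]) simp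
    then show False using that by blast
  qed
  note diff = Cinf_onD(2)[OF \<psi>(1), simplified]
  define \<psi>' where "\<psi>' z = frechet_derivative \<psi> (at z) (0, axis j 1)" for z
  have \<psi>'0: "\<psi>' z = 0" if "z \<notin> L" for z
  proof -
    have "frechet_derivative \<psi> (at z) = frechet_derivative (\<lambda>_. 0) (at z)"
      by (rule frechet_derivative_transform_within_open[OF diff, of "- L"])
         (use that L(1) \<psi>0 in \<open>auto intro: compact_imp_closed\<close>)
    then show ?thesis by (simp add: \<psi>'_def)
  qed
  have c\<psi>': "continuous_on UNIV \<psi>'" unfolding \<psi>'_def[abs_def] by (rule Cinf_onD(4)[OF \<psi>(1)])
  define A where "A z = indicator U z *\<^sub>R (b z $ i * \<psi>' z)" for z
  \<comment> \<open>The indicator is absorbed by \<open>\<psi>'\<close>, which vanishes off the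
    compact \<open>L\<close>; so \<open>A\<close> is continuous everywhere although \<open>b\<close>
    is continuous on \<open>U\<close> only.\<close>
  have A_eq: "A = (\<lambda>z. \<psi>' z *\<^sub>R (b z $ i))"
    using \<psi>'0 L(2) by (auto simp: A_def fun_eq_iff indicator_def)
  have "continuous_on U (\<lambda>z. b z $ i)"
    using b unfolding U_def by (intro continuous_on_component)
  then have cA: "continuous_on UNIV A"
    unfolding A_eq by (rule continuous_on_UNIV_cutoff[OF U _ c\<psi>' L \<psi>'0])
  have A_int: "integrable lborel A"
    by (rule integrable_continuous_compact_support[OF cA L(1)]) (simp add: A_eq \<psi>'0)
  define E where "E z = indicator U z *\<^sub>R (D z $ i $ j * \<psi> z)" for z
  have "bounded (\<psi> ` L)"
    by (intro compact_imp_bounded compact_continuous_image L continuous_on_subset[OF Cinf_onD(1)[OF \<psi>(1)]]) auto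
  then obtain C where C: "\<And>z. z \<in> L \<Longrightarrow> norm (\<psi> z) \<le> C" unfolding bounded_iff by blast
  have \<psi>m[measurable]: "\<psi> \<in> borel_measurable borel"
    by (rule borel_measurable_continuous_onI[OF Cinf_onD(1)[OF \<psi>(1)]])
  have bl: "bounded_linear (\<lambda>M :: real ^ 'n ^ 'm. M $ i $ j)"
    by (rule bounded_linear_compose[OF bounded_linear_vec_nth bounded_linear_vec_nth])
  have Dij[measurable]: "(\<lambda>z. D z $ i $ j) \<in> borel_measurable borel"
    by (rule measurable_compose[OF D(1)])
       (rule borel_measurable_continuous_onI[OF linear_continuous_on[OF bl]])
  have Em: "E \<in> borel_measurable borel"
    unfolding E_def[abs_def] using U
    by (intro borel_measurable_scaleR borel_measurable_indicator borel_measurable_times Dij \<psi>m) auto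
  have E_int: "integrable lborel E"
  \<comment> \<open>The majorant is the maximum of the test function on its support \<open>L\<close>
    times the entry of \<open>D\<close>, integrable on compact sets.\<close>
  proof (rule Bochner_Integration.integrable_bound)
    show "integrable lborel (\<lambda>z. C *\<^sub>R ((indicator L z *\<^sub>R D z) $ i $ j))"
      using integrable_bounded_linear[OF bl D_int[of L]] L
      by (intro integrable_scaleR_right) (simp add: U_def)
    show "E \<in> borel_measurable lborel" using Em by simp
    show "AE z in lborel. norm (E z) \<le> norm (C *\<^sub>R ((indicator L z *\<^sub>R D z) $ i $ j))"
    proof (rule AE_I2)
      fix z
      show "norm (E z) \<le> norm (C *\<^sub>R ((indicator L z *\<^sub>R D z) $ i $ j))"
      proof (cases "z \<in> L")
        case True
        have "norm (\<psi> z) \<le> norm C" using C[OF True] by simp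
        from mult_right_mono[OF this, of "norm (D z $ i $ j)"] show ?thesis
          using True L(2) by (auto simp: E_def abs_mult mult.commute)
      next
        case False
        then show ?thesis by (simp add: E_def \<psi>0)
      qed
    qed
  qed
  have slice: "AE t in lborel. (\<integral>x. A (t, x) \<partial>lborel) = - (\<integral>x. E (t, x) \<partial>lborel)"
  proof -
    have 1: "AE t in lborel. t \<in> I \<longrightarrow> W11loc_deriv \<Omega> (\<lambda>x. b (t, x)) (\<lambda>x. Db (t, x))"
      using W unfolding L1loc_W11loc_deriv_def by (simp add: AE_completion_iff)
    have 2: "AE t in lborel. AE x in lborel. (t, x) \<in> I \<times> \<Omega> \<longrightarrow> Db (t, x) = D (t, x)"
      by (rule lborel_pair.AE_pair) (unfold lborel_prod, rule D(2))
    from 1 2 show ?thesis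
    proof eventually_elim
      case (elim t)
      show ?case
      proof (cases "t \<in> I")
        case False
        then show ?thesis by (simp add: A_def E_def U_def)
      next
        case True
        let ?lhs = "LINT x:\<Omega>|lebesgue. b (t, x) $ i * frechet_derivative (\<lambda>x. \<psi> (t, x)) (at x) (axis j 1)"
        let ?rhs = "LINT x:\<Omega>|lebesgue. Db (t, x) $ i $ j * \<psi> (t, x)"
        have eq: "?lhs = - ?rhs"
          using elim(1) True test_function_slice[OF \<psi>, of t] unfolding W11loc_deriv_def by blast
        have Am: "(\<lambda>x. A (t, x)) \<in> borel_measurable borel"
          by (rule borel_measurable_continuous_onI, rule continuous_on_compose2[OF cA])
             (auto intro!: continuous_intros)
        have Et: "(\<lambda>x. E (t, x)) \<in> borel_measurable borel"
          by (rule measurable_compose[OF _ Em]) (auto intro!: borel_measurable_continuous_onI continuous_intros)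
        have "?lhs = (\<integral>x. A (t, x) \<partial>lebesgue)"
          unfolding set_lebesgue_integral_def using True
          by (intro Bochner_Integration.integral_cong)
             (auto simp: A_def U_def \<psi>'_def frechet_derivative_slice[OF diff] indicator_def)
        also have "\<dots> = (\<integral>x. A (t, x) \<partial>lborel)"
          by (rule integral_completion) (simp add: Am)
        finally have l: "?lhs = (\<integral>x. A (t, x) \<partial>lborel)" .
        have ae: "AE x in lebesgue. E (t, x) = indicator \<Omega> x *\<^sub>R (Db (t, x) $ i $ j * \<psi> (t, x))"
          by (rule AE_completion) (use elim(2) True in \<open>auto elim!: eventually_mono simp: E_def U_def indicator_def\<close>)
        have Et': "(\<lambda>x. E (t, x)) \<in> borel_measurable lebesgue" using Et by (simp add: measurable_completion)
        have "?rhs = (\<integral>x. E (t, x) \<partial>lebesgue)"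
          unfolding set_lebesgue_integral_def
          by (rule integral_cong_AE[OF borel_measurable_AE[OF Et' ae] Et'])
             (use ae in \<open>auto elim!: eventually_mono\<close>)
        also have "\<dots> = (\<integral>x. E (t, x) \<partial>lborel)"
          by (rule integral_completion) (simp add: Et)
        finally show ?thesis using eq l by simp
      qed
    qed
  qed
  have "(\<integral>z. A z \<partial>lborel) = (\<integral>t. (\<integral>x. A (t, x) \<partial>lborel) \<partial>lborel)"
    using lborel_pair.integral_fst'[of A] A_int by (simp add: lborel_prod)
  also have "\<dots> = (\<integral>t. - (\<integral>x. E (t, x) \<partial>lborel) \<partial>lborel)"
  proof (rule integral_cong_AE[OF _ _ slice])
    show "(\<lambda>t. \<integral>x. A (t, x) \<partial>lborel) \<in> borel_measurable lborel"
      using lborel_pair.integrable_fst'[of A] A_int by (simp add: lborel_prod borel_measurable_integrable)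
    show "(\<lambda>t. - (\<integral>x. E (t, x) \<partial>lborel)) \<in> borel_measurable lborel"
      using lborel_pair.integrable_fst'[of E] E_int by (simp add: lborel_prod borel_measurable_integrable)
  qed
  also have "\<dots> = - (\<integral>z. E z \<partial>lborel)"
    using lborel_pair.integral_fst'[of E] E_int by (simp add: lborel_prod)
  finally show ?thesis
    by (simp add: set_lebesgue_integral_def A_def E_def U_def \<psi>'_def)
qed

lemma spatial_jacobian_eq_directional:
  fixes f :: "real \<times> (real ^ 'n) \<Rightarrow> real ^ 'm"
  assumes "f differentiable (at z)"
  shows "spatial_jacobian f z = directional_jacobian (\<lambda>j. (0, axis j 1)) f z"
  using assms
  by (cases z) (simp add: spatial_jacobian_def directional_jacobian_def jacobian_def matrix_def
      frechet_derivative_slice)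

theorem theorem1:
  fixes I :: "real set" and \<Omega> :: "(real ^ 'n) set"
    and w :: "real \<times> (real ^ 'n) \<Rightarrow> real" and \<phi> :: "real \<Rightarrow> real" and k :: real
    and b :: "real \<times> (real ^ 'n) \<Rightarrow> real ^ 'm"
    and Db :: "real \<times> (real ^ 'n) \<Rightarrow> real ^ 'n ^ 'm"
  assumes "open I" and "is_interval I" and "open \<Omega>"
    and "w \<in> borel_measurable (restrict_space borel (I \<times> \<Omega>))"
    and "\<And>z. z \<in> I \<times> \<Omega> \<Longrightarrow> 0 < w z"
    and "\<And>K. compact K \<Longrightarrow> K \<subseteq> I \<times> \<Omega> \<Longrightarrow> \<exists>c C. 0 < c \<and> c \<le> C \<and> (\<forall>z\<in>K. c \<le> w z \<and> w z \<le> C)"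
    and "\<And>a. 0 \<le> a \<Longrightarrow> 0 \<le> \<phi> a"
    and "convex_on {0..} \<phi>" and "\<phi> 0 = 0"
    and "0 < k"
    and "\<And>a c. 0 \<le> a \<Longrightarrow> 0 \<le> c \<Longrightarrow> \<phi> (a + c) \<le> k * (\<phi> a * \<phi> c + \<phi> a + \<phi> c)"
    and "L1loc_W11loc_deriv I \<Omega> b Db"
    and "continuous_on (I \<times> \<Omega>) b"
    and "N_functional I \<Omega> \<phi> w (\<lambda>z. norm (Db z)) < \<infinity>"
  shows "\<exists>bh :: nat \<Rightarrow> real \<times> (real ^ 'n) \<Rightarrow> real ^ 'm.
    (\<forall>h. Cinf_on (I \<times> \<Omega>) (bh h)) \<and>
    L1loc_converges (I \<times> \<Omega>) bh b \<and>
    L1loc_converges (I \<times> \<Omega>) (\<lambda>h. spatial_jacobian (bh h)) Db \<and>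
    L1_converges (I \<times> \<Omega>) (\<lambda>h z. w z * \<phi> (norm (spatial_jacobian (bh h) z)))
      (\<lambda>z. w z * \<phi> (norm (Db z))) \<and>
    (\<lambda>h. N_functional I \<Omega> \<phi> w (\<lambda>z. norm (spatial_jacobian (bh h) z)))
      \<longlonglongrightarrow> N_functional I \<Omega> \<phi> w (\<lambda>z. norm (Db z))"
proof -
  define U where "U = I \<times> \<Omega>"
  define e :: "'n \<Rightarrow> real \<times> (real ^ 'n)" where "e = (\<lambda>j. (0, axis j 1))"
  have U: "open U" unfolding U_def using assms(1,3) by (rule open_Times)
  have Um[measurable]: "U \<in> sets borel" using U by auto
  note \<phi> = assms(8,9,7)
  \<comment> \<open>\<open>Db\<close> is measurable on \<open>U\<close> only; extension by zero
    gives a function on the whole space that has a Borel representative.\<close>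
  have "(\<lambda>z. if z \<in> U then Db z else 0) \<in> borel_measurable lebesgue"
    using assms(12) by (subst borel_measurable_if) (auto simp: L1loc_W11loc_deriv_def U_def[symmetric])
  then obtain D where D[measurable]: "D \<in> borel_measurable borel"
    and "AE z in lborel. (if z \<in> U then Db z else 0) = D z"
    by (rule lebesgue_borel_representative)
  then have Dae: "AE z in lborel. z \<in> U \<longrightarrow> Db z = D z" by (auto elim!: eventually_mono)
  have D_int: "integrable lborel (\<lambda>z. indicator K z *\<^sub>R D z)" if K: "compact K" "K \<subseteq> U" for K
  proof (rule integrableI_bounded)
    have Km[measurable]: "K \<in> sets borel" using K(1) by (simp add: borel_compact)
    show "(\<lambda>z. indicator K z *\<^sub>R D z) \<in> borel_measurable lborel" by measurable
    \<comment> \<open>The hypothesis bounds integrals over products of compact sets, so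
      \<open>K\<close> is enclosed in the product of its projections, which still lies in
      \<open>U\<close>.\<close>
    define J where "J = fst ` K"
    define X where "X = snd ` K"
    have J: "compact J" "J \<subseteq> I" and X: "compact X" "X \<subseteq> \<Omega>"
      using K unfolding J_def X_def U_def
      by (auto intro!: compact_continuous_image continuous_on_fst continuous_on_snd continuous_on_id)
    have KJX: "K \<subseteq> J \<times> X"
      unfolding J_def X_def by (auto simp: image_iff) force+
    have JX[measurable]: "J \<times> X \<in> sets borel" using compact_Times[OF J(1) X(1)] by (simp add: borel_compact)
    have "(\<integral>\<^sup>+z. ennreal (norm (indicator K z *\<^sub>R D z)) \<partial>lborel) \<le> (\<integral>\<^sup>+z\<in>J \<times> X. norm (D z) \<partial>lborel)"
      by (rule nn_integral_mono) (use KJX in \<open>auto simp: indicator_def\<close>)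
    also have "\<dots> = (\<integral>\<^sup>+t\<in>J. (\<integral>\<^sup>+x\<in>X. norm (Db (t, x)) \<partial>lebesgue) \<partial>lebesgue)"
    proof (rule iterated_nn_integral_lebesgue[symmetric])
      show "(\<lambda>z. ennreal (norm (D z)) * indicator (J \<times> X) z) \<in> borel_measurable borel" by measurable
      show "AE z in lborel. z \<in> J \<times> X \<longrightarrow> ennreal (norm (Db z)) = ennreal (norm (D z))"
        using Dae by eventually_elim (use J X in \<open>auto simp: U_def\<close>)
    qed
    also have "\<dots> \<le> (\<integral>\<^sup>+t\<in>J. W11_norm X (\<lambda>x. b (t, x)) (\<lambda>x. Db (t, x)) \<partial>lebesgue)"
      by (intro nn_integral_mono mult_right_mono) (auto simp: W11_norm_def)
    also have "\<dots> < \<infinity>"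
      using assms(12) J X unfolding L1loc_W11loc_deriv_def by blast
    finally show "(\<integral>\<^sup>+z. ennreal (norm (indicator K z *\<^sub>R D z)) \<partial>lborel) < \<infinity>" .
  qed
  have wm[measurable]: "(\<lambda>z. indicator U z * w z) \<in> borel_measurable borel"
    using assms(4) borel_measurable_restrict_space_iff[of U borel w] by (simp add: U_def[symmetric])
  have \<phi>m: "(\<lambda>z. \<phi> (norm (f z))) \<in> borel_measurable borel"
    if "f \<in> borel_measurable borel" for f :: "real \<times> (real ^ 'n) \<Rightarrow> real ^ 'n ^ 'm"
    by (rule borel_measurable_convex_nonneg[OF \<phi>]) (use that in auto)
  have wpos: "0 \<le> w z * \<phi> (norm (M :: real ^ 'n ^ 'm))" if "z \<in> U" for z M
    using assms(5)[of z] \<phi>(3)[of "norm M"] that by (simp add: U_def less_imp_le)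
  have w\<phi>m: "(\<lambda>z. indicator U z * (w z * \<phi> (norm (f z)))) \<in> borel_measurable borel"
    if "(\<lambda>z. indicator U z *\<^sub>R f z) \<in> borel_measurable borel" for f :: "real \<times> (real ^ 'n) \<Rightarrow> real ^ 'n ^ 'm"
  proof -
    have "(\<lambda>z. (indicator U z * w z) * \<phi> (norm (indicator U z *\<^sub>R f z))) \<in> borel_measurable borel"
      by (intro borel_measurable_times wm \<phi>m that)
    also have "(\<lambda>z. (indicator U z * w z) * \<phi> (norm (indicator U z *\<^sub>R f z))) =
        (\<lambda>z. indicator U z * (w z * \<phi> (norm (f z))))"
      by (auto simp: fun_eq_iff indicator_def)
    finally show ?thesis .
  qed
  \<comment> \<open>Makes the functional an integral over space-time of a Borel representative. It
    is used for \<open>Db\<close> with \<open>D\<close>, and for each smooth jacobian with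
    itself.\<close>
  have N_eq: "N_functional I \<Omega> \<phi> w (\<lambda>z. norm (g z)) = (\<integral>\<^sup>+z. ennreal (indicator U z * (w z * \<phi> (norm (f z)))) \<partial>lborel)"
    if "(\<lambda>z. indicator U z *\<^sub>R f z) \<in> borel_measurable borel" "AE z in lborel. z \<in> U \<longrightarrow> g z = f z"
    for f g :: "real \<times> (real ^ 'n) \<Rightarrow> real ^ 'n ^ 'm"
  proof -
    have ind: "ennreal (w z * \<phi> (norm (f z))) * indicator U z = ennreal (indicator U z * (w z * \<phi> (norm (f z))))" for z
      by (cases "z \<in> U") auto
    have "N_functional I \<Omega> \<phi> w (\<lambda>z. norm (g z)) = (\<integral>\<^sup>+z\<in>I \<times> \<Omega>. ennreal (w z * \<phi> (norm (f z))) \<partial>lborel)"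
      unfolding N_functional_def
      by (rule iterated_nn_integral_lebesgue[where g="\<lambda>z. ennreal (w z * \<phi> (norm (g z)))"])
         (use w\<phi>m[OF that(1)] that(2) in \<open>auto simp: U_def[symmetric] ind elim!: eventually_mono\<close>)
    then show ?thesis by (simp add: U_def[symmetric] ind)
  qed
  have DUm: "(\<lambda>z. indicator U z *\<^sub>R D z) \<in> borel_measurable borel" by measurable
  have w_int: "integrable lborel (\<lambda>z. indicator U z * (w z * \<phi> (norm (D z))))"
  proof (rule integrableI_bounded)
    have "norm (indicator U z * (w z * \<phi> (norm (D z)))) = indicator U z * (w z * \<phi> (norm (D z)))" for z
      using wpos[of z "D z"] by (cases "z \<in> U") simp_all
    then show "(\<integral>\<^sup>+z. ennreal (norm (indicator U z * (w z * \<phi> (norm (D z))))) \<partial>lborel) < \<infinity>"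
      using assms(14) N_eq[OF DUm Dae] by simp
  qed (use w\<phi>m[OF DUm] in simp)
  have weak: "(LINT z:U|lborel. b z $ i * frechet_derivative \<psi> (at z) (e j)) = - (LINT z:U|lborel. D z $ i $ j * \<psi> z)"
    if "Cinf_on UNIV \<psi>" "compact (closure {z. \<psi> z \<noteq> 0})" "closure {z. \<psi> z \<noteq> 0} \<subseteq> U" for \<psi> i j
    unfolding U_def e_def
    by (rule weak_derivative_spacetime[OF assms(1,3,12,13) D _ D_int])
       (use Dae that in \<open>simp_all add: U_def\<close>)
  have cb: "continuous_on U b" unfolding U_def by (rule assms(13))
  have w2: "0 < w z" if "z \<in> U" for z using assms(5) that by (simp add: U_def)
  have w3: "\<exists>c C. 0 < c \<and> c \<le> C \<and> (\<forall>z\<in>K. c \<le> w z \<and> w z \<le> C)" if "compact K" "K \<subseteq> U" for K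
    using assms(6) that by (simp add: U_def)
  obtain B where B: "\<And>h. Cinf_on U (B h)" "\<And>h z. z \<in> U \<Longrightarrow> norm (B h z - b z) \<le> inverse (real (Suc h))"
    "\<And>h. (\<integral>\<^sup>+z\<in>U. norm (directional_jacobian e (B h) z - D z) \<partial>lborel) \<le> ennreal (2 * inverse (real (Suc h)))"
    "\<And>h. (\<integral>\<^sup>+z\<in>U. norm (w z * \<phi> (norm (directional_jacobian e (B h) z)) - w z * \<phi> (norm (D z))) \<partial>lborel) < \<infinity>"
    "(\<lambda>h. \<integral>\<^sup>+z\<in>U. norm (w z * \<phi> (norm (directional_jacobian e (B h) z)) - w z * \<phi> (norm (D z))) \<partial>lborel) \<longlonglongrightarrow> 0"
    by (rule smooth_approximation[OF U cb D D_int weak \<phi> assms(10,11) wm w2 w3 w_int])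
      (assumption | rule that)+
  define J where "J h = spatial_jacobian (B h)" for h
  have J: "J h z = directional_jacobian e (B h) z" if "z \<in> U" for h z
    unfolding J_def e_def by (rule spatial_jacobian_eq_directional) (rule Cinf_onD(2)[OF B(1) that])
  have JUm: "(\<lambda>z. indicator U z *\<^sub>R J h z) \<in> borel_measurable borel" for h
  proof -
    have "(\<lambda>z. indicator U z *\<^sub>R directional_jacobian e (B h) z) \<in> borel_measurable borel"
      by (rule borel_measurable_continuous_on_indicator[OF Um continuous_on_directional(2)[OF B(1)]])
    also have "(\<lambda>z. indicator U z *\<^sub>R directional_jacobian e (B h) z) = (\<lambda>z. indicator U z *\<^sub>R J h z)"
      by (auto simp: fun_eq_iff indicator_def J)
    finally show ?thesis .
  qed
  have inv_lim: "(\<lambda>h. ennreal (c * inverse (real (Suc h)))) \<longlonglongrightarrow> 0" for c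
    using tendsto_ennrealI[OF tendsto_mult_left[OF LIMSEQ_inverse_real_of_nat, of c]] by simp
  have conv_b: "L1_converges K B b" if K: "compact K" "K \<subseteq> U" for K
  proof (rule L1_convergesI)
    have Km[measurable]: "K \<in> sets borel" using K(1) by (simp add: borel_compact)
    show "(\<lambda>z. indicator K z *\<^sub>R B h z) \<in> borel_measurable borel" for h
      by (rule borel_measurable_continuous_on_indicator[OF Km continuous_on_subset[OF Cinf_onD(1)[OF B(1)] K(2)]])
    show "integrable lborel (\<lambda>z. indicator K z *\<^sub>R b z)"
      by (rule borel_integrable_compact[OF K(1) continuous_on_subset[OF cb K(2)]])
    have em: "emeasure lborel K < \<infinity>" by (rule emeasure_compact_finite[OF K(1)])
    then have emK: "emeasure lborel K = ennreal (measure lborel K)"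
      by (intro emeasure_eq_ennreal_measure) auto
    \<comment> \<open>Uniform closeness on \<open>U\<close> becomes L1 closeness on \<open>K\<close>
      because \<open>K\<close> has finite volume.\<close>
    have le: "(\<integral>\<^sup>+z\<in>K. norm (B h z - b z) \<partial>lborel) \<le> ennreal (measure lborel K * inverse (real (Suc h)))" for h
    proof -
      have "(\<integral>\<^sup>+z\<in>K. norm (B h z - b z) \<partial>lborel) \<le> (\<integral>\<^sup>+z. ennreal (inverse (real (Suc h))) * indicator K z \<partial>lborel)"
      proof (rule nn_integral_mono)
        fix z
        show "ennreal (norm (B h z - b z)) * indicator K z \<le> ennreal (inverse (real (Suc h))) * indicator K z"
          using ennreal_leI[OF B(2)[of z h]] K(2) by (cases "z \<in> K") auto
      qed
      also have "\<dots> = ennreal (inverse (real (Suc h))) * emeasure lborel K"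
        by (rule nn_integral_cmult_indicator) simp
      also have "\<dots> = ennreal (measure lborel K * inverse (real (Suc h)))"
        by (simp add: emK ennreal_mult'' mult.commute)
      finally show ?thesis .
    qed
    show "(\<integral>\<^sup>+z\<in>K. norm (B h z - b z) \<partial>lborel) < \<infinity>" for h
      using le_less_trans[OF le ennreal_less_top] by simp
    show "(\<lambda>h. \<integral>\<^sup>+z\<in>K. norm (B h z - b z) \<partial>lborel) \<longlonglongrightarrow> 0"
      by (rule tendsto_sandwich[OF _ _ tendsto_const inv_lim]) (use le in \<open>auto intro!: always_eventually\<close>)
  qed simp
  have conv_J: "L1_converges K J Db" if K: "compact K" "K \<subseteq> U" for K
  proof (rule L1_convergesI)
    have Km: "K \<in> sets borel" using K(1) by (simp add: borel_compact)
    show "(\<lambda>z. indicator K z *\<^sub>R J h z) \<in> borel_measurable borel" for h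
    proof -
      have "(\<lambda>z. indicator K z *\<^sub>R (indicator U z *\<^sub>R J h z)) \<in> borel_measurable borel"
        by (intro borel_measurable_scaleR borel_measurable_indicator Km JUm)
      also have "(\<lambda>z. indicator K z *\<^sub>R (indicator U z *\<^sub>R J h z)) = (\<lambda>z. indicator K z *\<^sub>R J h z)"
        using K(2) by (auto simp: fun_eq_iff indicator_def)
      finally show ?thesis .
    qed
    show "integrable lborel (\<lambda>z. indicator K z *\<^sub>R D z)" by (rule D_int[OF K])
    show "AE z in lborel. z \<in> K \<longrightarrow> Db z = D z" using Dae by eventually_elim (use K(2) in auto)
    have le: "(\<integral>\<^sup>+z\<in>K. norm (J h z - D z) \<partial>lborel) \<le> ennreal (2 * inverse (real (Suc h)))" for h
    proof -
      have "(\<integral>\<^sup>+z\<in>K. norm (J h z - D z) \<partial>lborel) \<le> (\<integral>\<^sup>+z\<in>U. norm (directional_jacobian e (B h) z - D z) \<partial>lborel)"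
        by (rule nn_integral_mono) (use K(2) in \<open>auto simp: indicator_def J\<close>)
      then show ?thesis using B(3)[of h] by (rule order_trans)
    qed
    show "(\<integral>\<^sup>+z\<in>K. norm (J h z - D z) \<partial>lborel) < \<infinity>" for h
      using le_less_trans[OF le ennreal_less_top] by simp
    show "(\<lambda>h. \<integral>\<^sup>+z\<in>K. norm (J h z - D z) \<partial>lborel) \<longlonglongrightarrow> 0"
      by (rule tendsto_sandwich[OF _ _ tendsto_const inv_lim]) (use le in \<open>auto intro!: always_eventually\<close>)
  qed
  have nU: "(\<integral>\<^sup>+z\<in>U. norm (w z * \<phi> (norm (J h z)) - w z * \<phi> (norm (D z))) \<partial>lborel) =
      (\<integral>\<^sup>+z\<in>U. norm (w z * \<phi> (norm (directional_jacobian e (B h) z)) - w z * \<phi> (norm (D z))) \<partial>lborel)" for h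
    by (rule nn_integral_cong) (auto simp: indicator_def J)
  have conv_w: "L1_converges U (\<lambda>h z. w z * \<phi> (norm (J h z))) (\<lambda>z. w z * \<phi> (norm (Db z)))"
  proof (rule L1_convergesI[where G="\<lambda>z. w z * \<phi> (norm (D z))"])
    show "(\<lambda>z. indicator U z *\<^sub>R (w z * \<phi> (norm (J h z)))) \<in> borel_measurable borel" for h
      using w\<phi>m[OF JUm] by simp
    show "AE z in lborel. z \<in> U \<longrightarrow> w z * \<phi> (norm (Db z)) = w z * \<phi> (norm (D z))"
      using Dae by eventually_elim auto
  qed (use w_int B(4,5) nU in simp_all)
  have conv_N: "(\<lambda>h. N_functional I \<Omega> \<phi> w (\<lambda>z. norm (J h z))) \<longlonglongrightarrow> N_functional I \<Omega> \<phi> w (\<lambda>z. norm (Db z))"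
  proof -
    define F where "F h z = indicator U z * (w z * \<phi> (norm (J h z)))" for h z
    define f where "f z = indicator U z * (w z * \<phi> (norm (D z)))" for z
    have F0: "0 \<le> F h z" and f0: "0 \<le> f z" for h z
      using wpos[of z "J h z"] wpos[of z "D z"] by (cases "z \<in> U"; simp add: F_def f_def)+
    have nFf: "ennreal (norm (F h z - f z)) = ennreal (norm (w z * \<phi> (norm (J h z)) - w z * \<phi> (norm (D z)))) * indicator U z" for h z
      by (cases "z \<in> U") (auto simp: F_def f_def)
    have Fm: "F h \<in> borel_measurable borel" for h unfolding F_def[abs_def] by (rule w\<phi>m[OF JUm])
    have fi: "integrable lborel f" unfolding f_def[abs_def] by (rule w_int)
    have "integrable lborel (\<lambda>z. F h z - f z)" for h
      by (rule integrableI_bounded) (use Fm fi B(4)[of h] nU in \<open>simp_all add: nFf del: real_norm_def\<close>)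
    from Bochner_Integration.integrable_add[OF this fi] have Fi: "integrable lborel (F h)" for h by simp
    \<comment> \<open>L1 convergence gives convergence of the real integrals; nonnegativity then
      identifies them with the extended values of the functional.\<close>
    have "(\<lambda>h. \<integral>z. F h z \<partial>lborel) \<longlonglongrightarrow> (\<integral>z. f z \<partial>lborel)"
      by (rule tendsto_L1_int[OF Fi fi]) (use B(5) nU in \<open>simp add: nFf del: real_norm_def\<close>)
    from tendsto_ennrealI[OF this] have "(\<lambda>h. \<integral>\<^sup>+z. ennreal (F h z) \<partial>lborel) \<longlonglongrightarrow> (\<integral>\<^sup>+z. ennreal (f z) \<partial>lborel)"
      using F0 f0 by (simp add: nn_integral_eq_integral[OF Fi] nn_integral_eq_integral[OF fi])
    moreover have "N_functional I \<Omega> \<phi> w (\<lambda>z. norm (J h z)) = (\<integral>\<^sup>+z. ennreal (F h z) \<partial>lborel)" for h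
      unfolding F_def by (rule N_eq[OF JUm]) simp
    ultimately show ?thesis
      using N_eq[OF DUm Dae] by (simp add: f_def)
  qed
  show ?thesis
    by (rule exI[of _ B])
       (use B(1) conv_b conv_J conv_w conv_N in
         \<open>simp add: L1loc_converges_def J_def[abs_def] U_def[symmetric]\<close>)
qed

end
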